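(* Let $(Y,\nu)$ be a standard probability space, possibly with atoms, and let $(X,\mu)=(Y\times 2^{\mathbb N},\nu\times\lambda)$, where $\lambda$ is the Bernoulli $(1/2,1/2)$ product measure on $2^{\mathbb N}=\{0,1\}^{\mathbb N}$. Let $(Y_k)_{k\in\mathbb N}$ be a measurable partition of $Y$. Let $\mathcal R_0^Y=\Delta_Y\times\mathcal R_0$ be the pmp equivalence relation on $(X,\mu)$ defined by $$(x,x')\,\mathcal R_0^Y\,(y,y')\iff x=y\ \text{ and }\ x'\,\mathcal R_0\,y'.$$ Then there exists $U\in[\mathcal R_0^Y]$ whose support is contained in $Z=\bigsqcup_{k\in\mathbb N}Y_k\times(N_{0^{k+1}}\cup N_{1^{k+1}})$ such that the following properties hold for all integers $m\geq 0$: (I) The full group $[\mathcal R_0^Y]$ is topologically generated by $T=\mathrm{id}_Y\times T_0$ and $U^{2^m}$, where $T_0$ is the odometer. (II) For every odd cycle $C\in\mathrm{Aut}(X,\mu)$ whose support is disjoint from the support of $U^{2^m}$, the closed group generated by $CU^{2^m}$ contains $U^{2^m}$.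
   Context: Everything is understood modulo null sets. $\mathrm{Aut}(X,\mu)$ is the group of measure-preserving Borel bijections of $X$ up to null sets, with the uniform metric $d_u(S,S')=\mu(\{x:S(x)\neq S'(x)\})$; closures and topological generation (generating a dense subgroup) refer to this metric. The support of $S$ is $\{x:S(x)\neq x\}$. The full group of a pmp equivalence relation $\mathcal R$ is $[\mathcal R]=\{S\in\mathrm{Aut}(X,\mu):S(x)\,\mathcal R\,x\text{ for a.e. }x\}$. A cycle is an element of $\mathrm{Aut}(X,\mu)$ having only finite orbits; it is odd if all its orbits have odd cardinality. $\mathcal R_0$ is the equivalence relation on $(2^{\mathbb N},\lambda)$ given by $(x_i)\,\mathcal R_0\,(y_i)$ iff there is $n$ with $x_i=y_i$ for all $i\geq n$. For a finite word $s\in\{0,1\}^n$, $N_s\subseteq 2^{\mathbb N}$ is the set of sequences whose first $n$ terms are given by $s$; for $\epsilon\in\{0,1\}$, $\epsilon^n$ is the word of length $n$ all of whose letters are $\epsilon$. The odometer $T_0\in\mathrm{Aut}(2^{\mathbb N},\lambda)$ sends $(x_i)_{i\ge1}$ to $0^{n-1}1$ followed by $(x_i)_{i>n}$, where $n$ is the first index with $x_n=0$ (addition of $(1,0,0,\dots)$ with right carry). *)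

theory Defs
  imports "HOL-Probability.Probability" "HOL-Algebra.Algebra"
begin

text \<open>Standard Borel spaces: the measurable sets are the Borel sets of some Polish topology
  on the underlying set.\<close>

definition standard_borel_space :: "'a measure \<Rightarrow> bool" where
  "standard_borel_space M \<longleftrightarrow>
     (\<exists>\<T>. completely_metrizable_space \<T> \<and> separable_space \<T> \<and> topspace \<T> = space M \<and>
          sets M = sigma_sets (space M) {V. openin \<T> V})"

definition standard_prob_space :: "'a measure \<Rightarrow> bool" where
  "standard_prob_space M \<longleftrightarrow> standard_borel_space M \<and> prob_space M"

text \<open>Elements of the automorphism group are represented by honest Borel automorphisms of the
  underlying set (extensional functions, as in \<open>BijGroup\<close>), and two representatives that agree
  almost everywhere are not identified. Instead, every notion below is invariant under changing
  a representative on a null set; in particular \<open>unif_dist\<close> is a pseudometric whose metric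
  quotient is the automorphism group modulo null sets, so \<open>unif_closure\<close> is the preimage of the
  closure taken in that quotient.\<close>

definition mp_auts :: "'a measure \<Rightarrow> ('a \<Rightarrow> 'a) set" where
  "mp_auts M = {S \<in> Bij (space M). S \<in> measurable M M \<and>
                  inv_into (space M) S \<in> measurable M M \<and> distr M M S = M}"

definition mp_aut_group :: "'a measure \<Rightarrow> ('a \<Rightarrow> 'a) monoid" where
  "mp_aut_group M = BijGroup (space M) \<lparr>carrier := mp_auts M\<rparr>"

definition unif_dist :: "'a measure \<Rightarrow> ('a \<Rightarrow> 'a) \<Rightarrow> ('a \<Rightarrow> 'a) \<Rightarrow> real" where
  "unif_dist M S S' = measure M {x \<in> space M. S x \<noteq> S' x}"

definition unif_closure :: "'a measure \<Rightarrow> ('a \<Rightarrow> 'a) set \<Rightarrow> ('a \<Rightarrow> 'a) set" where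
  "unif_closure M A = {S \<in> mp_auts M. \<forall>\<epsilon>>0. \<exists>S'\<in>A. unif_dist M S S' < \<epsilon>}"

definition closed_group_generated :: "'a measure \<Rightarrow> ('a \<Rightarrow> 'a) set \<Rightarrow> ('a \<Rightarrow> 'a) set" where
  "closed_group_generated M A = unif_closure M (generate (mp_aut_group M) A)"

text \<open>A set of automorphisms topologically generates \<open>G\<close> if it generates a dense subgroup of
  \<open>G\<close>.\<close>

definition topologically_generates ::
    "'a measure \<Rightarrow> ('a \<Rightarrow> 'a) set \<Rightarrow> ('a \<Rightarrow> 'a) set \<Rightarrow> bool" where
  "topologically_generates M A G \<longleftrightarrow>
     generate (mp_aut_group M) A \<subseteq> G \<and> G \<subseteq> closed_group_generated M A"

definition supp :: "'a measure \<Rightarrow> ('a \<Rightarrow> 'a) \<Rightarrow> 'a set" where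
  "supp M S = {x \<in> space M. S x \<noteq> x}"

definition full_group :: "'a measure \<Rightarrow> ('a \<times> 'a) set \<Rightarrow> ('a \<Rightarrow> 'a) set" where
  "full_group M R = {S \<in> mp_auts M. AE x in M. (S x, x) \<in> R}"

definition orbit_of :: "'a measure \<Rightarrow> ('a \<Rightarrow> 'a) \<Rightarrow> 'a \<Rightarrow> 'a set" where
  "orbit_of M S x = range (\<lambda>n::int. (S [^]\<^bsub>mp_aut_group M\<^esub> n) x)"

definition is_cycle :: "'a measure \<Rightarrow> ('a \<Rightarrow> 'a) \<Rightarrow> bool" where
  "is_cycle M S \<longleftrightarrow> S \<in> mp_auts M \<and> (AE x in M. finite (orbit_of M S x))"

definition odd_cycle :: "'a measure \<Rightarrow> ('a \<Rightarrow> 'a) \<Rightarrow> bool" where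
  "odd_cycle M S \<longleftrightarrow> is_cycle M S \<and> (AE x in M. odd (card (orbit_of M S x)))"

definition ae_subset :: "'a measure \<Rightarrow> 'a set \<Rightarrow> 'a set \<Rightarrow> bool" where
  "ae_subset M A B \<longleftrightarrow> (AE x in M. x \<in> A \<longrightarrow> x \<in> B)"

definition ae_disjoint :: "'a measure \<Rightarrow> 'a set \<Rightarrow> 'a set \<Rightarrow> bool" where
  "ae_disjoint M A B \<longleftrightarrow> (AE x in M. \<not> (x \<in> A \<and> x \<in> B))"

text \<open>Pieces of a partition may be empty (or null).\<close>

definition ae_partition :: "'a measure \<Rightarrow> (nat \<Rightarrow> 'a set) \<Rightarrow> bool" where
  "ae_partition M P \<longleftrightarrow> (\<forall>k. P k \<in> sets M) \<and> (AE y in M. \<exists>!k. y \<in> P k)"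

text \<open>The letters 0 and 1 are \<open>False\<close> and \<open>True\<close>; coordinates are indexed from 0, so the first
  term of a sequence \<open>x\<close> is \<open>x 0\<close>.\<close>

definition cantor_measure :: "(nat \<Rightarrow> bool) measure" where
  "cantor_measure = PiM UNIV (\<lambda>_. measure_pmf (bernoulli_pmf (1/2)))"

definition cylinder :: "bool list \<Rightarrow> (nat \<Rightarrow> bool) set" where
  "cylinder s = {x. \<forall>i<length s. x i = s ! i}"

definition R0 :: "((nat \<Rightarrow> bool) \<times> (nat \<Rightarrow> bool)) set" where
  "R0 = {(x, y). \<exists>n. \<forall>i\<ge>n. x i = y i}"

text \<open>The constant sequence 1, where no index with letter 0 exists, is sent to the constant
  sequence 0, which makes the odometer a bijection everywhere.\<close>

definition odometer :: "(nat \<Rightarrow> bool) \<Rightarrow> (nat \<Rightarrow> bool)" where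
  "odometer x =
     (if \<exists>n. \<not> x n
      then (let n = (LEAST n. \<not> x n) in (\<lambda>i. if i < n then False else if i = n then True else x i))
      else (\<lambda>_. False))"

definition X_space :: "'a measure \<Rightarrow> ('a \<times> (nat \<Rightarrow> bool)) measure" where
  "X_space \<nu> = \<nu> \<Otimes>\<^sub>M cantor_measure"

definition R0Y ::
    "'a measure \<Rightarrow> (('a \<times> (nat \<Rightarrow> bool)) \<times> ('a \<times> (nat \<Rightarrow> bool))) set" where
  "R0Y \<nu> = {((x, x'), (y, y')). x \<in> space \<nu> \<and> x = y \<and> (x', y') \<in> R0}"

definition odometerY ::
    "'a measure \<Rightarrow> ('a \<times> (nat \<Rightarrow> bool)) \<Rightarrow> ('a \<times> (nat \<Rightarrow> bool))" where
  "odometerY \<nu> = (\<lambda>(y, x) \<in> space (X_space \<nu>). (y, odometer x))"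

definition Z_set :: "(nat \<Rightarrow> 'a set) \<Rightarrow> ('a \<times> (nat \<Rightarrow> bool)) set" where
  "Z_set P = (\<Union>k. P k \<times> (cylinder (replicate (k + 1) False) \<union> cylinder (replicate (k + 1) True)))"

end

theory Submission
  imports Defs "HOL-Number_Theory.Number_Theory"
begin

text \<open>\<open>U\<close> is a disjoint union of dyadic cycles \<open>U\<^sub>n\<close>. The cycle \<open>U\<^sub>n\<close> has order \<open>2 ^ (n + 1)\<close>, lives on
  a set of rapidly decreasing measure, and \<open>U\<^sub>n ^ (2 ^ n)\<close> exchanges, over a member of a countable
  generator of the Borel sets of \<open>Y\<close>, two words of length \<open>p n\<close> that are consecutive for the odometer.
  As \<open>U ^ (2 ^ n)\<close> is trivial on the earlier cycles, it is extremely close to this transposition.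
  Conjugating by \<open>T\<close> gives all adjacent transpositions, hence all permutations of words over the
  chosen set, in the limit. A Dynkin class argument then puts the restriction of any finite
  coordinate flip to any invariant set into the closed group, and such involutions suffice to undo an
  arbitrary element of the full group up to small measure.

  For odd cycles \<open>C\<close> disjoint from \<open>V = U ^ (2 ^ m)\<close>, take an odd \<open>k\<close> which is divisible by most
  orbit lengths of \<open>C\<close> and congruent to 1 modulo a high power of 2; then
  \<open>(C V) ^ k = C ^ k V ^ k\<close> is close to \<open>V\<close>.\<close>

section \<open>The group of measure-preserving automorphisms\<close>

text \<open>\<open>T\<close> acts trivially on \<open>Y\<close>, so all dependence on the fibre has
  to come from \<open>U\<close>: this is why words are exchanged over members of a generator of the
  Borel sets, each used again and again with longer words. Over the piece of index k, the set Z
  contains only sequences with k + 1 equal initial letters. Hence level n stays over finitely many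
  pieces and uses words that are constant up to their last letter; the position of the change also
  keeps the levels disjoint.

  An involution at each level would vanish in the square of \<open>U\<close>, and (I) would fail for
  m >= 1. A cycle of order 2 ^ (n + 1) is still visible in U ^ (2 ^ m) for every n >= m, so one
  \<open>U\<close> serves all m; and since its order is a power of 2, the exponents in (II) can be
  adjusted to it independently of the odd orbit lengths.

  Isolating level n by the power 2 ^ n leaves an error from all later levels, and this error is paid
  once for each of up to 4 ^ p n adjacent transpositions. The factor 4 in the growth of
  \<open>p\<close> absorbs this.\<close>

lemma mp_auts_space: "S \<in> mp_auts M \<Longrightarrow> x \<in> space M \<Longrightarrow> S x \<in> space M"
  by (auto simp: mp_auts_def measurable_space)

lemma mp_auts_meas [measurable_dest]: "S \<in> mp_auts M \<Longrightarrow> S \<in> M \<rightarrow>\<^sub>M M"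
  by (simp add: mp_auts_def)

lemma mp_auts_distr: "S \<in> mp_auts M \<Longrightarrow> distr M M S = M"
  by (simp add: mp_auts_def)

lemma mp_auts_inj: "S \<in> mp_auts M \<Longrightarrow> x \<in> space M \<Longrightarrow> y \<in> space M \<Longrightarrow> S x = S y \<longleftrightarrow> x = y"
  by (auto simp: mp_auts_def Bij_def bij_betw_def inj_on_eq_iff)

lemma mp_auts_ext: "S \<in> mp_auts M \<Longrightarrow> S \<in> extensional (space M)"
  by (simp add: mp_auts_def Bij_def)

lemma mp_auts_eqI:
  assumes "S \<in> mp_auts M" "S' \<in> mp_auts M" "\<And>x. x \<in> space M \<Longrightarrow> S x = S' x"
  shows "S = S'"
  using assms by (meson extensionalityI mp_auts_ext)

text \<open>Automorphisms are constructed from maps on the whole type together with a two-sided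
  inverse; \<open>restrict\<close> supplies the extensionality that \<open>Bij\<close>
  demands.\<close>

lemma mp_autsI:
  assumes "S \<in> M \<rightarrow>\<^sub>M M" "S' \<in> M \<rightarrow>\<^sub>M M"
    and "\<And>x. x \<in> space M \<Longrightarrow> S' (S x) = x" "\<And>x. x \<in> space M \<Longrightarrow> S (S' x) = x"
    and "distr M M S = M"
  shows "restrict S (space M) \<in> mp_auts M"
proof -
  let ?S = "restrict S (space M)"
  have bij: "bij_betw S (space M) (space M)"
    by (rule bij_betw_byWitness[where f' = S']) (use assms in \<open>auto simp: measurable_space\<close>)
  then have bij': "bij_betw ?S (space M) (space M)"
    by (simp add: bij_betw_def inj_on_def)
  have "inv_into (space M) ?S x = S' x" if "x \<in> space M" for x
    by (rule inv_into_f_eq) (use that assms bij' in \<open>auto simp: bij_betw_def measurable_space\<close>)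
  then have "inv_into (space M) ?S \<in> M \<rightarrow>\<^sub>M M"
    using assms(2) measurable_cong by blast
  moreover have "?S \<in> M \<rightarrow>\<^sub>M M"
    using assms(1) measurable_cong[of M ?S S M] by simp
  moreover have "distr M M ?S = M"
    using assms(5) distr_cong[of M M M M ?S S] by simp
  ultimately show ?thesis
    using bij' by (auto simp: mp_auts_def Bij_def)
qed

lemma mp_auts_measure_vimage:
  assumes "S \<in> mp_auts M" "A \<in> sets M"
  shows "measure M (S -` A \<inter> space M) = measure M A"
  using assms measure_distr[of S M M A] by (simp add: mp_auts_def)

text \<open>Preimages of null sets are null, so almost-everywhere statements can be transported
  along an automorphism. This is the substitute for working in a quotient modulo null sets.\<close>

lemma mp_auts_AE:
  assumes "S \<in> mp_auts M" "AE x in M. Q x"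
  shows "AE x in M. Q (S x)"
proof -
  have "AE x in distr M M S. Q x"
    by (subst mp_auts_distr[OF assms(1)]) (fact assms(2))
  then show ?thesis
    by (rule AE_distrD[OF mp_auts_meas[OF assms(1)]])
qed

lemma mp_auts_subgroup: "subgroup (mp_auts M) (BijGroup (space M))"
proof (rule group.subgroupI[OF group_BijGroup])
  show "mp_auts M \<subseteq> carrier (BijGroup (space M))"
    by (auto simp: mp_auts_def BijGroup_def)
  have "restrict (\<lambda>x. x) (space M) \<in> mp_auts M"
    by (rule mp_autsI[where S' = "\<lambda>x. x"]) auto
  then show "mp_auts M \<noteq> {}" by blast
next
  fix S assume S: "S \<in> mp_auts M"
  then have Bij: "S \<in> Bij (space M)" and m: "inv_into (space M) S \<in> M \<rightarrow>\<^sub>M M" "S \<in> M \<rightarrow>\<^sub>M M"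
    by (auto simp: mp_auts_def)
  have l: "inv_into (space M) S (S x) = x" "S (inv_into (space M) S x) = x" if "x \<in> space M" for x
    using that Bij by (auto simp: Bij_def bij_betw_inv_into_left bij_betw_inv_into_right)
  have "distr M M (inv_into (space M) S) = distr (distr M M S) M (inv_into (space M) S)"
    using S by (simp add: mp_auts_def)
  also have "\<dots> = distr M M (inv_into (space M) S \<circ> S)"
    by (rule distr_distr) (use m in auto)
  also have "\<dots> = distr M M (\<lambda>x. x)"
    by (rule distr_cong) (auto simp: l)
  finally have "distr M M (inv_into (space M) S) = M" by simp
  then have "restrict (inv_into (space M) S) (space M) \<in> mp_auts M"
    by (intro mp_autsI[where S' = S]) (use m l in auto)
  then show "inv\<^bsub>BijGroup (space M)\<^esub> S \<in> mp_auts M"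
    by (simp add: inv_BijGroup Bij)
next
  fix S S' assume S: "S \<in> mp_auts M" and S': "S' \<in> mp_auts M"
  then have B: "S \<in> Bij (space M)" "S' \<in> Bij (space M)"
    by (auto simp: mp_auts_def)
  have l: "inv_into (space M) f (f x) = x" "f (inv_into (space M) f x) = x"
    "inv_into (space M) f x \<in> space M"
    if "x \<in> space M" "f \<in> mp_auts M" for f x
    using that by (auto simp: mp_auts_def Bij_def bij_betw_inv_into_left bij_betw_inv_into_right
        measurable_space)
  have m: "f \<in> M \<rightarrow>\<^sub>M M" "inv_into (space M) f \<in> M \<rightarrow>\<^sub>M M" "distr M M f = M"
    if "f \<in> mp_auts M" for f
    using that by (auto simp: mp_auts_def)
  have "distr M M (S \<circ> S') = distr (distr M M S') M S"
    by (rule distr_distr[symmetric]) (use m S S' in auto)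
  then have d: "distr M M (S \<circ> S') = M"
    using m S S' by simp
  have "restrict (S \<circ> S') (space M) \<in> mp_auts M"
    by (rule mp_autsI[where S' = "inv_into (space M) S' \<circ> inv_into (space M) S"])
      (use S S' m d in \<open>auto simp: l mp_auts_space intro: measurable_comp\<close>)
  moreover have "restrict (S \<circ> S') (space M) = S \<otimes>\<^bsub>BijGroup (space M)\<^esub> S'"
    using B by (auto simp: BijGroup_def compose_def)
  ultimately show "S \<otimes>\<^bsub>BijGroup (space M)\<^esub> S' \<in> mp_auts M" by simp
qed

lemma group_mp_aut_group: "group (mp_aut_group M)"
  unfolding mp_aut_group_def
  by (rule group.subgroup_imp_group[OF group_BijGroup mp_auts_subgroup])

lemma carrier_mp_aut_group [simp]: "carrier (mp_aut_group M) = mp_auts M"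
  by (simp add: mp_aut_group_def)

lemma mp_mult_apply:
  "\<lbrakk>S \<in> mp_auts M; S' \<in> mp_auts M; x \<in> space M\<rbrakk> \<Longrightarrow> (S \<otimes>\<^bsub>mp_aut_group M\<^esub> S') x = S (S' x)"
  by (simp add: mp_aut_group_def BijGroup_def compose_def mp_auts_def)

lemma mp_one_apply: "x \<in> space M \<Longrightarrow> \<one>\<^bsub>mp_aut_group M\<^esub> x = x"
  by (simp add: mp_aut_group_def BijGroup_def)

section \<open>The uniform pseudometric and its two-sided invariance\<close>

locale mp_space = prob_space M for M :: "'a measure" +
  fixes sep :: "nat \<Rightarrow> 'a set"
  assumes sep_sets: "sep i \<in> sets M"
    and separates: "\<lbrakk>x \<in> space M; y \<in> space M; x \<noteq> y\<rbrakk> \<Longrightarrow> \<exists>i. x \<in> sep i \<and> y \<notin> sep i"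
begin

abbreviation "G \<equiv> mp_aut_group M"

abbreviation d where "d \<equiv> unif_dist M"

sublocale Aut: group G by (rule group_mp_aut_group)

lemma mult_mp [simp, intro]: "S \<in> mp_auts M \<Longrightarrow> S' \<in> mp_auts M \<Longrightarrow> S \<otimes>\<^bsub>G\<^esub> S' \<in> mp_auts M"
  using Aut.m_closed by simp

lemma one_mp [simp, intro]: "\<one>\<^bsub>G\<^esub> \<in> mp_auts M"
  using Aut.one_closed by simp

lemma inv_mp [simp, intro]: "S \<in> mp_auts M \<Longrightarrow> inv\<^bsub>G\<^esub> S \<in> mp_auts M"
  using Aut.inv_closed by simp

lemma pow_mp [simp, intro]: "S \<in> mp_auts M \<Longrightarrow> S [^]\<^bsub>G\<^esub> (n::nat) \<in> mp_auts M"
  using Aut.nat_pow_closed by simp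

lemma inv_apply: "S \<in> mp_auts M \<Longrightarrow> x \<in> space M \<Longrightarrow> (inv\<^bsub>G\<^esub> S) (S x) = x"
  by (metis Aut.l_inv carrier_mp_aut_group inv_mp mp_mult_apply mp_one_apply)

lemma apply_inv: "S \<in> mp_auts M \<Longrightarrow> x \<in> space M \<Longrightarrow> S ((inv\<^bsub>G\<^esub> S) x) = x"
  by (metis Aut.r_inv carrier_mp_aut_group inv_mp mp_mult_apply mp_one_apply)

text \<open>Two different images are told apart by a member of the countable family
  \<open>sep\<close>, so the disagreement set is a countable union of measurable sets. This has to
  be secured because \<open>measure\<close> is 0 on a non-measurable set, where
  \<open>unif_dist\<close> would carry no information.\<close>

lemma neq_sets:
  assumes "S \<in> M \<rightarrow>\<^sub>M M" "S' \<in> M \<rightarrow>\<^sub>M M"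
  shows "{x \<in> space M. S x \<noteq> S' x} \<in> sets M"
proof -
  have "{x \<in> space M. S x \<noteq> S' x} =
      (\<Union>i. (S -` sep i \<inter> space M) - (S' -` sep i \<inter> space M))"
    using separates assms[THEN measurable_space] by (fastforce simp: set_eq_iff)
  also have "\<dots> \<in> sets M"
    using assms sep_sets by (auto intro!: sets.countable_UN' sets.Diff measurable_sets)
  finally show ?thesis .
qed

lemma eq_sets:
  assumes "S \<in> M \<rightarrow>\<^sub>M M" "S' \<in> M \<rightarrow>\<^sub>M M"
  shows "{x \<in> space M. S x = S' x} \<in> sets M"
proof -
  have "{x \<in> space M. S x = S' x} = space M - {x \<in> space M. S x \<noteq> S' x}"
    by auto
  then show ?thesis
    using neq_sets[OF assms] by (metis sets.compl_sets)
qed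

lemma d_le:
  assumes "{x \<in> space M. S x \<noteq> S' x} \<subseteq> A" "A \<in> sets M"
  shows "d S S' \<le> measure M A"
  unfolding unif_dist_def by (rule finite_measure_mono) (use assms in auto)

lemma d_eq_0I:
  assumes "AE x in M. S x = S' x"
  shows "d S S' = 0"
proof -
  obtain N where N: "{x \<in> space M. \<not> S x = S' x} \<subseteq> N" "N \<in> null_sets M"
    using assms by (auto simp: eventually_ae_filter)
  then have "d S S' \<le> measure M N"
    by (intro d_le) auto
  also have "\<dots> = 0"
    using N by (simp add: null_sets_def measure_def)
  finally show ?thesis
    by (simp add: unif_dist_def order_antisym)
qed

lemma d_refl [simp]: "d S S = 0"
  by (rule d_eq_0I) simp

lemma d_sym: "d S S' = d S' S"
  by (simp add: unif_dist_def eq_commute)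

lemma d_triangle:
  assumes "S \<in> mp_auts M" "S' \<in> mp_auts M" "S'' \<in> mp_auts M"
  shows "d S S'' \<le> d S S' + d S' S''"
proof -
  have *: "{x \<in> space M. S x \<noteq> S' x} \<in> sets M" "{x \<in> space M. S' x \<noteq> S'' x} \<in> sets M"
    using assms by (auto intro!: neq_sets mp_auts_meas)
  then have "d S S'' \<le> measure M ({x \<in> space M. S x \<noteq> S' x} \<union> {x \<in> space M. S' x \<noteq> S'' x})"
    by (intro d_le) auto
  also have "\<dots> \<le> d S S' + d S' S''"
    unfolding unif_dist_def using * by (rule measure_Un_le)
  finally show ?thesis .
qed

lemma d_left:
  assumes "R \<in> mp_auts M" "S \<in> mp_auts M" "S' \<in> mp_auts M"
  shows "d (R \<otimes>\<^bsub>G\<^esub> S) (R \<otimes>\<^bsub>G\<^esub> S') = d S S'"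
proof -
  have "{x \<in> space M. (R \<otimes>\<^bsub>G\<^esub> S) x \<noteq> (R \<otimes>\<^bsub>G\<^esub> S') x} = {x \<in> space M. S x \<noteq> S' x}"
    using assms by (auto simp: mp_mult_apply mp_auts_inj mp_auts_space)
  then show ?thesis by (simp add: unif_dist_def)
qed

lemma d_right:
  assumes "R \<in> mp_auts M" "S \<in> mp_auts M" "S' \<in> mp_auts M"
  shows "d (S \<otimes>\<^bsub>G\<^esub> R) (S' \<otimes>\<^bsub>G\<^esub> R) = d S S'"
proof -
  let ?A = "{x \<in> space M. S x \<noteq> S' x}"
  have "{x \<in> space M. (S \<otimes>\<^bsub>G\<^esub> R) x \<noteq> (S' \<otimes>\<^bsub>G\<^esub> R) x} = R -` ?A \<inter> space M"
    using assms by (auto simp: mp_mult_apply mp_auts_space)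
  moreover have "?A \<in> sets M"
    using assms by (auto intro!: neq_sets mp_auts_meas)
  ultimately show ?thesis
    using mp_auts_measure_vimage[OF assms(1), of ?A] by (simp add: unif_dist_def)
qed

lemma d_mult:
  assumes "S \<in> mp_auts M" "S' \<in> mp_auts M" "R \<in> mp_auts M" "R' \<in> mp_auts M"
  shows "d (S \<otimes>\<^bsub>G\<^esub> R) (S' \<otimes>\<^bsub>G\<^esub> R') \<le> d S S' + d R R'"
  using d_triangle[of "S \<otimes>\<^bsub>G\<^esub> R" "S' \<otimes>\<^bsub>G\<^esub> R" "S' \<otimes>\<^bsub>G\<^esub> R'"] assms
  by (simp add: d_left d_right)

text \<open>Translating by \<open>S\<close> on the left and by \<open>S'\<close> on the right
  carries the pair of inverses to the pair \<open>S'\<close>, \<open>S\<close>.\<close>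

lemma d_inv:
  assumes "S \<in> mp_auts M" "S' \<in> mp_auts M"
  shows "d (inv\<^bsub>G\<^esub> S) (inv\<^bsub>G\<^esub> S') = d S S'"
proof -
  have "d (inv\<^bsub>G\<^esub> S) (inv\<^bsub>G\<^esub> S') = d (S \<otimes>\<^bsub>G\<^esub> inv\<^bsub>G\<^esub> S) (S \<otimes>\<^bsub>G\<^esub> inv\<^bsub>G\<^esub> S')"
    using assms by (simp only: d_left inv_mp)
  also have "\<dots> = d (\<one>\<^bsub>G\<^esub> \<otimes>\<^bsub>G\<^esub> S') (S \<otimes>\<^bsub>G\<^esub> inv\<^bsub>G\<^esub> S' \<otimes>\<^bsub>G\<^esub> S')"
    using assms by (subst d_right) auto
  also have "\<dots> = d S' S"
    using assms by (simp add: Aut.m_assoc)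
  finally show ?thesis by (simp add: d_sym)
qed

end

section \<open>Approximation by the elements of a subgroup\<close>

locale mp_subgroup = mp_space +
  fixes \<Gamma>
  assumes \<Gamma>: "subgroup \<Gamma> (mp_aut_group M)"
begin

text \<open>With \<open>near\<close>, estimates for words in approximants become bookkeeping on \<open>r\<close>.\<close>

definition near :: "real \<Rightarrow> ('a \<Rightarrow> 'a) set" where
  "near r = {S \<in> mp_auts M. \<exists>h\<in>\<Gamma>. d S h \<le> r}"

abbreviation "H \<equiv> unif_closure M \<Gamma>"

lemma \<Gamma>_mp: "h \<in> \<Gamma> \<Longrightarrow> h \<in> mp_auts M"
  using \<Gamma> subgroup.subset by fastforce

lemma near_mp: "S \<in> near r \<Longrightarrow> S \<in> mp_auts M"
  by (simp add: near_def)

lemma near_mono: "S \<in> near r \<Longrightarrow> r \<le> s \<Longrightarrow> S \<in> near s"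
  by (force simp: near_def)

lemma \<Gamma>_near: "h \<in> \<Gamma> \<Longrightarrow> h \<in> near 0"
  by (auto simp: near_def \<Gamma>_mp intro!: bexI[of _ h])

lemma near_mult: 
  assumes "S \<in> near r" "S' \<in> near s"
  shows "S \<otimes>\<^bsub>G\<^esub> S' \<in> near (r + s)"
proof -
  obtain h h' where h: "h \<in> \<Gamma>" "d S h \<le> r" "h' \<in> \<Gamma>" "d S' h' \<le> s"
    using assms by (auto simp: near_def)
  have "d (S \<otimes>\<^bsub>G\<^esub> S') (h \<otimes>\<^bsub>G\<^esub> h') \<le> d S h + d S' h'"
    using assms h by (intro d_mult) (auto simp: near_mp \<Gamma>_mp)
  moreover have "h \<otimes>\<^bsub>G\<^esub> h' \<in> \<Gamma>"
    using h \<Gamma> by (simp add: subgroup.m_closed)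
  ultimately show ?thesis
    using h assms by (auto simp: near_def intro!: bexI[of _ "h \<otimes>\<^bsub>G\<^esub> h'"])
qed

lemma near_inv: 
  assumes "S \<in> near r"
  shows "inv\<^bsub>G\<^esub> S \<in> near r"
proof -
  obtain h where h: "h \<in> \<Gamma>" "d S h \<le> r" using assms by (auto simp: near_def)
  then have "inv\<^bsub>G\<^esub> h \<in> \<Gamma>" using \<Gamma> by (simp add: subgroup.m_inv_closed)
  then show ?thesis
    using h assms by (auto simp: near_def d_inv \<Gamma>_mp intro!: bexI[of _ "inv\<^bsub>G\<^esub> h"])
qed

lemma near_shift:
  assumes "S \<in> near r" "S' \<in> mp_auts M" "d S' S \<le> s"
  shows "S' \<in> near (r + s)"
proof -
  obtain h where h: "h \<in> \<Gamma>" "d S h \<le> r" using assms by (auto simp: near_def)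
  then have "d S' h \<le> r + s"
    using d_triangle[of S' S h] assms by (auto simp: near_mp \<Gamma>_mp)
  then show ?thesis using h assms by (auto simp: near_def)
qed

text \<open>\<open>near\<close> uses weak bounds so that members of \<Gamma> have error 0, while
  \<open>unif_closure\<close> uses strict ones; quantifying over all positive bounds removes the
  difference.\<close>

lemma H_iff: "S \<in> H \<longleftrightarrow> S \<in> mp_auts M \<and> (\<forall>\<epsilon>>0. S \<in> near \<epsilon>)"
proof -
  have "(\<forall>\<epsilon>>0. \<exists>h\<in>\<Gamma>. d S h < \<epsilon>) \<longleftrightarrow> (\<forall>\<epsilon>>0. \<exists>h\<in>\<Gamma>. d S h \<le> \<epsilon>)"
    by (meson dual_order.strict_trans2 field_lbound_gt_zero less_imp_le)
  then show ?thesis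
    by (auto simp: unif_closure_def near_def)
qed

lemma H_mp: "S \<in> H \<Longrightarrow> S \<in> mp_auts M"
  by (simp add: H_iff)

lemma H_mult: "S \<in> H \<Longrightarrow> S' \<in> H \<Longrightarrow> S \<otimes>\<^bsub>G\<^esub> S' \<in> H"
  by (auto simp: H_iff) (metis field_sum_of_halves half_gt_zero near_mult)

lemma H_inv: "S \<in> H \<Longrightarrow> inv\<^bsub>G\<^esub> S \<in> H"
  by (auto simp: H_iff near_inv)

lemma \<Gamma>_H: "h \<in> \<Gamma> \<Longrightarrow> h \<in> H"
  by (auto simp: H_iff \<Gamma>_mp intro: near_mono[OF \<Gamma>_near])

lemma one_H: "\<one>\<^bsub>G\<^esub> \<in> H"
  using \<Gamma> by (simp add: \<Gamma>_H subgroup.one_closed)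

lemma H_closed:
  assumes "S \<in> mp_auts M" "\<And>\<epsilon>. \<epsilon> > 0 \<Longrightarrow> \<exists>S'\<in>H. d S S' < \<epsilon>"
  shows "S \<in> H"
  unfolding H_iff
proof (intro conjI allI impI)
  fix \<epsilon> :: real assume "\<epsilon> > 0"
  then obtain S' where "S' \<in> H" "d S S' < \<epsilon>/2" using assms(2)[of "\<epsilon>/2"] by auto
  then show "S \<in> near \<epsilon>"
    using near_shift[of S' "\<epsilon>/2" S "\<epsilon>/2"] assms(1) \<open>\<epsilon> > 0\<close> by (auto simp: H_iff)
qed (fact assms)

lemma H_limit:
  assumes "S \<in> mp_auts M" "\<And>n. h n \<in> H" "(\<lambda>n. d S (h n)) \<longlonglongrightarrow> 0"
  shows "S \<in> H"
proof (rule H_closed)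
  fix \<epsilon> :: real assume "\<epsilon> > 0"
  then have "\<forall>\<^sub>F n in sequentially. d S (h n) < \<epsilon>"
    using assms(3) order_tendstoD(2) by blast
  then obtain n where "d S (h n) < \<epsilon>" by (auto simp: eventually_sequentially)
  then show "\<exists>S'\<in>H. d S S' < \<epsilon>" using assms(2) by blast
qed (fact assms)

end

section \<open>Finite words and the dyadic relation\<close>

unbundle bit_operations_syntax

text \<open>Words of length \<open>q\<close> are coded as numbers below \<open>2 ^ q\<close>, the first letter being the least
  significant bit, so that the odometer adds 1 modulo \<open>2 ^ q\<close>.\<close>

definition val :: "nat \<Rightarrow> (nat \<Rightarrow> bool) \<Rightarrow> nat" where
  "val q x = horner_sum of_bool 2 (map x [0..<q])"

definition act :: "nat \<Rightarrow> (nat \<Rightarrow> nat) \<Rightarrow> (nat \<Rightarrow> bool) \<Rightarrow> (nat \<Rightarrow> bool)" where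
  "act q \<sigma> x = (\<lambda>i. if i < q then bit (\<sigma> (val q x)) i else x i)"

text \<open>The natural numbers under bitwise XOR are the group of finitely supported 0-1 sequences.
  \<open>R0\<close> is the orbit relation of its free action by flips, so a pair of related points
  is labelled by exactly one number.\<close>

definition flp :: "nat \<Rightarrow> (nat \<Rightarrow> bool) \<Rightarrow> (nat \<Rightarrow> bool)" where
  "flp c x = (\<lambda>i. x i \<noteq> bit c i)"

lemma bit_val: "bit (val q x) i \<longleftrightarrow> i < q \<and> x i"
  by (auto simp: val_def bit_horner_sum_bit_iff)

lemma bit_less_exp: "(n::nat) < 2 ^ q \<Longrightarrow> bit n i \<Longrightarrow> i < q"
  by (metis bit_take_bit_iff take_bit_nat_eq_self)

lemma val_less [simp]: "val q x < 2 ^ q"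
  using horner_sum_of_bool_2_less[of "map x [0..<q]"] by (simp add: val_def)

lemma val_eq_iff: "n < 2 ^ q \<Longrightarrow> val q x = n \<longleftrightarrow> (\<forall>i<q. x i = bit n i)"
  by (auto simp: bit_eq_iff bit_val dest: bit_less_exp)

lemma val_take_bit: "q \<le> r \<Longrightarrow> take_bit q (val r x) = val q x"
  by (auto simp: bit_eq_iff bit_val bit_take_bit_iff)

lemma val_0 [simp]: "val 0 x = 0"
  by (simp add: val_def)

lemma act_low: "i < q \<Longrightarrow> act q \<sigma> x i = bit (\<sigma> (val q x)) i"
  by (simp add: act_def)

lemma val_act:
  assumes "\<And>n. n < 2 ^ q \<Longrightarrow> \<sigma> n < 2 ^ q"
  shows "val q (act q \<sigma> x) = \<sigma> (val q x)"
  using assms[OF val_less] by (subst val_eq_iff) (auto simp: act_low)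

lemma act_act:
  assumes "\<And>n. n < 2 ^ q \<Longrightarrow> \<tau> n < 2 ^ q"
  shows "act q \<sigma> (act q \<tau> x) = act q (\<sigma> \<circ> \<tau>) x"
  using val_act[of q \<tau> x, OF assms] by (simp add: act_def[of q \<sigma>] act_low fun_eq_iff) (simp add: act_def)

lemma act_idI:
  assumes "\<sigma> (val q x) = val q x"
  shows "act q \<sigma> x = x"
  using assms by (auto simp: act_def fun_eq_iff bit_val)

lemma act_cong: "\<sigma> (val q x) = \<tau> (val q x) \<Longrightarrow> act q \<sigma> x = act q \<tau> x"
  by (simp add: act_def fun_eq_iff)

lemma act_eqI:
  assumes "\<And>n. n < 2 ^ q \<Longrightarrow> \<sigma> n < 2 ^ q"
    and "val q x' = \<sigma> (val q x)" "\<And>i. i \<ge> q \<Longrightarrow> x' i = x i"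
  shows "x' = act q \<sigma> x"
proof
  fix i show "x' i = act q \<sigma> x i"
    using assms(3) bit_val[of q x' i] assms(2) by (cases "i < q") (auto simp: act_def)
qed

lemma permutes_less:
  assumes "\<sigma> permutes {..<N::nat}" "n < N"
  shows "\<sigma> n < N"
  using permutes_in_image[OF assms(1), of n] assms(2) by simp

lemma flp_flp [simp]: "flp c (flp c x) = x"
  by (auto simp: flp_def)

lemma flp_0 [simp]: "flp 0 x = x"
  by (auto simp: flp_def)

lemma flp_inject: "flp c x = flp c' x \<longleftrightarrow> c = c'"
  by (auto simp: flp_def fun_eq_iff bit_eq_iff)

lemma val_flp: "c < 2 ^ q \<Longrightarrow> val q (flp c x) = val q x XOR c"
  by (auto simp: bit_eq_iff bit_val bit_xor_iff flp_def dest: bit_less_exp)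

lemma R0_iff_flp: "(x', x) \<in> R0 \<longleftrightarrow> (\<exists>c. x' = flp c x)"
proof
  assume "(x', x) \<in> R0"
  then obtain n where n: "\<And>i. i \<ge> n \<Longrightarrow> x' i = x i" by (auto simp: R0_def)
  have "x' = flp (val n (\<lambda>i. x' i \<noteq> x i)) x"
    using n by (auto simp: flp_def fun_eq_iff bit_val not_le)
  then show "\<exists>c. x' = flp c x" ..
next
  assume "\<exists>c. x' = flp c x"
  then obtain c where c: "x' = flp c x" ..
  \<comment> \<open>Since c < 2 ^ c, the number \<open>c\<close> itself bounds the positions of its
    set bits.\<close>
  have "\<not> bit c i" if "i \<ge> c" for i
    using bit_less_exp[of c c i] that by (auto simp: less_exp)
  then show "(x', x) \<in> R0"
    by (auto simp: R0_def c flp_def)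
qed

lemma R0_act: "(act q \<sigma> x, x) \<in> R0"
  by (auto simp: R0_def act_def intro!: exI[of _ q])

text \<open>The carry reaches position \<open>i\<close> exactly when all earlier letters are 1. This
  form needs no separate case for the constant sequence 1 and gives measurability letter by
  letter.\<close>

lemma odometer_apply: "odometer x i = (x i \<noteq> (\<forall>j<i. x j))"
proof (cases "\<exists>n. \<not> x n")
  case True
  define n where "n = (LEAST n. \<not> x n)"
  have n: "\<not> x n" "\<And>j. j < n \<Longrightarrow> x j"
    unfolding n_def using LeastI_ex[OF True] not_less_Least by blast+
  have "odometer x i = (if i < n then False else if i = n then True else x i)"
    using True by (auto simp: odometer_def n_def Let_def)
  moreover have "(\<forall>j<i. x j) \<longleftrightarrow> i \<le> n"
    using n by (metis linorder_not_less order_less_le_trans)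
  ultimately show ?thesis
    using n by (cases i n rule: linorder_cases) simp_all
qed (auto simp: odometer_def)

text \<open>Subtraction of 1: the borrow runs through the initial zeros.\<close>

definition odometer_inv :: "(nat \<Rightarrow> bool) \<Rightarrow> (nat \<Rightarrow> bool)" where
  "odometer_inv x = (\<lambda>i. x i \<noteq> (\<forall>j<i. \<not> x j))"

lemma odometer_inv_odometer: "odometer_inv (odometer x) = x"
proof
  fix i
  have "(\<forall>j<i. \<not> odometer x j) \<longleftrightarrow> (\<forall>j<i. x j)"
  proof (induction i)
    case (Suc i)
    with odometer_apply[of x i] show ?case unfolding All_less_Suc by blast
  qed simp
  then show "odometer_inv (odometer x) i = x i"
    unfolding odometer_inv_def odometer_apply[of x i] by blast
qed

lemma odometer_odometer_inv: "odometer (odometer_inv x) = x"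
proof
  fix i
  have "(\<forall>j<i. odometer_inv x j) \<longleftrightarrow> (\<forall>j<i. \<not> x j)"
  proof (induction i)
    case (Suc i)
    have "odometer_inv x i = (x i \<noteq> (\<forall>j<i. \<not> x j))" by (simp add: odometer_inv_def)
    with Suc show ?case unfolding All_less_Suc by blast
  qed simp
  moreover have "odometer_inv x i = (x i \<noteq> (\<forall>j<i. \<not> x j))" by (simp add: odometer_inv_def)
  ultimately show "odometer (odometer_inv x) i = x i"
    unfolding odometer_apply by blast
qed

lemma odometer_R0:
  assumes "\<not> (\<forall>i. x i)"
  shows "(odometer x, x) \<in> R0"
proof -
  obtain k where "\<not> x k" using assms by blast
  then show ?thesis
    unfolding R0_def odometer_apply by (simp, intro exI[of _ "Suc k"], metis Suc_le_lessD)
qed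

lemma val_Suc: "val (Suc q) x = val q x + (if x q then 2 ^ q else 0)"
proof -
  have "val (Suc q) x = val q x OR (if x q then 2 ^ q else 0)"
    by (rule bit_eqI) (auto simp: bit_val bit_or_iff bit_exp_iff less_Suc_eq)
  moreover have "val q x AND (if x q then 2 ^ q else 0) = 0"
    by (rule bit_eqI) (auto simp: bit_val bit_and_iff bit_exp_iff)
  ultimately show ?thesis
    by (simp add: disjunctive_add_eq_or)
qed

lemma val_all: "(\<forall>i<q. x i) \<longleftrightarrow> Suc (val q x) = 2 ^ q"
proof -
  have "(\<forall>i<q. x i) \<longleftrightarrow> val q x = mask q"
    by (subst val_eq_iff) (auto simp: bit_mask_iff)
  moreover have "Suc (mask q) = 2 ^ q"
    by (simp add: mask_eq_exp_minus_1)
  ultimately show ?thesis by (metis Suc_inject)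
qed

lemma val_odometer: "val q (odometer x) = (if Suc (val q x) = 2 ^ q then 0 else Suc (val q x))"
proof (induction q)
  case (Suc q)
  have "Suc (val q x) \<noteq> 2 * 2 ^ q" using val_less[of q x] by linarith
  then show ?case
    using Suc by (auto simp: val_Suc odometer_apply val_all)
qed simp

lemma odometer_tail: 
  assumes "Suc (val q x) \<noteq> 2 ^ q" "i \<ge> q"
  shows "odometer x i = x i"
  using assms by (metis odometer_apply order_less_le_trans val_all)

text \<open>As long as the word does not wrap around, the odometer adds 1 to its code and leaves the
  later letters alone. The bound keeps the codes \<open>j\<close> and \<open>Suc j\<close> away from
  the all-ones word, so conjugation shifts the transposition by one. On every other word, including
  the one that wraps to 0, both transpositions are idle.\<close>

lemma odometer_transpose:
  assumes "Suc (Suc j) < 2 ^ q"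
  shows "odometer (act q (Transposition.transpose j (Suc j)) x) = act q (Transposition.transpose (Suc j) (Suc (Suc j))) (odometer x)"
proof -
  let ?y = "act q (Transposition.transpose j (Suc j)) x"
  have vy: "val q ?y = Transposition.transpose j (Suc j) (val q x)"
    by (rule val_act) (use assms in \<open>auto simp: Transposition.transpose_def\<close>)
  consider "val q x = j" | "val q x = Suc j" | "val q x \<noteq> j" "val q x \<noteq> Suc j" by blast
  then show ?thesis
  proof cases
    case 3
    then have "?y = x" by (intro act_idI) auto
    moreover have "act q (Transposition.transpose (Suc j) (Suc (Suc j))) (odometer x) = odometer x"
      using 3 assms by (intro act_idI) (auto simp: val_odometer Transposition.transpose_def)
    ultimately show ?thesis by simp
  next
    case 1
    show ?thesis
    proof (rule act_eqI)
      fix i assume "i \<ge> q"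
      then show "odometer ?y i = odometer x i"
        using 1 assms vy odometer_tail[of q ?y i] odometer_tail[of q x i] by (simp add: act_def)
    qed (use 1 assms vy in \<open>auto simp: val_odometer Transposition.transpose_def\<close>)
  next
    case 2
    show ?thesis
    proof (rule act_eqI)
      fix i assume "i \<ge> q"
      then show "odometer ?y i = odometer x i"
        using 2 assms vy odometer_tail[of q ?y i] odometer_tail[of q x i] by (simp add: act_def)
    qed (use 2 assms vy in \<open>auto simp: val_odometer Transposition.transpose_def\<close>)
  qed
qed

text \<open>The permutation acts on the prefix of a longer word: \<open>mod\<close> extracts the
  first \<open>q\<close> letters and \<open>div\<close> the remaining ones. The identity from
  \<open>2 ^ r\<close> on is what \<open>permutes\<close> asks for.\<close>

definition lift :: "nat \<Rightarrow> nat \<Rightarrow> (nat \<Rightarrow> nat) \<Rightarrow> (nat \<Rightarrow> nat)" where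
  "lift q r \<sigma> n = (if n < 2 ^ r then \<sigma> (n mod 2 ^ q) + 2 ^ q * (n div 2 ^ q) else n)"

lemma act_lift:
  assumes "q \<le> r" "\<sigma> permutes {..<2 ^ q}"
  shows "act r (lift q r \<sigma>) x = act q \<sigma> x"
proof 
  fix i
  have s: "\<sigma> (val q x) < 2 ^ q" using permutes_less[OF assms(2)] by simp
  have vq: "val r x mod 2 ^ q = val q x"
    using assms(1) by (simp add: val_take_bit flip: take_bit_eq_mod)
  have "\<sigma> (val q x) + 2 ^ q * (val r x div 2 ^ q) = \<sigma> (val q x) OR push_bit q (drop_bit q (val r x))"
  proof -
    have "\<sigma> (val q x) AND push_bit q (drop_bit q (val r x)) = 0"
      using s by (intro bit_eqI) (auto simp: bit_and_iff bit_push_bit_iff dest: bit_less_exp)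
    then show ?thesis
      by (simp add: disjunctive_add_eq_or[symmetric] push_bit_eq_mult drop_bit_eq_div mult.commute)
  qed
  then have "bit (\<sigma> (val q x) + 2 ^ q * (val r x div 2 ^ q)) i = (if i < q then bit (\<sigma> (val q x)) i else i < r \<and> x i)"
    using s by (auto simp: bit_or_iff bit_push_bit_iff bit_drop_bit_eq bit_val dest: bit_less_exp)
  then show "act r (lift q r \<sigma>) x i = act q \<sigma> x i"
    using assms(1) by (auto simp: act_def vq lift_def)
qed

lemma lift_permutes:
  assumes "q \<le> r" "\<sigma> permutes {..<2 ^ q}"
  shows "lift q r \<sigma> permutes {..<2 ^ r}"
proof -
  have sm: "n < 2 ^ r \<longleftrightarrow> n div 2 ^ q < 2 ^ (r - q)" for n :: nat
    using assms(1) by (simp add: div_less_iff_less_mult power_add[symmetric])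
  have lt: "lift q r \<sigma> n < 2 ^ r \<longleftrightarrow> n < 2 ^ r" if "\<sigma> permutes {..<2 ^ q}" for \<sigma> n
    using permutes_less[OF that, of "n mod 2 ^ q"] by (simp add: lift_def sm)
  have inv: "lift q r \<tau> (lift q r \<sigma> n) = n"
    if "\<sigma> permutes {..<2 ^ q}" "\<And>k. \<tau> (\<sigma> k) = k" for \<sigma> \<tau> n
    using permutes_less[OF that(1), of "n mod 2 ^ q"] lt[OF that(1), of n]
    by (simp add: lift_def that(2) split: if_splits)
  have "bij (lift q r \<sigma>)"
    by (rule o_bij[where g = "lift q r (inv_into UNIV \<sigma>)"])
      (use assms(2) permutes_inv[OF assms(2)] in \<open>auto simp: fun_eq_iff inv permutes_inverses\<close>)
  then show ?thesis
    by (auto simp: permutes_def bij_iff lift_def)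
qed

text \<open>Sorting by adjacent transpositions, with the number of factors recorded in
  \<open>k\<close>. In the application every factor costs a fixed approximation error, so the
  quadratic bound matters as much as the existence of the factorization.\<close>

lemma adjacent_transpositions_induct:
  assumes "\<sigma> permutes {..<N::nat}" "P 0 id"
    and step: "\<And>k \<sigma> j. \<lbrakk>P k \<sigma>; \<sigma> permutes {..<N}; Suc j < N\<rbrakk> \<Longrightarrow> P (Suc k) (Transposition.transpose j (Suc j) \<circ> \<sigma>)"
  shows "\<exists>k\<le>N * N. P k \<sigma>"
proof -
  have "\<exists>k\<le>L * L. P k \<sigma>" if "L \<le> N" "\<sigma> permutes {..<L}" for L
    using that
  proof (induction L arbitrary: \<sigma>)
    case 0
    then show ?case using assms(2) by (auto simp: permutes_empty id_def)
  next
    case (Suc L)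
    \<comment> \<open>The inner induction raises the value of \<sigma> at the last point from
      \<open>m\<close> to \<open>L\<close>, one adjacent transposition at a time; after that
      \<sigma> fixes \<open>L\<close> and permutes the smaller set.\<close>
    have "\<exists>k\<le>L * L + (L - m). P k \<sigma>" if "m \<le> L" "\<sigma> L = m" "\<sigma> permutes {..<Suc L}" for m \<sigma>
      using that
    proof (induction m arbitrary: \<sigma> rule: inc_induct)
      case base
      have "\<sigma> permutes {..<L}"
        by (rule permutes_superset[OF base(2)]) (auto simp: less_Suc_eq base(1))
      then show ?case using Suc by auto
    next
      case (step m)
      let ?t = "Transposition.transpose m (Suc m)"
      have t: "?t permutes {..<Suc L}"
        using step by (intro permutes_swap_id) auto
      then have p: "?t \<circ> \<sigma> permutes {..<Suc L}" "?t \<circ> \<sigma> permutes {..<N}"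
        using permutes_compose[OF step.prems(2)] Suc.prems(1) permutes_subset[of _ "{..<Suc L}" "{..<N}"]
        by auto
      have "(?t \<circ> \<sigma>) L = Suc m" by (simp add: step.prems)
      from step.IH[OF this p(1)] obtain k where k: "k \<le> L * L + (L - Suc m)" "P k (?t \<circ> \<sigma>)"
        by blast
      then have "P (Suc k) (?t \<circ> (?t \<circ> \<sigma>))"
        using p Suc.prems step.hyps by (intro assms(3)) auto
      then have "P (Suc k) \<sigma>"
        by (simp add: o_assoc)
      then show ?case
        using k step.hyps by (intro exI[of _ "Suc k"]) auto
    qed
    moreover have "\<sigma> L \<le> L"
      using Suc.prems permutes_less[of \<sigma> "Suc L" L] by simp
    ultimately obtain k where k: "k \<le> L * L + (L - \<sigma> L)" "P k \<sigma>"
      using Suc.prems by blast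
    then have "k \<le> Suc L * Suc L" by auto
    with k(2) show ?case by blast
  qed
  then show ?thesis using assms(1) by blast
qed

text \<open>The words \<open>a u\<close> and \<open>b u\<close> with \<open>u < 2 ^ n\<close> are enumerated by \<open>e\<close> and rotated by one step;
  \<open>2 ^ n\<close> steps exchange \<open>a\<close> and \<open>b\<close> and leave \<open>u\<close> unchanged.\<close>

lemma ex_dyadic_cycle:
  fixes a b p n :: nat
  assumes ab: "a < 2 ^ p" "b < 2 ^ p" "a \<noteq> b"
  obtains c where "c permutes {..<2 ^ (p + n)}"
    and "\<And>j. c j \<noteq> j \<Longrightarrow> j mod 2 ^ p \<in> {a, b}"
    and "\<And>j. j < 2 ^ (p + n) \<Longrightarrow> (c ^^ 2 ^ n) j = lift p (p + n) (Transposition.transpose a b) j"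
proof -
  define e where "e = (\<lambda>N. (if N < 2 ^ n then a else b) + 2 ^ p * (N mod 2 ^ n))"
  define e' where "e' = (\<lambda>j. (if j mod 2 ^ p = a then 0 else 2 ^ n) + j div 2 ^ p)"
  define I where "I = {j. j < 2 ^ (p + n) \<and> j mod 2 ^ p \<in> {a, b}}"
  let ?K = "2 ^ (n + 1) :: nat"
  define c where "c = (\<lambda>j. if j \<in> I then e ((e' j + 1) mod ?K) else j)"
  have dv: "j div 2 ^ p < 2 ^ n" if "j \<in> I" for j
    using that by (simp add: I_def div_less_iff_less_mult power_add mult.commute)
  have e_mod: "e N mod 2 ^ p = (if N < 2 ^ n then a else b)"
    and e_div: "e N div 2 ^ p = N mod 2 ^ n" for N
    using ab by (auto simp: e_def)
  have e_lt: "e N < 2 ^ (p + n)" for N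
  proof -
    have "e N div 2 ^ p < 2 ^ n" by (simp add: e_div)
    then show ?thesis by (simp add: div_less_iff_less_mult power_add mult.commute)
  qed
  have eI: "e N \<in> I" for N
    by (auto simp: I_def e_lt e_mod)
  have e'e: "e' (e N) = N" if "N < ?K" for N
    using that ab(3) mod_less[of "N - 2 ^ n" "2 ^ n"] le_mod_geq[of "2 ^ n" N] by (auto simp: e'_def e_mod e_div)
  have ee': "e (e' j) = j" and e'_lt: "e' j < ?K" if "j \<in> I" for j
  proof -
    have "e (e' j) = j mod 2 ^ p + 2 ^ p * (j div 2 ^ p)"
      using that dv[OF that] ab(3) by (auto simp: e_def e'_def I_def)
    then show "e (e' j) = j" by simp
    show "e' j < ?K" using dv[OF that] by (auto simp: e'_def)
  qed
  have c_e: "c (e N) = e ((N + 1) mod ?K)" if "N < ?K" for N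
    using that by (simp add: c_def eI e'e)
  have pow: "(c ^^ k) (e N) = e ((N + k) mod ?K)" if "N < ?K" for N k
  proof (induction k)
    case (Suc k)
    then show ?case by (simp add: c_e mod_Suc_eq del: power_Suc)
  qed (use that in simp)
  have idp: "(c ^^ k) j = j" if "j \<notin> I" for j k
    by (induction k) (use that in \<open>auto simp: c_def\<close>)
  have cK: "(c ^^ ?K) j = j" for j
  proof (cases "j \<in> I")
    case True
    then show ?thesis using pow[OF e'_lt[OF True], of ?K] e'_lt[OF True] by (simp add: ee' del: power_Suc)
  qed (rule idp)
  have "bij c"
  proof -
    \<comment> \<open>As \<open>c\<close> has finite order, its power with exponent
      \<open>?K - 1\<close> is a two-sided inverse.\<close>
    obtain L where L: "?K = Suc L" by (metis not0_implies_Suc power_not_zero zero_neq_numeral)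
    have cL: "c ^^ Suc L = id" using cK unfolding L by auto
    then show ?thesis
      using o_bij[of "c ^^ L" c] by (metis funpow.simps(2) funpow_Suc_right)
  qed
  then have "c permutes {..<2 ^ (p + n)}"
    by (auto simp: permutes_def bij_iff) (auto simp: c_def I_def)
  moreover have "j mod 2 ^ p \<in> {a, b}" if "c j \<noteq> j" for j
    using that by (auto simp: c_def I_def split: if_splits)
  moreover have "(c ^^ 2 ^ n) j = lift p (p + n) (Transposition.transpose a b) j" if j: "j < 2 ^ (p + n)" for j
  proof (cases "j \<in> I")
    case True
    have "(c ^^ 2 ^ n) j = e ((e' j + 2 ^ n) mod ?K)"
      using pow[OF e'_lt[OF True], of "2 ^ n"] ee'[OF True] by simp
    \<comment> \<open>Words beginning with \<open>b\<close> occupy the second half of the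
      enumeration, and 2 ^ n further steps wrap them around to the first half.\<close>
    moreover have "(2 ^ n + j div 2 ^ p + 2 ^ n) mod ?K = j div 2 ^ p"
    proof -
      have "2 ^ n + j div 2 ^ p + 2 ^ n = j div 2 ^ p + ?K" by simp
      then have "(2 ^ n + j div 2 ^ p + 2 ^ n) mod ?K = (j div 2 ^ p) mod ?K"
        by (metis mod_add_self2)
      then show ?thesis using dv[OF True] by simp
    qed
    ultimately have "(c ^^ 2 ^ n) j = Transposition.transpose a b (j mod 2 ^ p) + 2 ^ p * (j div 2 ^ p)"
      using dv[OF True] True ab(3) by (auto simp: e_def e'_def I_def)
    then show ?thesis using j by (simp add: lift_def)
  next
    case False
    then show ?thesis using j by (simp add: idp lift_def) (auto simp: I_def Transposition.transpose_def)
  qed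
  ultimately show ?thesis by (rule that)
qed

section \<open>Fibrewise automorphisms of \<open>Y \<times> 2\<^sup>\<nat>\<close>\<close>

text \<open>Balls of radii 1 / (n + 1) about a countable dense set form a base, and its finite
  intersections form the family. Countability lets every member recur among the levels of
  \<open>U\<close>, stability under intersections serves the Dynkin argument, and separation of
  points makes disagreement sets measurable.\<close>

lemma standard_borel_space_generator:
  assumes "standard_borel_space M"
  obtains \<G> where "countable \<G>" "\<G> \<subseteq> sets M" "space M \<in> \<G>" "Int_stable \<G>"
    "sets M = sigma_sets (space M) \<G>"
    "\<And>x y. \<lbrakk>x \<in> space M; y \<in> space M; x \<noteq> y\<rbrakk> \<Longrightarrow> \<exists>A\<in>\<G>. x \<in> A \<and> y \<notin> A"
proof -
  obtain \<T> where \<T>: "completely_metrizable_space \<T>" "separable_space \<T>" "topspace \<T> = space M"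
      "sets M = sigma_sets (space M) {V. openin \<T> V}"
    using assms by (auto simp: standard_borel_space_def)
  obtain S d where "Metric_space S d" and td: "\<T> = Metric_space.mtopology S d"
    using \<T>(1) by (auto simp: completely_metrizable_space_def)
  interpret Metric_space S d by fact
  have S: "S = space M" using \<T>(3) td by simp
  obtain C where C: "countable C" "C \<subseteq> S" "mtopology closure_of C = S"
    using \<T>(2) by (auto simp: separable_space_def td)
  define B where "B = (\<lambda>(c, n). mball c (1 / real (Suc n))) ` (C \<times> UNIV)"
  have cB: "countable B" using C(1) by (auto simp: B_def)
  have B_open: "openin mtopology V" if "V \<in> B" for V using that by (auto simp: B_def)
  have base: "\<exists>b\<in>B. x \<in> b \<and> b \<subseteq> V" if V: "openin mtopology V" "x \<in> V" for V x
  proof -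
    have xS: "x \<in> S" using V openin_subset by fastforce
    obtain r where r: "r > 0" "mball x r \<subseteq> V"
      using V unfolding openin_mtopology by blast
    obtain n where n: "1 / real (Suc n) < r / 2" using nat_approx_posE[of "r/2"] r by auto
    have "\<forall>r>0. \<exists>c\<in>C. c \<in> mball x r"
      using C(3) xS unfolding metric_closure_of by blast
    moreover have "0 < 1 / real (Suc n)" by simp
    ultimately obtain c where c: "c \<in> C" "c \<in> mball x (1 / real (Suc n))" by blast
    have dxc: "d x c < 1 / real (Suc n)" and cS: "c \<in> S" using c by auto
    have "mball c (1 / real (Suc n)) \<subseteq> mball x r"
      using dxc n by (intro mball_subset) (auto simp: commute xS)
    then show ?thesis
      using c dxc cS xS r by (intro bexI[of _ "mball c (1 / real (Suc n))"])
        (auto simp: B_def commute)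
  qed
  \<comment> \<open>The factor \<open>S\<close> turns the empty intersection into the whole space,
    which thereby belongs to the family.\<close>
  define \<G> where "\<G> = (\<lambda>F. S \<inter> \<Inter>F) ` {F. F \<subseteq> B \<and> finite F}"
  have G_open: "openin mtopology V" if V: "V \<in> \<G>" for V
  proof -
    obtain F where F: "F \<subseteq> B" "finite F" "V = S \<inter> \<Inter>F" using V by (auto simp: \<G>_def)
    show ?thesis
    proof (cases "F = {}")
      case False
      then have "openin mtopology (\<Inter>F)" using F B_open by (intro openin_Inter) auto
      then show ?thesis using F(3) openin_topspace[of mtopology] by (metis openin_Int topspace_mtopology)
    qed (use F openin_topspace[of mtopology] in auto)
  qed
  have BG: "b \<in> \<G>" if "b \<in> B" for b
    using that openin_subset[OF B_open[OF that]]
    by (auto simp: \<G>_def intro!: image_eqI[of _ _ "{b}"])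
  show ?thesis
  proof
    have "countable {F. finite F \<and> F \<subseteq> B}" using cB by (rule countable_Collect_finite_subset)
    then show "countable \<G>" by (simp add: \<G>_def conj_commute)
    show "\<G> \<subseteq> sets M" using G_open by (auto simp: \<T>(4) td)
    show "space M \<in> \<G>" by (auto simp: \<G>_def S intro!: image_eqI[of _ _ "{}"])
    show "Int_stable \<G>"
    proof (rule Int_stableI)
      fix a b assume "a \<in> \<G>" "b \<in> \<G>"
      then obtain F F' where "F \<subseteq> B" "finite F" "a = S \<inter> \<Inter>F" "F' \<subseteq> B" "finite F'" "b = S \<inter> \<Inter>F'"
        by (auto simp: \<G>_def)
      then show "a \<inter> b \<in> \<G>"
        by (auto simp: \<G>_def intro!: image_eqI[of _ _ "F \<union> F'"])
    qed
    show "sets M = sigma_sets (space M) \<G>"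
    proof
      show "sigma_sets (space M) \<G> \<subseteq> sets M"
        using \<open>\<G> \<subseteq> sets M\<close> by (rule sets.sigma_sets_subset)
      have "V \<in> sigma_sets (space M) \<G>" if "openin mtopology V" for V
      proof -
        have "V = \<Union>{b \<in> B. b \<subseteq> V}" using base[OF that] by blast
        moreover have "\<Union>{b \<in> B. b \<subseteq> V} \<in> sigma_sets (space M) \<G>"
          using cB BG by (intro sigma_sets_UNION) auto
        ultimately show ?thesis by simp
      qed
      then show "sets M \<subseteq> sigma_sets (space M) \<G>"
        unfolding \<T>(4) td by (intro sigma_sets_mono) auto
    qed
    show "\<exists>A\<in>\<G>. x \<in> A \<and> y \<notin> A" if xy: "x \<in> space M" "y \<in> space M" "x \<noteq> y" for x y
    proof -
      have xS: "x \<in> S" "y \<in> S" using xy S by auto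
      then have "d x y > 0" using xy by simp
      moreover have "openin mtopology (mball x (d x y))" by simp
      moreover have "x \<in> mball x (d x y)" using xS \<open>d x y > 0\<close> by simp
      ultimately obtain b where b: "b \<in> B" "x \<in> b" "b \<subseteq> mball x (d x y)"
        using base[of "mball x (d x y)" x] by blast
      have "y \<notin> mball x (d x y)" by simp
      then show ?thesis using BG b by blast
    qed
  qed
qed

section \<open>The Bernoulli measure on binary sequences\<close>

lemma space_cantor [simp]: "space cantor_measure = UNIV"
  by (simp add: cantor_measure_def space_PiM)

lemma prob_space_cantor: "prob_space cantor_measure"
  unfolding cantor_measure_def by (intro prob_space_PiM prob_space_measure_pmf)

lemma measurable_cantor_coord [measurable]: "(\<lambda>x. x i) \<in> cantor_measure \<rightarrow>\<^sub>M count_space UNIV"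
proof -
  have "(\<lambda>x. x i) \<in> cantor_measure \<rightarrow>\<^sub>M measure_pmf (bernoulli_pmf (1/2))"
    unfolding cantor_measure_def by (rule measurable_component_singleton) simp
  then show ?thesis by (simp cong: measurable_cong_sets)
qed

lemma measurable_cantorI:
  assumes "\<And>i. (\<lambda>z. f z i) \<in> M \<rightarrow>\<^sub>M count_space UNIV"
  shows "f \<in> M \<rightarrow>\<^sub>M cantor_measure"
  unfolding cantor_measure_def
  by (rule measurable_PiM_single') (use assms in \<open>auto cong: measurable_cong_sets\<close>)

lemma measurable_val [measurable]: "val q \<in> cantor_measure \<rightarrow>\<^sub>M count_space UNIV"
proof (induction q)
  case 0
  then show ?case by (simp add: val_0[abs_def])
next
  case (Suc q)
  note [measurable] = Suc
  show ?case unfolding val_Suc[abs_def] by measurable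
qed

text \<open>A letter is determined by any word long enough to contain it, so short words can be
  discarded. The lower bound \<open>q0\<close> will be chosen so that the words see all letters
  changed by a given flip.\<close>

lemma sets_cantor_val:
  "sets cantor_measure = sigma_sets UNIV {{x. val q x \<in> K} | q K. q \<ge> q0}" (is "_ = sigma_sets UNIV ?V")
proof
  have "?V \<subseteq> sets cantor_measure"
  proof safe
    fix q and K :: "nat set"
    have "val q -` K \<inter> space cantor_measure \<in> sets cantor_measure"
      by (rule measurable_sets[OF measurable_val]) simp
    then show "{x. val q x \<in> K} \<in> sets cantor_measure" by (simp add: vimage_def)
  qed
  then show "sigma_sets UNIV ?V \<subseteq> sets cantor_measure"
    using sets.sigma_sets_subset[of ?V cantor_measure] by simp
  have "{f. f i \<in> A} \<in> sigma_sets UNIV ?V" for i :: nat and A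
  proof (rule sigma_sets.Basic)
    have "{f. f i \<in> A} = {x. val (max q0 (Suc i)) x \<in> {n. bit n i \<in> A}}"
      using max.strict_coboundedI2[of i "Suc i" q0] by (simp add: bit_val)
    then show "{f. f i \<in> A} \<in> ?V" using max.cobounded1[of q0 "Suc i"] by blast
  qed
  moreover have "sets cantor_measure = sigma_sets UNIV {{f. f i \<in> A} | i A. True}"
    unfolding cantor_measure_def sets_PiM_single by simp
  ultimately show "sets cantor_measure \<subseteq> sigma_sets UNIV ?V"
    by (auto intro!: sigma_sets_mono)
qed

lemma cantor_measure_box:
  assumes "finite J"
  shows "emeasure cantor_measure (prod_emb UNIV (\<lambda>_. measure_pmf (bernoulli_pmf (1/2))) J (Pi\<^sub>E J A))
    = (\<Prod>i\<in>J. emeasure (measure_pmf (bernoulli_pmf (1/2))) (A i))"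
  unfolding cantor_measure_def by (rule emeasure_PiM_emb) (use assms in \<open>auto intro: prob_space_measure_pmf\<close>)

lemma measurable_flp [measurable]: "flp c \<in> cantor_measure \<rightarrow>\<^sub>M cantor_measure"
  by (rule measurable_cantorI) (simp add: flp_def)

text \<open>The fair coin is invariant under exchanging its two outcomes, so a flip preserves the
  measure of every finite-dimensional box, and boxes determine the product measure.\<close>

lemma distr_flp: "distr cantor_measure cantor_measure (flp c) = cantor_measure"
proof -
  let ?b = "measure_pmf (bernoulli_pmf (1/2))"
  let ?N = "\<lambda>i A. {b. (b \<noteq> bit c i) \<in> A}"
  have half: "emeasure ?b (?N i A) = emeasure ?b A" for i A
  proof -
    have "map_pmf (\<lambda>b. b \<noteq> bit c i) (bernoulli_pmf (1/2)) = bernoulli_pmf (1/2)"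
    proof (rule pmf_eqI)
      fix b
      have "inj (\<lambda>b. b \<noteq> bit c i)" by (auto simp: inj_def)
      from pmf_map_inj'[OF this, of "bernoulli_pmf (1/2)" "b \<noteq> bit c i"]
      have "pmf (map_pmf (\<lambda>b. b \<noteq> bit c i) (bernoulli_pmf (1/2))) ((b \<noteq> bit c i) \<noteq> bit c i) = 1/2"
        by simp
      moreover have "((b \<noteq> bit c i) \<noteq> bit c i) = b" by auto
      ultimately show "pmf (map_pmf (\<lambda>b. b \<noteq> bit c i) (bernoulli_pmf (1/2))) b = pmf (bernoulli_pmf (1/2)) b"
        by simp
    qed
    then have "emeasure ?b A = emeasure (map_pmf (\<lambda>b. b \<noteq> bit c i) (bernoulli_pmf (1/2))) A" by simp
    also have "\<dots> = emeasure ?b (?N i A)" by (simp add: vimage_def)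
    finally show ?thesis by simp
  qed
  have "distr cantor_measure cantor_measure (flp c) = PiM UNIV (\<lambda>_. ?b)"
  proof (rule measure_eqI_PiM_infinite)
    fix A and J :: "nat set"
    assume J: "finite J" "J \<subseteq> UNIV" and A: "\<And>i. i \<in> J \<Longrightarrow> A i \<in> sets ?b"
    let ?P = "prod_emb UNIV (\<lambda>_. ?b) J (Pi\<^sub>E J A)"
    have P: "?P \<in> sets cantor_measure"
      unfolding cantor_measure_def by (rule sets_PiM_I) (use J A in auto)
    have "flp c -` ?P \<inter> space cantor_measure = prod_emb UNIV (\<lambda>_. ?b) J (Pi\<^sub>E J (\<lambda>i. ?N i (A i)))"
      by (auto simp: prod_emb_def PiE_iff flp_def space_PiM)
    then show "emeasure (distr cantor_measure cantor_measure (flp c)) ?P = emeasure (PiM UNIV (\<lambda>_. ?b)) ?P"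
      using P J by (simp add: emeasure_distr cantor_measure_box half[simplified] flip: cantor_measure_def)
  next
    interpret C: prob_space cantor_measure by (rule prob_space_cantor)
    show "finite_measure (distr cantor_measure cantor_measure (flp c))"
      by (intro C.finite_measure_distr measurable_flp)
  qed (auto simp: cantor_measure_def)
  then show ?thesis by (simp add: cantor_measure_def)
qed

lemma cantor_measure_const: "measure cantor_measure {x. \<forall>i<k. x i = b} = (1/2) ^ k"
proof -
  let ?b = "measure_pmf (bernoulli_pmf (1/2))"
  have "{x. \<forall>i<k. x i = b} = prod_emb UNIV (\<lambda>_. ?b) {..<k} (Pi\<^sub>E {..<k} (\<lambda>_. {b}))"
    by (auto simp: prod_emb_def space_PiM fun_eq_iff restrict_def)
  also have "emeasure cantor_measure \<dots> = (\<Prod>i<k. emeasure ?b {b})"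
    by (rule cantor_measure_box) simp
  also have "\<dots> = (\<Prod>i<k. ennreal (1/2))"
    by (simp add: emeasure_pmf_single)
  also have "\<dots> = ennreal ((1/2) ^ k)"
    by (subst prod_constant, subst card_lessThan, rule ennreal_power) simp
  finally show ?thesis
    by (simp add: measure_def)
qed

lemma space_X: "space (X_space \<nu>) = space \<nu> \<times> UNIV"
  by (simp add: X_space_def space_pair_measure)

section \<open>The product space, fibrewise flips and the full group\<close>

locale fibred = prob_space \<nu> for \<nu> :: "'a measure" +
  fixes gen :: "nat \<Rightarrow> 'a set"
  assumes gen_sets: "gen i \<in> sets \<nu>"
    and gen_space: "space \<nu> \<in> range gen"
    and gen_Int: "Int_stable (range gen)"
    and gen_sigma: "sets \<nu> = sigma_sets (space \<nu>) (range gen)"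
    and gen_sep: "\<lbrakk>x \<in> space \<nu>; y \<in> space \<nu>; x \<noteq> y\<rbrakk> \<Longrightarrow> \<exists>i. x \<in> gen i \<and> y \<notin> gen i"
begin

abbreviation "\<Omega> \<equiv> X_space \<nu>"

lemma measurable_fst_X [measurable]: "fst \<in> \<Omega> \<rightarrow>\<^sub>M \<nu>"
  by (simp add: X_space_def)

lemma measurable_snd_X [measurable]: "snd \<in> \<Omega> \<rightarrow>\<^sub>M cantor_measure"
  by (simp add: X_space_def)

lemma measurable_into_X:
  assumes "(\<lambda>z. fst (f z)) \<in> M \<rightarrow>\<^sub>M \<nu>" "(\<lambda>z. snd (f z)) \<in> M \<rightarrow>\<^sub>M cantor_measure"
  shows "f \<in> M \<rightarrow>\<^sub>M \<Omega>"
  using measurable_Pair[OF assms] by (simp add: X_space_def)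

lemma measurable_fibre_X:
  assumes "\<And>i. (\<lambda>z. g z i) \<in> \<Omega> \<rightarrow>\<^sub>M count_space UNIV"
  shows "(\<lambda>z. (fst z, g z)) \<in> \<Omega> \<rightarrow>\<^sub>M \<Omega>"
  by (rule measurable_into_X) (use assms in \<open>auto intro!: measurable_cantorI\<close>)

lemma measurable_coord_X [measurable]: "(\<lambda>z. snd z i) \<in> \<Omega> \<rightarrow>\<^sub>M count_space UNIV"
  by (rule measurable_compose[OF measurable_snd_X measurable_cantor_coord])

lemma measurable_val_X [measurable]: "(\<lambda>z. val q (snd z)) \<in> \<Omega> \<rightarrow>\<^sub>M count_space UNIV"
  by (rule measurable_compose[OF measurable_snd_X measurable_val])

lemma times_sets: 
  assumes "A \<in> sets \<nu>" "B \<in> sets cantor_measure"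
  shows "A \<times> B \<in> sets \<Omega>"
  using assms by (simp add: X_space_def)

lemma measure_times:
  assumes "A \<in> sets \<nu>" "B \<in> sets cantor_measure"
  shows "measure \<Omega> (A \<times> B) = measure \<nu> A * measure cantor_measure B"
proof -
  interpret C: prob_space cantor_measure by (rule prob_space_cantor)
  show ?thesis
    using assms by (simp add: X_space_def measure_def C.emeasure_pair_measure_Times enn2real_mult)
qed

lemma prob_space_X: "prob_space \<Omega>"
proof -
  interpret C: prob_space cantor_measure by (rule prob_space_cantor)
  interpret P: pair_prob_space \<nu> cantor_measure ..
  show ?thesis unfolding X_space_def by (rule P.prob_space_axioms)
qed

text \<open>The index \<open>k\<close> selects the kind of set: 0 for a generator in the base, 1 for
  letter \<open>i\<close> being 1, anything else for letter \<open>i\<close> being 0. Both letter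
  values occur because \<open>separates\<close> is one-sided: the set must contain the first point
  and miss the second.\<close>

definition sepX :: "nat \<Rightarrow> ('a \<times> (nat \<Rightarrow> bool)) set" where
  "sepX n = (case prod_decode n of (k, i) \<Rightarrow>
     if k = 0 then gen i \<times> UNIV else {z \<in> space \<Omega>. snd z i = (k = 1)})"

sublocale P: mp_space \<Omega> sepX
proof (intro mp_space.intro mp_space_axioms.intro prob_space_X)
  fix n show "sepX n \<in> sets \<Omega>"
    using gen_sets by (auto simp: sepX_def split: prod.split intro!: times_sets)
      (metis sets.top space_cantor)
next
  fix z w assume zw: "z \<in> space \<Omega>" "w \<in> space \<Omega>" "z \<noteq> w"
  then consider i where "fst z \<in> gen i" "fst w \<notin> gen i" | i where "snd z i \<noteq> snd w i"
    using gen_sep by (cases z; cases w) (force simp: space_X fun_eq_iff)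
  then show "\<exists>n. z \<in> sepX n \<and> w \<notin> sepX n"
  proof cases
    case (1 i)
    then show ?thesis by (intro exI[of _ "prod_encode (0, i)"]) (auto simp: sepX_def mem_Times_iff)
  next
    case (2 i)
    then show ?thesis using zw
      by (intro exI[of _ "prod_encode (if snd z i then 1 else 2, i)"]) (auto simp: sepX_def)
  qed
qed

definition flpX :: "nat \<Rightarrow> 'a \<times> (nat \<Rightarrow> bool) \<Rightarrow> 'a \<times> (nat \<Rightarrow> bool)" where
  "flpX c z = (fst z, flp c (snd z))"

lemma flpX_flpX [simp]: "flpX c (flpX c z) = z"
  by (simp add: flpX_def)

lemma flpX_space [simp]: "flpX c z \<in> space \<Omega> \<longleftrightarrow> z \<in> space \<Omega>"
  by (cases z) (auto simp: flpX_def space_X)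

lemma flpX_inject: "flpX c z = flpX c' z \<longleftrightarrow> c = c'"
  by (simp add: flpX_def flp_inject)

lemma measurable_flpX [measurable]: "flpX c \<in> \<Omega> \<rightarrow>\<^sub>M \<Omega>"
  unfolding flpX_def[abs_def] by (rule measurable_into_X) auto

lemma distr_flpX: "distr \<Omega> \<Omega> (flpX c) = \<Omega>"
proof -
  interpret C: prob_space cantor_measure by (rule prob_space_cantor)
  have "distr \<nu> \<nu> (\<lambda>y. y) \<Otimes>\<^sub>M distr cantor_measure cantor_measure (flp c) =
      distr (\<nu> \<Otimes>\<^sub>M cantor_measure) (\<nu> \<Otimes>\<^sub>M cantor_measure) (\<lambda>(y, x). (y, flp c x))"
    by (rule pair_measure_distr) (auto simp: distr_flp C.sigma_finite_measure_axioms)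
  then show ?thesis
    by (simp add: X_space_def distr_flp distr_id2 flpX_def[abs_def] case_prod_unfold)
qed

lemma flpX_measure:
  assumes "A \<in> sets \<Omega>"
  shows "emeasure \<Omega> (flpX c -` A \<inter> space \<Omega>) = emeasure \<Omega> A"
  using emeasure_distr[of "flpX c" \<Omega> \<Omega> A] assms by (simp add: distr_flpX)

lemma R0Y_iff: "(w, z) \<in> R0Y \<nu> \<longleftrightarrow> fst z \<in> space \<nu> \<and> (\<exists>c. w = flpX c z)"
  by (cases z; cases w) (auto simp: R0Y_def flpX_def R0_iff_flp)

text \<open>The pieces on which \<open>S\<close> agrees with a fixed finite flip are moved in a
  measure-preserving way onto disjoint sets, so preimages under \<open>S\<close> cannot gain measure;
  passing to complements turns this inequality into an equality.\<close>

lemma distr_R0Y: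
  assumes [measurable]: "S \<in> \<Omega> \<rightarrow>\<^sub>M \<Omega>" and inj: "inj_on S (space \<Omega>)"
    and R: "AE z in \<Omega>. (S z, z) \<in> R0Y \<nu>"
  shows "distr \<Omega> \<Omega> S = \<Omega>"
proof -
  define D where "D c = {z \<in> space \<Omega>. S z = flpX c z}" for c
  have D_sets [measurable]: "D c \<in> sets \<Omega>" for c
    unfolding D_def by (rule P.eq_sets) auto
  have D_disj: "D m \<inter> D n = {}" if "m \<noteq> n" for m n
    unfolding D_def using that flpX_inject by (smt (verit) Int_emptyI mem_Collect_eq)
  have le: "emeasure \<Omega> (S -` A \<inter> space \<Omega>) \<le> emeasure \<Omega> A" if A [measurable]: "A \<in> sets \<Omega>" for A
  proof -
    let ?B = "\<lambda>c. S -` A \<inter> D c"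
    let ?E = "\<lambda>c. flpX c -` (?B c) \<inter> space \<Omega>"
    have B_sets: "?B c \<in> sets \<Omega>" for c
    proof -
      have "?B c = (S -` A \<inter> space \<Omega>) \<inter> D c" by (auto simp: D_def)
      then show ?thesis by simp
    qed
    have E_sets: "?E c \<in> sets \<Omega>" for c
      using B_sets by (intro measurable_sets[OF measurable_flpX]) auto
    have E_sub: "?E c \<subseteq> A" for c by (auto simp: D_def)
    have "emeasure \<Omega> (S -` A \<inter> space \<Omega>) = emeasure \<Omega> (\<Union>c. ?B c)"
    proof (rule emeasure_eq_AE)
      show "AE z in \<Omega>. z \<in> S -` A \<inter> space \<Omega> \<longleftrightarrow> z \<in> (\<Union>c. ?B c)"
        using R AE_space by eventually_elim (auto simp: D_def R0Y_iff)
    qed (use B_sets in \<open>auto simp del: UN_extend_simps UN_simps intro!: sets.countable_UN'\<close>)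
    also have "\<dots> = suminf (\<lambda>c. emeasure \<Omega> (?B c))"
      by (rule suminf_emeasure[symmetric])
        (use B_sets D_disj in \<open>auto simp: disjoint_family_on_def\<close>)
    also have "\<dots> = suminf (\<lambda>c. emeasure \<Omega> (?E c))"
      by (simp only: flpX_measure[OF B_sets])
    also have "\<dots> = emeasure \<Omega> (\<Union>c. ?E c)"
    proof (rule suminf_emeasure)
      show "disjoint_family ?E"
        unfolding disjoint_family_on_def
      proof (intro ballI impI equals0I)
        fix c c' w assume cc': "c \<noteq> c'" and "w \<in> ?E c \<inter> ?E c'"
        then have w: "w \<in> space \<Omega>" "flpX c w \<in> D c" "flpX c' w \<in> D c'" by auto
        then have "S (flpX c w) = S (flpX c' w)" by (simp add: D_def)
        then have "flpX c w = flpX c' w" using inj w by (auto simp: inj_on_def)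
        then show False using cc' by (simp add: flpX_inject)
      qed
    qed (use E_sets in auto)
    also have "\<dots> \<le> emeasure \<Omega> A"
      by (rule emeasure_mono) (use E_sub in auto)
    finally show ?thesis .
  qed
  have "measure \<Omega> (S -` A \<inter> space \<Omega>) = measure \<Omega> A" if A: "A \<in> sets \<Omega>" for A
  proof (rule antisym)
    have le': "measure \<Omega> (S -` A \<inter> space \<Omega>) \<le> measure \<Omega> A" if "A \<in> sets \<Omega>" for A
      using le[OF that] by (simp add: P.emeasure_eq_measure)
    show "measure \<Omega> (S -` A \<inter> space \<Omega>) \<le> measure \<Omega> A" by (rule le'[OF A])
    have "S -` (space \<Omega> - A) \<inter> space \<Omega> = space \<Omega> - (S -` A \<inter> space \<Omega>)"
      using measurable_space[OF assms(1)] by auto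
    then show "measure \<Omega> A \<le> measure \<Omega> (S -` A \<inter> space \<Omega>)"
      using le'[of "space \<Omega> - A"] A by (simp add: P.prob_compl)
  qed
  then show ?thesis
    by (intro measure_eqI) (auto simp: emeasure_distr P.emeasure_eq_measure)
qed

text \<open>By \<open>distr_R0Y\<close> measure preservation comes for free, so it is enough to
  exhibit a measurable bijection that moves almost every point inside its class.\<close>

lemma R0Y_full_groupI:
  assumes S: "S \<in> \<Omega> \<rightarrow>\<^sub>M \<Omega>" "S' \<in> \<Omega> \<rightarrow>\<^sub>M \<Omega>"
    "\<And>z. z \<in> space \<Omega> \<Longrightarrow> S' (S z) = z" "\<And>z. z \<in> space \<Omega> \<Longrightarrow> S (S' z) = z"
    and R: "AE z in \<Omega>. (S z, z) \<in> R0Y \<nu>"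
  shows "restrict S (space \<Omega>) \<in> full_group \<Omega> (R0Y \<nu>)"
proof -
  have "inj_on S (space \<Omega>)" using S(3) by (metis inj_onI)
  then have "distr \<Omega> \<Omega> S = \<Omega>" using S R by (intro distr_R0Y)
  then have "restrict S (space \<Omega>) \<in> mp_auts \<Omega>" using S by (intro mp_autsI)
  moreover have "AE z in \<Omega>. (restrict S (space \<Omega>) z, z) \<in> R0Y \<nu>"
    using R AE_space by eventually_elim auto
  ultimately show ?thesis by (simp add: full_group_def)
qed

lemma full_group_mp: "S \<in> full_group \<Omega> (R0Y \<nu>) \<Longrightarrow> S \<in> mp_auts \<Omega>"
  by (simp add: full_group_def)

lemma R0Y_trans: "(w, z) \<in> R0Y \<nu> \<Longrightarrow> (v, w) \<in> R0Y \<nu> \<Longrightarrow> (v, z) \<in> R0Y \<nu>"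
  by (auto simp: R0Y_def R0_def) (metis max.bounded_iff)

lemma R0Y_sym: "(w, z) \<in> R0Y \<nu> \<Longrightarrow> (z, w) \<in> R0Y \<nu>"
  by (auto simp: R0Y_def R0_def)

lemma full_group_subgroup: "subgroup (full_group \<Omega> (R0Y \<nu>)) P.G"
proof (rule P.Aut.subgroupI)
  show "full_group \<Omega> (R0Y \<nu>) \<subseteq> carrier P.G" by (auto simp: full_group_def)
  have "AE z in \<Omega>. (\<one>\<^bsub>P.G\<^esub> z, z) \<in> R0Y \<nu>"
    using AE_space by eventually_elim (auto simp: mp_one_apply R0Y_def R0_def space_X)
  then show "full_group \<Omega> (R0Y \<nu>) \<noteq> {}" by (auto simp: full_group_def)
next
  fix S assume S: "S \<in> full_group \<Omega> (R0Y \<nu>)"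
  have "AE z in \<Omega>. (S ((inv\<^bsub>P.G\<^esub> S) z), (inv\<^bsub>P.G\<^esub> S) z) \<in> R0Y \<nu>"
    by (rule mp_auts_AE[where S = "inv\<^bsub>P.G\<^esub> S" and Q = "\<lambda>z. (S z, z) \<in> R0Y \<nu>"])
      (use S in \<open>auto simp: full_group_def\<close>)
  then have "AE z in \<Omega>. ((inv\<^bsub>P.G\<^esub> S) z, z) \<in> R0Y \<nu>"
    using AE_space
    by eventually_elim (use S in \<open>auto simp: P.apply_inv full_group_mp intro: R0Y_sym\<close>)
  then show "inv\<^bsub>P.G\<^esub> S \<in> full_group \<Omega> (R0Y \<nu>)"
    using S by (auto simp: full_group_def)
next
  fix S S' assume S: "S \<in> full_group \<Omega> (R0Y \<nu>)" "S' \<in> full_group \<Omega> (R0Y \<nu>)"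
  have "AE z in \<Omega>. (S (S' z), S' z) \<in> R0Y \<nu>"
    by (rule mp_auts_AE[where S = S' and Q = "\<lambda>z. (S z, z) \<in> R0Y \<nu>"])
      (use S in \<open>auto simp: full_group_def\<close>)
  moreover have "AE z in \<Omega>. (S' z, z) \<in> R0Y \<nu>" using S by (simp add: full_group_def)
  ultimately have "AE z in \<Omega>. ((S \<otimes>\<^bsub>P.G\<^esub> S') z, z) \<in> R0Y \<nu>"
    using AE_space
    by eventually_elim (use S in \<open>auto simp: mp_mult_apply full_group_mp intro: R0Y_trans\<close>)
  then show "S \<otimes>\<^bsub>P.G\<^esub> S' \<in> full_group \<Omega> (R0Y \<nu>)"
    using S by (auto simp: full_group_def)
qed

end

section \<open>The odometer, word permutations and partial flips on the product\<close>

context fibred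
begin

lemma measure_const: "measure \<Omega> (space \<nu> \<times> {x. \<forall>i<k. x i = b}) = (1/2) ^ k"
  and const_sets: "space \<nu> \<times> {x. \<forall>i<k. x i = b} \<in> sets \<Omega>"
proof -
  have "{x \<in> space cantor_measure. \<forall>i<k. x i = b} \<in> sets cantor_measure" by measurable
  then have s: "{x. \<forall>i<k. x i = b} \<in> sets cantor_measure" by simp
  then show "space \<nu> \<times> {x. \<forall>i<k. x i = b} \<in> sets \<Omega>" by (intro times_sets) auto
  show "measure \<Omega> (space \<nu> \<times> {x. \<forall>i<k. x i = b}) = (1/2) ^ k"
    using s by (subst measure_times) (auto simp: cantor_measure_const prob_space)
qed

text \<open>The constant sequence 1 is the only place where the odometer leaves the class of a
  point; it lies in cylinders of measure 2 ^ -k for all k.\<close>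

lemma AE_not_all: "AE z in \<Omega>. \<not> (\<forall>i. snd z i)"
proof -
  let ?N = "{z \<in> space \<Omega>. \<forall>i. snd z i}"
  have N: "?N \<in> sets \<Omega>" by measurable
  have "measure \<Omega> ?N \<le> (1/2) ^ k" for k
  proof -
    have "measure \<Omega> ?N \<le> measure \<Omega> (space \<nu> \<times> {x. \<forall>i<k. x i = True})"
      by (rule P.finite_measure_mono) (auto simp: space_X intro: const_sets[of k True, simplified])
    then show ?thesis unfolding measure_const .
  qed
  moreover have "(\<lambda>k. (1/2::real) ^ k) \<longlonglongrightarrow> 0" by (rule LIMSEQ_power_zero) simp
  ultimately have "measure \<Omega> ?N \<le> 0" by (intro LIMSEQ_le_const) auto
  then have "?N \<in> null_sets \<Omega>"
    using N by (simp add: P.emeasure_eq_measure null_sets_def measure_le_0_iff)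
  then show ?thesis by (subst AE_iff_null) (simp_all add: N)
qed

abbreviation "T \<equiv> odometerY \<nu>"

lemma T_apply: "z \<in> space \<Omega> \<Longrightarrow> T z = (fst z, odometer (snd z))"
  by (simp add: odometerY_def case_prod_unfold)

lemma T_full: "T \<in> full_group \<Omega> (R0Y \<nu>)"
proof -
  have "restrict (\<lambda>z. (fst z, odometer (snd z))) (space \<Omega>) \<in> full_group \<Omega> (R0Y \<nu>)"
  proof (rule R0Y_full_groupI[where S' = "\<lambda>z. (fst z, odometer_inv (snd z))"])
    show "(\<lambda>z. (fst z, odometer (snd z))) \<in> \<Omega> \<rightarrow>\<^sub>M \<Omega>"
      by (rule measurable_fibre_X) (simp add: odometer_apply)
    show "(\<lambda>z. (fst z, odometer_inv (snd z))) \<in> \<Omega> \<rightarrow>\<^sub>M \<Omega>"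
      by (rule measurable_fibre_X) (simp add: odometer_inv_def)
    show "AE z in \<Omega>. ((fst z, odometer (snd z)), z) \<in> R0Y \<nu>"
      using AE_not_all AE_space by eventually_elim (auto simp: R0Y_def space_X intro!: odometer_R0)
  qed (auto simp: odometer_inv_odometer odometer_odometer_inv)
  then show ?thesis by (simp add: odometerY_def case_prod_unfold)
qed

lemma T_mp: "T \<in> mp_auts \<Omega>"
  using T_full by (rule full_group_mp)

definition wperm :: "'a set \<Rightarrow> nat \<Rightarrow> (nat \<Rightarrow> nat) \<Rightarrow> 'a \<times> (nat \<Rightarrow> bool) \<Rightarrow> 'a \<times> (nat \<Rightarrow> bool)" where
  "wperm A q \<sigma> = (\<lambda>z\<in>space \<Omega>. (fst z, if fst z \<in> A then act q \<sigma> (snd z) else snd z))"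

lemma wperm_apply: "z \<in> space \<Omega> \<Longrightarrow> wperm A q \<sigma> z = (fst z, if fst z \<in> A then act q \<sigma> (snd z) else snd z)"
  by (simp add: wperm_def)

lemma measurable_wperm:
  assumes [measurable]: "A \<in> sets \<nu>"
  shows "(\<lambda>z. (fst z, if fst z \<in> A then act q \<sigma> (snd z) else snd z)) \<in> \<Omega> \<rightarrow>\<^sub>M \<Omega>"
proof (rule measurable_fibre_X)
  fix i
  have "(\<lambda>z. bit (\<sigma> (val q (snd z))) i) \<in> \<Omega> \<rightarrow>\<^sub>M count_space UNIV"
    by (rule measurable_compose[OF measurable_val_X]) simp
  then have [measurable]: "(\<lambda>z. act q \<sigma> (snd z) i) \<in> \<Omega> \<rightarrow>\<^sub>M count_space UNIV"
    by (cases "i < q") (auto simp: act_def)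
  have "(\<lambda>z. if fst z \<in> A then act q \<sigma> (snd z) i else snd z i) \<in> \<Omega> \<rightarrow>\<^sub>M count_space UNIV"
    by measurable
  then show "(\<lambda>z. (if fst z \<in> A then act q \<sigma> (snd z) else snd z) i) \<in> \<Omega> \<rightarrow>\<^sub>M count_space UNIV"
    by (simp add: if_distribR)
qed

lemma act_inv_act:
  assumes "\<sigma> permutes {..<2 ^ q}"
  shows "act q (inv_into UNIV \<sigma>) (act q \<sigma> x) = x" "act q \<sigma> (act q (inv_into UNIV \<sigma>) x) = x"
  using act_act[of q \<sigma> "inv_into UNIV \<sigma>" x] act_act[of q "inv_into UNIV \<sigma>" \<sigma> x]
    permutes_less[OF assms] permutes_less[OF permutes_inv[OF assms]] permutes_inv_o[OF assms]
  by (auto simp: act_idI)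

lemma wperm_full:
  assumes "A \<in> sets \<nu>" "\<sigma> permutes {..<2 ^ q}"
  shows "wperm A q \<sigma> \<in> full_group \<Omega> (R0Y \<nu>)"
  unfolding wperm_def
proof (rule R0Y_full_groupI[OF measurable_wperm[where A = A and q = q and \<sigma> = \<sigma>]
      measurable_wperm[where A = A and q = q and \<sigma> = "inv_into UNIV \<sigma>"]])
  show "AE z in \<Omega>. ((fst z, if fst z \<in> A then act q \<sigma> (snd z) else snd z), z) \<in> R0Y \<nu>"
    using AE_space by eventually_elim (auto simp: R0Y_def space_X R0_act, auto simp: R0_def)
qed (use assms in \<open>auto simp: act_inv_act\<close>)

lemma wperm_mp: "A \<in> sets \<nu> \<Longrightarrow> \<sigma> permutes {..<2 ^ q} \<Longrightarrow> wperm A q \<sigma> \<in> mp_auts \<Omega>"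
  by (rule full_group_mp[OF wperm_full])

lemma wperm_mult:
  assumes "A \<in> sets \<nu>" "\<sigma> permutes {..<2 ^ q}" "\<tau> permutes {..<2 ^ q}"
  shows "wperm A q \<sigma> \<otimes>\<^bsub>P.G\<^esub> wperm A q \<tau> = wperm A q (\<sigma> \<circ> \<tau>)"
proof (rule mp_auts_eqI)
  fix z assume z: "z \<in> space \<Omega>"
  then have "wperm A q \<tau> z \<in> space \<Omega>" using assms by (auto intro: mp_auts_space[OF wperm_mp])
  then show "(wperm A q \<sigma> \<otimes>\<^bsub>P.G\<^esub> wperm A q \<tau>) z = wperm A q (\<sigma> \<circ> \<tau>) z"
    using z assms permutes_less[OF assms(3)] by (simp add: mp_mult_apply wperm_mp wperm_apply act_act)
qed (use assms in \<open>auto intro!: wperm_mp permutes_compose\<close>)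

lemma wperm_id: "A \<in> sets \<nu> \<Longrightarrow> wperm A q id = \<one>\<^bsub>P.G\<^esub>"
  by (rule mp_auts_eqI) (auto intro!: wperm_mp simp: permutes_id wperm_apply act_idI mp_one_apply)

lemma wperm_lift:
  assumes "q \<le> r" "\<sigma> permutes {..<2 ^ q}"
  shows "wperm A r (lift q r \<sigma>) = wperm A q \<sigma>"
  unfolding wperm_def act_lift[OF assms] ..

lemma T_wperm:
  assumes "A \<in> sets \<nu>" "Suc (Suc j) < 2 ^ q"
  shows "T \<otimes>\<^bsub>P.G\<^esub> wperm A q (Transposition.transpose j (Suc j)) =
    wperm A q (Transposition.transpose (Suc j) (Suc (Suc j))) \<otimes>\<^bsub>P.G\<^esub> T"
proof (rule mp_auts_eqI)
  have [simp]: "wperm A q (Transposition.transpose j (Suc j)) \<in> mp_auts \<Omega>"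
    "wperm A q (Transposition.transpose (Suc j) (Suc (Suc j))) \<in> mp_auts \<Omega>"
    using assms by (auto intro!: wperm_mp permutes_swap_id)
  note [simp] = T_mp
  show "T \<otimes>\<^bsub>P.G\<^esub> wperm A q (Transposition.transpose j (Suc j)) \<in> mp_auts \<Omega>"
    "wperm A q (Transposition.transpose (Suc j) (Suc (Suc j))) \<otimes>\<^bsub>P.G\<^esub> T \<in> mp_auts \<Omega>"
    by auto
  fix z assume z: "z \<in> space \<Omega>"
  then have s: "wperm A q (Transposition.transpose j (Suc j)) z \<in> space \<Omega>" "T z \<in> space \<Omega>"
    by (auto intro: mp_auts_space)
  show "(T \<otimes>\<^bsub>P.G\<^esub> wperm A q (Transposition.transpose j (Suc j))) z =
    (wperm A q (Transposition.transpose (Suc j) (Suc (Suc j))) \<otimes>\<^bsub>P.G\<^esub> T) z"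
    using z s assms by (simp add: mp_mult_apply T_apply wperm_apply odometer_transpose)
qed

lemma d_wperm_subset:
  assumes "A \<in> sets \<nu>" "B \<in> sets \<nu>" "B \<subseteq> A"
  shows "P.d (wperm A q \<sigma>) (wperm B q \<sigma>) \<le> measure \<nu> (A - B)"
proof -
  interpret C: prob_space cantor_measure by (rule prob_space_cantor)
  have "(A - B) \<times> UNIV \<in> sets \<Omega>"
    using assms sets.top[of cantor_measure] by (intro times_sets) auto
  then have "P.d (wperm A q \<sigma>) (wperm B q \<sigma>) \<le> measure \<Omega> ((A - B) \<times> UNIV)"
    using assms(3) by (intro P.d_le) (auto simp: wperm_apply split: if_splits)
  also have "\<dots> = measure \<nu> (A - B)"
    using assms sets.top[of cantor_measure] C.prob_space by (subst measure_times) auto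
  finally show ?thesis .
qed

text \<open>For a set bit \<open>b\<close> of \<open>c\<close>, the sequences with letter 0 at \<open>b\<close> form a fundamental domain of
  the involution \<open>flpX c\<close>, and \<open>proj c b\<close> projects onto it. Restricting the involution to the
  preimages under this projection gives an element for every set \<open>D\<close>, compatible with complements
  and disjoint unions.\<close>

definition proj :: "nat \<Rightarrow> nat \<Rightarrow> 'a \<times> (nat \<Rightarrow> bool) \<Rightarrow> 'a \<times> (nat \<Rightarrow> bool)" where
  "proj c b z = (if snd z b then flpX c z else z)"

definition swap_on :: "nat \<Rightarrow> nat \<Rightarrow> ('a \<times> (nat \<Rightarrow> bool)) set \<Rightarrow> 'a \<times> (nat \<Rightarrow> bool) \<Rightarrow> 'a \<times> (nat \<Rightarrow> bool)" where
  "swap_on c b D = (\<lambda>z\<in>space \<Omega>. if proj c b z \<in> D then flpX c z else z)"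

lemma swap_on_apply: "z \<in> space \<Omega> \<Longrightarrow> swap_on c b D z = (if proj c b z \<in> D then flpX c z else z)"
  by (simp add: swap_on_def)

lemma proj_flpX: "bit c b \<Longrightarrow> proj c b (flpX c z) = proj c b z"
  by (auto simp: proj_def) (auto simp: flpX_def flp_def)

lemma measurable_proj [measurable]: "proj c b \<in> \<Omega> \<rightarrow>\<^sub>M \<Omega>"
  unfolding proj_def[abs_def] by measurable

text \<open>\<open>proj\<close> takes the same value at \<open>z\<close> and at
  \<open>flpX c z\<close>, so the condition in \<open>swap_on\<close> is invariant under the flip
  and the map is its own inverse.\<close>

lemma swap_on_full:
  assumes c: "bit c b" and [measurable]: "D \<in> sets \<Omega>"
  shows "swap_on c b D \<in> full_group \<Omega> (R0Y \<nu>)"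
proof -
  have [measurable]: "(\<lambda>z. if proj c b z \<in> D then flpX c z else z) \<in> \<Omega> \<rightarrow>\<^sub>M \<Omega>"
    by measurable
  have "AE z in \<Omega>. ((if proj c b z \<in> D then flpX c z else z), z) \<in> R0Y \<nu>"
    using AE_space
  proof eventually_elim
    case (elim z)
    moreover have "z = flpX 0 z" by (simp add: flpX_def)
    ultimately show ?case by (auto simp: R0Y_iff space_X)
  qed
  then show ?thesis
    unfolding swap_on_def
    by (intro R0Y_full_groupI[where S' = "\<lambda>z. if proj c b z \<in> D then flpX c z else z"])
      (auto simp: proj_flpX[OF c])
qed

lemma swap_on_mp: "bit c b \<Longrightarrow> D \<in> sets \<Omega> \<Longrightarrow> swap_on c b D \<in> mp_auts \<Omega>"
  by (rule full_group_mp[OF swap_on_full])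

end

section \<open>The automorphism \<open>U\<close>\<close>

locale partitioned = fibred +
  fixes P :: "nat \<Rightarrow> 'a set"
  assumes P_sets: "P k \<in> sets \<nu>"
    and P_AE: "AE y in \<nu>. \<exists>k. y \<in> P k"
begin

text \<open>The words \<open>lo n\<close> and \<open>hi n\<close> are \<open>1\<dots>10\<close> and \<open>0\<dots>01\<close>: consecutive for the odometer, and,
  since \<open>p n > n + 1\<close>, both inside \<open>Z\<close> over \<open>P 0, \<dots>, P n\<close>. The exponents \<open>p n\<close> grow so fast that
  \<open>4 ^ p n\<close> times the measure of all later levels still tends to 0. Through \<open>prod_decode\<close> every
  generator \<open>gen i\<close> recurs infinitely often.\<close>

definition p :: "nat \<Rightarrow> nat" where "p n = 4 ^ (n + 1)"

definition lo :: "nat \<Rightarrow> nat" where "lo n = 2 ^ (p n - 1) - 1"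

definition hi :: "nat \<Rightarrow> nat" where "hi n = 2 ^ (p n - 1)"

definition base :: "nat \<Rightarrow> 'a set" where
  "base n = gen (fst (prod_decode n)) \<inter> (\<Union>k\<le>n. P k)"

definition level :: "nat \<Rightarrow> ('a \<times> (nat \<Rightarrow> bool)) set" where
  "level n = {z \<in> space \<Omega>. fst z \<in> base n \<and> val (p n) (snd z) \<in> {lo n, hi n}}"

lemma p_pos: "p n > 0" and p_Suc: "p (Suc n) = 4 * p n" and p_ge: "n + 2 \<le> p n"
proof -
  show "p n > 0" "p (Suc n) = 4 * p n" by (simp_all add: p_def)
  show "n + 2 \<le> p n" by (induction n) (simp_all add: p_def)
qed

lemma p_mono: "m \<le> n \<Longrightarrow> p m \<le> p n"
  by (simp add: p_def)

lemma p_strict: "m < n \<Longrightarrow> p m < p n"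
  by (simp add: p_def)

lemma lo_hi: "lo n < 2 ^ p n" "hi n < 2 ^ p n" "lo n \<noteq> hi n" "Suc (lo n) = hi n"
proof -
  have "(2::nat) ^ (p n - 1) < 2 ^ p n" using p_pos[of n] by (intro power_strict_increasing) auto
  then show "lo n < 2 ^ p n" "hi n < 2 ^ p n" by (auto simp: lo_def hi_def less_imp_diff_less)
  show "Suc (lo n) = hi n" by (simp add: lo_def hi_def)
  then show "lo n \<noteq> hi n" by linarith
qed

text \<open>Letter by letter, \<open>lo n\<close> and \<open>hi n\<close> are the words that stay
  constant until the last letter and change there. The position of the first change therefore
  determines the level, whence disjointness.\<close>

lemma val_lo_hi:
  "val (p n) x \<in> {lo n, hi n} \<longleftrightarrow> (\<forall>i<p n - 1. x i = x 0) \<and> x (p n - 1) \<noteq> x 0"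
proof -
  have lo: "lo n = mask (p n - 1)" by (simp add: lo_def mask_eq_exp_minus_1)
  have p2: "p n - 1 > 0" using p_ge[of n] by simp
  have lt: "i < p n \<longleftrightarrow> i < p n - 1 \<or> i = p n - 1" for i using p_pos[of n] by linarith
  have "val (p n) x = lo n \<longleftrightarrow> (\<forall>i<p n - 1. x i) \<and> \<not> x (p n - 1)"
    by (subst val_eq_iff[OF lo_hi(1)]) (auto simp: lo bit_mask_iff lt)
  moreover have "val (p n) x = hi n \<longleftrightarrow> (\<forall>i<p n - 1. \<not> x i) \<and> x (p n - 1)"
    by (subst val_eq_iff[OF lo_hi(2)]) (auto simp: hi_def bit_exp_iff lt)
  ultimately show ?thesis using p2 by auto
qed

lemma base_sets [measurable]: "base n \<in> sets \<nu>"
  unfolding base_def using gen_sets P_sets by auto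

lemma level_sets [measurable]: "level n \<in> sets \<Omega>"
proof -
  have [measurable]: "Measurable.pred \<Omega> (\<lambda>z. val (p n) (snd z) \<in> {lo n, hi n})"
    by (rule measurable_compose[OF measurable_val_X]) simp
  show ?thesis unfolding level_def by measurable
qed

lemma level_const: "z \<in> level n \<Longrightarrow> i < p n - 1 \<Longrightarrow> snd z i = snd z 0"
  and level_change: "z \<in> level n \<Longrightarrow> snd z (p n - 1) \<noteq> snd z 0"
  unfolding level_def val_lo_hi by blast+

lemma level_unique:
  assumes "z \<in> level m" "z \<in> level n"
  shows "m = n"
proof -
  have c: False if "m < n" "z \<in> level m" "z \<in> level n" for m n
  proof -
    have "p m - 1 < p n - 1" using p_strict[OF that(1)] p_pos[of m] by linarith
    then show False using level_const[OF that(3)] level_change[OF that(2)] by blast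
  qed
  show ?thesis
    using c[OF _ assms] c[OF _ assms(2,1)] by (meson linorder_neqE_nat)
qed

text \<open>One word permutation for each level, moving only words whose prefix is
  \<open>lo n\<close> or \<open>hi n\<close>. Such families are closed under levelwise composition
  and inverses and \<open>glue\<close> respects composition, so powers of \<open>U\<close> can be
  computed level by level. The \<open>n\<close> letters beyond the prefix provide the room for a
  cycle of length 2 ^ (n + 1).\<close>

definition admissible :: "(nat \<Rightarrow> nat \<Rightarrow> nat) \<Rightarrow> bool" where
  "admissible g \<longleftrightarrow> (\<forall>n. g n permutes {..<2 ^ (p n + n)} \<and>
     (\<forall>j. j mod 2 ^ p n \<notin> {lo n, hi n} \<longrightarrow> g n j = j))"

text \<open>Kept total on the type so that the composition laws hold without membership conditions;
  \<open>glue\<close> restricts it afterwards. The description by \<open>THE\<close> is legitimate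
  by \<open>level_unique\<close>.\<close>

definition glue_fun :: "(nat \<Rightarrow> nat \<Rightarrow> nat) \<Rightarrow> 'a \<times> (nat \<Rightarrow> bool) \<Rightarrow> 'a \<times> (nat \<Rightarrow> bool)" where
  "glue_fun g z = (if \<exists>n. z \<in> level n
     then let n = (THE n. z \<in> level n) in (fst z, act (p n + n) (g n) (snd z)) else z)"

definition glue :: "(nat \<Rightarrow> nat \<Rightarrow> nat) \<Rightarrow> 'a \<times> (nat \<Rightarrow> bool) \<Rightarrow> 'a \<times> (nat \<Rightarrow> bool)" where
  "glue g = restrict (glue_fun g) (space \<Omega>)"

lemma glue_level: "z \<in> level n \<Longrightarrow> glue_fun g z = (fst z, act (p n + n) (g n) (snd z))"
proof -
  assume z: "z \<in> level n"
  then have "(THE n. z \<in> level n) = n" using level_unique by blast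
  then show ?thesis using z by (auto simp: glue_fun_def)
qed

lemma glue_off: "(\<And>n. z \<notin> level n) \<Longrightarrow> glue_fun g z = z"
  by (simp add: glue_fun_def)

lemma admissible_perm: "admissible g \<Longrightarrow> g n permutes {..<2 ^ (p n + n)}"
  by (simp add: admissible_def)

text \<open>An image without one of the two prefixes would be a fixed point, and by injectivity it
  would coincide with the point it came from.\<close>

lemma admissible_stable:
  assumes "admissible g" "j mod 2 ^ p n \<in> {lo n, hi n}"
  shows "g n j mod 2 ^ p n \<in> {lo n, hi n}"
proof (rule ccontr)
  assume "g n j mod 2 ^ p n \<notin> {lo n, hi n}"
  then have "g n (g n j) = g n j" using assms(1) unfolding admissible_def by blast
  then have "g n j = j" using permutes_inj[OF admissible_perm[OF assms(1)], of n] by (auto dest: injD)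
  with \<open>g n j mod 2 ^ p n \<notin> {lo n, hi n}\<close> assms(2) show False by simp
qed

lemma level_act:
  assumes "admissible g" "z \<in> level n"
  shows "(fst z, act (p n + n) (g n) (snd z)) \<in> level n"
proof -
  have tb: "val (p n + n) x mod 2 ^ p n = val (p n) x" for x
    using val_take_bit[of "p n" "p n + n" x] by (simp add: take_bit_eq_mod)
  have "val (p n) (act (p n + n) (g n) (snd z)) = g n (val (p n + n) (snd z)) mod 2 ^ p n"
    using permutes_less[OF admissible_perm[OF assms(1)]] by (subst tb[symmetric], subst val_act) auto
  also have "\<dots> \<in> {lo n, hi n}"
    by (rule admissible_stable[OF assms(1)]) (use assms(2) in \<open>simp add: level_def tb del: insert_iff\<close>)
  finally show ?thesis using assms(2) by (simp add: level_def space_X mem_Times_iff del: insert_iff)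
qed

text \<open>Each level is invariant under an admissible family, so the second map meets the point on
  the level where the first one left it.\<close>

lemma glue_fun_comp:
  assumes "admissible g" "admissible h" 
  shows "glue_fun g (glue_fun h z) = glue_fun (\<lambda>n. g n \<circ> h n) z"
proof (cases "\<exists>n. z \<in> level n")
  case True
  then obtain n where n: "z \<in> level n" ..
  show ?thesis
    using level_act[OF assms(2) n] permutes_less[OF admissible_perm[OF assms(2)]]
    by (simp add: glue_level[OF n] glue_level[OF level_act[OF assms(2) n]] act_act)
qed (simp add: glue_off)

lemma admissible_id: "admissible (\<lambda>n. id)"
  by (simp add: admissible_def permutes_id)

lemma glue_fun_id: "glue_fun (\<lambda>n. id) z = z"
  by (cases "\<exists>n. z \<in> level n") (auto simp: glue_level act_idI glue_off)

lemma admissible_comp: "admissible g \<Longrightarrow> admissible h \<Longrightarrow> admissible (\<lambda>n. g n \<circ> h n)"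
  by (simp add: admissible_def permutes_compose)

lemma admissible_inv: "admissible g \<Longrightarrow> admissible (\<lambda>n. inv_into UNIV (g n))"
  unfolding admissible_def by (metis permutes_inv permutes_inverses(2))

lemma admissible_funpow: "admissible g \<Longrightarrow> admissible (\<lambda>n. g n ^^ k)"
proof (induction k)
  case 0
  then show ?case using admissible_id by (simp add: id_def)
next
  case (Suc k)
  then show ?case using admissible_comp[of g "\<lambda>n. g n ^^ k"] by (simp add: comp_def)
qed

lemma measurable_glue_fun: "glue_fun g \<in> \<Omega> \<rightarrow>\<^sub>M \<Omega>"
proof (rule measurableI)
  fix z assume "z \<in> space \<Omega>"
  then show "glue_fun g z \<in> space \<Omega>"
    by (cases "\<exists>n. z \<in> level n") (auto simp: glue_level glue_off space_X)
next
  fix A assume A: "A \<in> sets \<Omega>"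
  \<comment> \<open>On a level the first coordinate lies in the space of \<nu>, so the conditional
    is harmless; it only gives the map the shape of \<open>measurable_wperm\<close>.\<close>
  let ?E = "\<lambda>n z. (fst z, if fst z \<in> space \<nu> then act (p n + n) (g n) (snd z) else snd z)"
  have "glue_fun g -` A \<inter> space \<Omega> =
      (\<Union>n. level n \<inter> (?E n -` A \<inter> space \<Omega>)) \<union> (A \<inter> (space \<Omega> - (\<Union>n. level n)))" (is "?L = ?R")
  proof (rule Set.set_eqI)
    fix z
    show "z \<in> ?L \<longleftrightarrow> z \<in> ?R"
    proof (cases "\<exists>n. z \<in> level n")
      case True
      then obtain n where n: "z \<in> level n" ..
      then have "z \<in> level m \<longleftrightarrow> m = n" for m using level_unique by blast
      moreover have "fst z \<in> space \<nu>" using n by (auto simp: level_def space_X)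
      ultimately show ?thesis using n by (auto simp: glue_level)
    next
      case False
      then show ?thesis by (auto simp: glue_off)
    qed
  qed
  also have "\<dots> \<in> sets \<Omega>"
    using A measurable_sets[OF measurable_wperm[OF sets.top] A]
    by (intro sets.Un sets.countable_UN' sets.Int sets.Diff) auto
  finally show "glue_fun g -` A \<inter> space \<Omega> \<in> sets \<Omega>" .
qed

lemma glue_full:
  assumes "admissible g"
  shows "glue g \<in> full_group \<Omega> (R0Y \<nu>)"
  unfolding glue_def
proof (rule R0Y_full_groupI[OF measurable_glue_fun measurable_glue_fun[of "\<lambda>n. inv_into UNIV (g n)"]])
  note i = admissible_inv[OF assms]
  have "inv_into UNIV (g n) \<circ> g n = id" "g n \<circ> inv_into UNIV (g n) = id" for n
    using permutes_inv_o[OF admissible_perm[OF assms]] by auto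
  then show "glue_fun (\<lambda>n. inv_into UNIV (g n)) (glue_fun g z) = z"
    "glue_fun g (glue_fun (\<lambda>n. inv_into UNIV (g n)) z) = z" for z
    by (simp_all add: glue_fun_comp assms i glue_fun_id)
  show "AE z in \<Omega>. (glue_fun g z, z) \<in> R0Y \<nu>"
    using AE_space
  proof eventually_elim
    case (elim z)
    then show ?case
      by (cases "\<exists>n. z \<in> level n")
        (auto simp: glue_level glue_off R0Y_def space_X R0_act, auto simp: R0_def)
  qed
qed

lemma glue_mp: "admissible g \<Longrightarrow> glue g \<in> mp_auts \<Omega>"
  by (rule full_group_mp[OF glue_full])

lemma glue_apply: "z \<in> space \<Omega> \<Longrightarrow> glue g z = glue_fun g z"
  by (simp add: glue_def)

lemma glue_pow: "admissible g \<Longrightarrow> glue g [^]\<^bsub>P.G\<^esub> (k::nat) = glue (\<lambda>n. g n ^^ k)"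
proof (induction k)
  case 0
  show ?case
    using glue_mp[OF admissible_id]
    by (intro mp_auts_eqI) (auto simp: glue_apply glue_fun_id[unfolded id_def] mp_one_apply id_def)
next
  case (Suc k)
  note g = Suc.prems
  show ?case
  proof (rule mp_auts_eqI)
    fix z assume z: "z \<in> space \<Omega>"
    then have "glue g z \<in> space \<Omega>" by (rule mp_auts_space[OF glue_mp[OF g]])
    then show "(glue g [^]\<^bsub>P.G\<^esub> Suc k) z = glue (\<lambda>n. g n ^^ Suc k) z"
      using z Suc g by (simp add: mp_mult_apply glue_mp admissible_funpow glue_apply glue_fun_comp
          funpow_Suc_right del: funpow.simps)
  qed (use g in \<open>auto intro!: glue_mp admissible_funpow simp del: funpow.simps\<close>)
qed

definition cyc :: "nat \<Rightarrow> nat \<Rightarrow> nat" where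
  "cyc n = (SOME c. c permutes {..<2 ^ (p n + n)} \<and> (\<forall>j. c j \<noteq> j \<longrightarrow> j mod 2 ^ p n \<in> {lo n, hi n}) \<and>
     (\<forall>j<2 ^ (p n + n). (c ^^ 2 ^ n) j = lift (p n) (p n + n) (Transposition.transpose (lo n) (hi n)) j))"

lemma cyc: "cyc n permutes {..<2 ^ (p n + n)}" "cyc n j \<noteq> j \<Longrightarrow> j mod 2 ^ p n \<in> {lo n, hi n}"
  "j < 2 ^ (p n + n) \<Longrightarrow>
    (cyc n ^^ 2 ^ n) j = lift (p n) (p n + n) (Transposition.transpose (lo n) (hi n)) j"
proof -
  have "\<exists>c. c permutes {..<2 ^ (p n + n)} \<and> (\<forall>j. c j \<noteq> j \<longrightarrow> j mod 2 ^ p n \<in> {lo n, hi n}) \<and>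
     (\<forall>j<2 ^ (p n + n). (c ^^ 2 ^ n) j = lift (p n) (p n + n) (Transposition.transpose (lo n) (hi n)) j)"
    by (rule ex_dyadic_cycle[OF lo_hi(1-3)[of n], where n = n], rule exI, intro conjI allI impI) assumption+
  from someI_ex[OF this, folded cyc_def]
  show "cyc n permutes {..<2 ^ (p n + n)}" "cyc n j \<noteq> j \<Longrightarrow> j mod 2 ^ p n \<in> {lo n, hi n}"
    "j < 2 ^ (p n + n) \<Longrightarrow>
      (cyc n ^^ 2 ^ n) j = lift (p n) (p n + n) (Transposition.transpose (lo n) (hi n)) j"
    by blast+
qed

lemma admissible_cyc: "admissible cyc"
  unfolding admissible_def using cyc by blast

definition U :: "'a \<times> (nat \<Rightarrow> bool) \<Rightarrow> 'a \<times> (nat \<Rightarrow> bool)" where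
  "U = glue cyc"

lemma U_full: "U \<in> full_group \<Omega> (R0Y \<nu>)"
  unfolding U_def by (rule glue_full[OF admissible_cyc])

lemma U_mp: "U \<in> mp_auts \<Omega>"
  by (rule full_group_mp[OF U_full])

lemma U_pow: "U [^]\<^bsub>P.G\<^esub> (k::nat) = glue (\<lambda>n. cyc n ^^ k)"
  unfolding U_def by (rule glue_pow[OF admissible_cyc])

lemma swap_perm: "Transposition.transpose (lo n) (hi n) permutes {..<2 ^ p n}"
  using lo_hi by (intro permutes_swap_id) auto

text \<open>The exchange of prefixes is an involution, so the power 2 ^ (n + 1) of the cycle is
  trivial on coded words, and for k > n every multiple of 2 ^ k is a multiple of that
  exponent.\<close>

lemma cyc_double:
  assumes "j < 2 ^ (p n + n)" "n < k"
  shows "(cyc n ^^ (2 ^ k * t)) j = j"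
proof -
  let ?f = "cyc n ^^ 2 ^ Suc n" and ?s = "lift (p n) (p n + n) (Transposition.transpose (lo n) (hi n))"
  have s: "?s j < 2 ^ (p n + n)"
    using permutes_less[OF lift_permutes[OF _ swap_perm] assms(1)] by simp
  have t: "Transposition.transpose (lo n) (hi n) (j mod 2 ^ p n) < 2 ^ p n"
    by (rule permutes_less[OF swap_perm]) simp
  have "?f = cyc n ^^ 2 ^ n \<circ> cyc n ^^ 2 ^ n"
    by (simp add: mult_2 funpow_add)
  then have "?f j = ?s (?s j)" using s assms(1) by (simp add: cyc(3))
  also have "\<dots> = j" using s assms(1) t by (simp add: lift_def)
  finally have f: "?f j = j" .
  have "2 ^ k * t = 2 ^ Suc n * (2 ^ (k - Suc n) * t)"
    using assms(2) by (simp add: power_add[symmetric] mult.assoc[symmetric] del: power_Suc)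
  then have "(cyc n ^^ (2 ^ k * t)) j = (?f ^^ (2 ^ (k - Suc n) * t)) j"
    by (simp only: funpow_mult)
  also have "(?f ^^ m) j = j" for m
    by (induction m) (use f in \<open>auto simp del: power_Suc\<close>)
  finally show ?thesis .
qed

text \<open>Two cylinders that together contain all levels from \<open>n\<close> on, since a point
  of a level m >= n begins with at least \<open>p n - 1\<close> equal letters.\<close>

definition tail :: "nat \<Rightarrow> ('a \<times> (nat \<Rightarrow> bool)) set" where
  "tail n = (\<Union>b. space \<nu> \<times> {x. \<forall>i<p n - 1. x i = b})"

lemma tail_sets: "tail n \<in> sets \<Omega>"
  unfolding tail_def by (intro sets.finite_UN const_sets) auto

lemma level_tail: "n \<le> m \<Longrightarrow> level m \<subseteq> tail n"
proof
  fix z assume "n \<le> m" "z \<in> level m"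
  then have "p n - 1 \<le> p m - 1" using p_mono[of n m] by linarith
  then have "\<forall>i<p n - 1. snd z i = snd z 0"
    using level_const[OF \<open>z \<in> level m\<close>] by (meson order_less_le_trans)
  moreover have "fst z \<in> space \<nu>"
    using \<open>z \<in> level m\<close> by (auto simp: level_def space_X)
  ultimately show "z \<in> tail n"
    unfolding tail_def mem_Times_iff UN_iff mem_Collect_eq by blast
qed

lemma measure_tail: "measure \<Omega> (tail n) \<le> 4 / 2 ^ p n"
proof -
  have "tail n = (space \<nu> \<times> {x. \<forall>i<p n - 1. x i = True}) \<union> (space \<nu> \<times> {x. \<forall>i<p n - 1. x i = False})"
    unfolding tail_def UNIV_bool by blast
  also have "measure \<Omega> \<dots> \<le> (1/2) ^ (p n - 1) + (1/2) ^ (p n - 1)"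
    by (rule order_trans[OF measure_Un_le[OF const_sets const_sets]]) (simp only: measure_const)
  also have "\<dots> = 4 / 2 ^ p n"
    using p_pos[of n] by (cases "p n") (auto simp: power_one_over field_simps)
  finally show ?thesis .
qed

text \<open>Exponents divisible by 2 ^ k are trivial on the levels below \<open>k\<close>, so only
  the levels inside \<open>tail k\<close> can be moved.\<close>

lemma U_pow_near_id: "P.d (U [^]\<^bsub>P.G\<^esub> ((2::nat) ^ k * t)) \<one>\<^bsub>P.G\<^esub> \<le> 4 / 2 ^ p k"
proof -
  have "P.d (U [^]\<^bsub>P.G\<^esub> ((2::nat) ^ k * t)) \<one>\<^bsub>P.G\<^esub> \<le> measure \<Omega> (tail k)"
  proof (rule P.d_le)
    show "{z \<in> space \<Omega>. (U [^]\<^bsub>P.G\<^esub> ((2::nat) ^ k * t)) z \<noteq> \<one>\<^bsub>P.G\<^esub> z} \<subseteq> tail k"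
    proof safe
      fix y x assume z: "(y, x) \<in> space \<Omega>"
        and ne: "(U [^]\<^bsub>P.G\<^esub> ((2::nat) ^ k * t)) (y, x) \<noteq> \<one>\<^bsub>P.G\<^esub> (y, x)"
      then obtain n where n: "(y, x) \<in> level n"
        by (cases "\<exists>n. (y, x) \<in> level n") (auto simp: U_pow glue_apply glue_off mp_one_apply)
      moreover have "\<not> n < k"
        using ne z n by (auto simp: U_pow glue_apply glue_level mp_one_apply cyc_double act_idI)
      ultimately show "(y, x) \<in> tail k" using level_tail[of k n] by auto
    qed
  qed (rule tail_sets)
  then show ?thesis using measure_tail[of k] by simp
qed

text \<open>At the power 2 ^ n the levels below \<open>n\<close> are already trivial and level
  \<open>n\<close> carries exactly the exchange of prefixes. Off level \<open>n\<close> the word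
  permutation is trivial too, so the two maps can differ only on later levels.\<close>

lemma U_pow_near_swap:
  "P.d (wperm (base n) (p n) (Transposition.transpose (lo n) (hi n))) (U [^]\<^bsub>P.G\<^esub> ((2::nat) ^ n))
    \<le> 4 / 2 ^ p (Suc n)"
proof -
  let ?W = "wperm (base n) (p n) (Transposition.transpose (lo n) (hi n))"
  have "P.d ?W (U [^]\<^bsub>P.G\<^esub> ((2::nat) ^ n)) \<le> measure \<Omega> (tail (Suc n))"
  proof (rule P.d_le)
    show "{z \<in> space \<Omega>. ?W z \<noteq> (U [^]\<^bsub>P.G\<^esub> ((2::nat) ^ n)) z} \<subseteq> tail (Suc n)"
    proof 
      fix z assume "z \<in> {z \<in> space \<Omega>. ?W z \<noteq> (U [^]\<^bsub>P.G\<^esub> ((2::nat) ^ n)) z}"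
      then have z: "z \<in> space \<Omega>" and ne: "?W z \<noteq> glue_fun (\<lambda>m. cyc m ^^ 2 ^ n) z"
        by (auto simp: U_pow glue_apply)
      have W_id: "?W z = z" if "z \<notin> level n"
        using that z by (auto simp: wperm_apply level_def intro!: act_idI prod_eqI)
      have "z \<notin> level n"
      proof
        assume l: "z \<in> level n"
        have "act (p n) (Transposition.transpose (lo n) (hi n)) (snd z) =
            act (p n + n) (lift (p n) (p n + n) (Transposition.transpose (lo n) (hi n))) (snd z)"
          by (rule act_lift[symmetric]) (auto simp: swap_perm)
        also have "\<dots> = act (p n + n) (cyc n ^^ 2 ^ n) (snd z)"
          by (rule act_cong) (simp add: cyc(3))
        finally show False
          using ne l z by (simp add: glue_level wperm_apply) (simp add: level_def)
      qed
      then have "glue_fun (\<lambda>m. cyc m ^^ 2 ^ n) z \<noteq> z" using W_id ne by simp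
      then obtain m where m: "z \<in> level m" using glue_off by blast
      have "\<not> m < n"
      proof
        assume "m < n"
        then have "glue_fun (\<lambda>m. cyc m ^^ 2 ^ n) z = z"
          using m cyc_double[of "val (p m + m) (snd z)" m n 1] by (simp add: glue_level act_idI)
        with \<open>glue_fun (\<lambda>m. cyc m ^^ 2 ^ n) z \<noteq> z\<close> show False ..
      qed
      moreover have "m \<noteq> n" using m \<open>z \<notin> level n\<close> by auto
      ultimately show "z \<in> tail (Suc n)" using m level_tail[of "Suc n" m] by auto
    qed
  qed (rule tail_sets)
  then show ?thesis using measure_tail[of "Suc n"] by simp
qed

lemma supp_U: "supp \<Omega> U \<subseteq> Z_set P"
proof
  fix z assume "z \<in> supp \<Omega> U"
  then obtain n where n: "z \<in> level n"
    by (auto simp: supp_def U_def glue_apply) (metis glue_off)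
  then obtain k where k: "k \<le> n" "fst z \<in> P k" by (auto simp: level_def base_def)
  \<comment> \<open>From \<open>k <= n\<close> and \<open>n + 2 <= p n\<close>, the first k + 1
    letters come before the change at position \<open>p n - 1\<close>.\<close>
  have c: "snd z i = snd z 0" if "i < k + 1" for i
    using that k(1) p_ge[of n] by (intro level_const[OF n]) linarith
  have "snd z \<in> cylinder (replicate (k + 1) (snd z 0))"
    unfolding cylinder_def
  proof (intro CollectI allI impI)
    fix i assume "i < length (replicate (k + 1) (snd z 0))"
    then have i: "i < k + 1" by (simp only: length_replicate)
    show "snd z i = replicate (k + 1) (snd z 0) ! i"
      unfolding List.nth_replicate[OF i] by (rule c[OF i])
  qed
  then have "snd z \<in> cylinder (replicate (k + 1) False) \<union> cylinder (replicate (k + 1) True)"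
    by (cases "snd z 0") auto
  then show "z \<in> Z_set P" using k(2) unfolding Z_set_def by (cases z) auto
qed

end

section \<open>Density of the generated subgroup\<close>

locale generating = partitioned +
  fixes m :: nat
begin

definition V :: "'a \<times> (nat \<Rightarrow> bool) \<Rightarrow> 'a \<times> (nat \<Rightarrow> bool)" where
  "V = U [^]\<^bsub>P.G\<^esub> ((2::nat) ^ m)"

lemma V_mp: "V \<in> mp_auts \<Omega>"
  unfolding V_def using U_mp by simp

lemma V_pow: "V [^]\<^bsub>P.G\<^esub> (k::nat) = U [^]\<^bsub>P.G\<^esub> (2 ^ m * k)"
  unfolding V_def using U_mp by (simp add: P.Aut.nat_pow_pow)

sublocale S: mp_subgroup \<Omega> sepX "generate P.G {T, V}"
proof (intro mp_subgroup.intro mp_subgroup_axioms.intro P.mp_space_axioms)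
  show "subgroup (generate P.G {T, V}) P.G"
    using T_mp V_mp by (intro P.Aut.generate_is_subgroup) auto
qed

lemma T_near: "T \<in> S.near 0"
  by (intro S.\<Gamma>_near generate.incl) simp

lemma V_pow_\<Gamma>: "V [^]\<^bsub>P.G\<^esub> (k::nat) \<in> generate P.G {T, V}"
proof -
  have V: "V \<in> generate P.G {T, V}" by (rule generate.incl) simp
  show ?thesis
    by (induction k) (use V subgroup.one_closed[OF S.\<Gamma>] subgroup.m_closed[OF S.\<Gamma>] in auto)
qed

abbreviation "tr j \<equiv> Transposition.transpose j (Suc j)"

lemma tr_perm: "Suc j < N \<Longrightarrow> tr j permutes {..<N}"
  by (intro permutes_swap_id) auto

text \<open>For n >= m the exponent 2 ^ n is a multiple of 2 ^ m, so the power of \<open>U\<close>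
  that isolates level \<open>n\<close> is a power of \<open>V\<close> and belongs to the generated
  group.\<close>

lemma mid_near:
  assumes "m \<le> n"
  shows "wperm (base n) (p n) (tr (lo n)) \<in> S.near (4 / 2 ^ p (Suc n))"
proof -
  have "U [^]\<^bsub>P.G\<^esub> ((2::nat) ^ n) = V [^]\<^bsub>P.G\<^esub> ((2::nat) ^ (n - m))"
    unfolding V_pow using assms by (simp flip: power_add)
  then have "U [^]\<^bsub>P.G\<^esub> ((2::nat) ^ n) \<in> S.near 0"
    using V_pow_\<Gamma> S.\<Gamma>_near by simp
  then have "wperm (base n) (p n) (Transposition.transpose (lo n) (hi n)) \<in> S.near (0 + 4 / 2 ^ p (Suc n))"
    by (rule S.near_shift[OF _ wperm_mp[OF base_sets swap_perm] U_pow_near_swap])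
  then show ?thesis by (simp add: lo_hi(4))
qed

text \<open>\<open>T\<close> lies in the group itself, so conjugating by it shifts the transposition
  without increasing the error.\<close>

lemma conj_T:
  assumes "A \<in> sets \<nu>" "Suc (Suc j) < 2 ^ q"
  shows "wperm A q (tr j) \<in> S.near r \<longleftrightarrow> wperm A q (tr (Suc j)) \<in> S.near r"
proof -
  let ?a = "wperm A q (tr j)" and ?b = "wperm A q (tr (Suc j))"
  have ab: "?a \<in> mp_auts \<Omega>" "?b \<in> mp_auts \<Omega>"
    using assms by (auto intro!: wperm_mp tr_perm)
  have e: "T \<otimes>\<^bsub>P.G\<^esub> ?a = ?b \<otimes>\<^bsub>P.G\<^esub> T" by (rule T_wperm[OF assms])
  have b: "?b = T \<otimes>\<^bsub>P.G\<^esub> ?a \<otimes>\<^bsub>P.G\<^esub> inv\<^bsub>P.G\<^esub> T"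
    unfolding e using ab T_mp by (simp add: P.Aut.m_assoc)
  have a: "?a = inv\<^bsub>P.G\<^esub> T \<otimes>\<^bsub>P.G\<^esub> (?b \<otimes>\<^bsub>P.G\<^esub> T)"
    unfolding e[symmetric] using ab T_mp by (simp add: P.Aut.m_assoc[symmetric])
  have "?b \<in> S.near (0 + r + 0)" if "?a \<in> S.near r"
    by (subst b) (intro S.near_mult S.near_inv T_near that)
  moreover have "?a \<in> S.near (0 + (r + 0))" if "?b \<in> S.near r"
    by (subst a) (intro S.near_mult S.near_inv T_near that)
  ultimately show ?thesis by auto
qed

text \<open>Starting from the single known transposition at index \<open>lo n\<close>, conjugation
  by \<open>T\<close> reaches the smaller indices downwards and the larger ones upwards.\<close>

lemma adjacent_near:
  assumes "m \<le> n" "Suc j < 2 ^ p n"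
  shows "wperm (base n) (p n) (tr j) \<in> S.near (4 / 2 ^ p (Suc n))"
proof (cases "j \<le> lo n")
  case True
  then show ?thesis
  proof (induction rule: inc_induct)
    case (step i)
    then show ?case using conj_T[OF base_sets, of i "p n" n] lo_hi(1,2,4)[of n] by simp
  qed (rule mid_near[OF assms(1)])
next
  case False
  then have "lo n \<le> j" by simp
  then show ?thesis using assms(2)
  proof (induction rule: dec_induct)
    case (step i)
    then show ?case using conj_T[OF base_sets, of i "p n" n] by simp
  qed (rule mid_near[OF assms(1)])
qed

text \<open>At most 4 ^ p n adjacent transpositions are multiplied, each with error 4 / 16 ^ p n
  because \<open>p (Suc n) = 4 * p n\<close>. The product of the two bounds still tends to
  0.\<close>

lemma word_perm_near:
  assumes "m \<le> n" "\<sigma> permutes {..<2 ^ p n}"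
  shows "wperm (base n) (p n) \<sigma> \<in> S.near (4 / 4 ^ p n)"
proof -
  let ?\<delta> = "4 / 2 ^ p (Suc n) :: real"
  have "\<exists>k\<le>2 ^ p n * 2 ^ p n. wperm (base n) (p n) \<sigma> \<in> S.near (real k * ?\<delta>)"
    using assms(2)
  proof (rule adjacent_transpositions_induct)
    show "wperm (base n) (p n) id \<in> S.near (real 0 * ?\<delta>)"
      using S.\<Gamma>_near[OF subgroup.one_closed[OF S.\<Gamma>]] by (simp add: wperm_id[OF base_sets])
  next
    fix k \<sigma> j
    assume *: "wperm (base n) (p n) \<sigma> \<in> S.near (real k * ?\<delta>)" "\<sigma> permutes {..<2 ^ p n}" "Suc j < 2 ^ p n"
    have "wperm (base n) (p n) (tr j \<circ> \<sigma>) = wperm (base n) (p n) (tr j) \<otimes>\<^bsub>P.G\<^esub> wperm (base n) (p n) \<sigma>"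
      by (rule wperm_mult[OF base_sets tr_perm *(2), symmetric]) fact
    also have "\<dots> \<in> S.near (?\<delta> + real k * ?\<delta>)"
      by (intro S.near_mult adjacent_near assms(1) *)
    finally show "wperm (base n) (p n) (tr j \<circ> \<sigma>) \<in> S.near (real (Suc k) * ?\<delta>)"
      by (simp add: algebra_simps add_divide_distrib)
  qed
  then obtain k where k: "k \<le> 2 ^ p n * 2 ^ p n" "wperm (base n) (p n) \<sigma> \<in> S.near (real k * ?\<delta>)"
    by blast
  have "real k * ?\<delta> \<le> (2 ^ p n * 2 ^ p n) * ?\<delta>"
    using of_nat_mono[OF k(1), where ?'a = real] by (intro mult_right_mono) auto
  also have "\<dots> = 4 / 4 ^ p n"
  proof -
    have "(2::real) ^ p (Suc n) = (2 ^ p n * 2 ^ p n) * 4 ^ p n"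
      unfolding p_Suc by (simp add: power_mult flip: power_mult_distrib)
    then show ?thesis by simp
  qed
  finally show ?thesis using k(2) S.near_mono by blast
qed

text \<open>The loss is bounded by the measure of what \<open>P 0\<close>, ..., \<open>P n\<close>
  leave uncovered. This bound does not depend on the generator, and it tends to 0 as the pieces
  cover almost all of \<open>Y\<close>.\<close>

lemma base_exhausts:
  assumes "\<epsilon> > 0"
  shows "\<exists>N. \<forall>n\<ge>N. measure \<nu> (gen (fst (prod_decode n)) - base n) < \<epsilon>"
proof -
  let ?Q = "\<lambda>n. space \<nu> - (\<Union>k\<le>n. P k)"
  have Q: "?Q n \<in> sets \<nu>" for n using P_sets by auto
  have "(\<lambda>n. measure \<nu> (?Q n)) \<longlonglongrightarrow> measure \<nu> (\<Inter>n. ?Q n)"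
    by (rule finite_Lim_measure_decseq) (use Q in \<open>auto simp: decseq_def\<close>)
  moreover have "measure \<nu> (\<Inter>n. ?Q n) = 0"
  proof -
    have "AE y in \<nu>. y \<notin> (\<Inter>n. ?Q n)" using P_AE by eventually_elim auto
    moreover have "(\<Inter>n. ?Q n) \<in> sets \<nu>" by (intro sets.countable_INT') (use Q in auto)
    ultimately have "(\<Inter>n. ?Q n) \<in> null_sets \<nu>" by (subst AE_iff_null_sets)
    then show ?thesis by (rule measure_eq_0_null_sets)
  qed
  ultimately have "\<forall>\<^sub>F n in sequentially. measure \<nu> (?Q n) < \<epsilon>"
    using assms order_tendstoD(2) by force
  then obtain N where N: "\<And>n. n \<ge> N \<Longrightarrow> measure \<nu> (?Q n) < \<epsilon>"
    by (auto simp: eventually_sequentially)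
  have le: "measure \<nu> (gen i - base n) \<le> measure \<nu> (?Q n)" if "i = fst (prod_decode n)" for i n
    using Q sets.sets_into_space[OF gen_sets[of i]] that
    by (intro finite_measure_mono) (auto simp: base_def)
  show ?thesis using order_le_less_trans[OF le[OF refl] N] by blast
qed

text \<open>For a fixed \<sigma> the level may be taken arbitrarily high: \<sigma> is read on
  prefixes of words of length \<open>p n\<close>, while \<open>base n\<close> fills up
  \<open>gen i\<close> and the error of the word permutation disappears.\<close>

lemma gen_perm_H:
  assumes "\<sigma> permutes {..<2 ^ q}"
  shows "wperm (gen i) q \<sigma> \<in> S.H"
  unfolding S.H_iff
proof (intro conjI allI impI)
  show "wperm (gen i) q \<sigma> \<in> mp_auts \<Omega>" by (rule wperm_mp[OF gen_sets assms])
  fix \<epsilon> :: real assume \<epsilon>: "\<epsilon> > 0"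
  obtain N where N: "\<And>n. n \<ge> N \<Longrightarrow> measure \<nu> (gen (fst (prod_decode n)) - base n) < \<epsilon> / 2"
    using base_exhausts[of "\<epsilon> / 2"] \<epsilon> by auto
  have "(\<lambda>n. (1/4::real) ^ n) \<longlonglongrightarrow> 0" by (rule LIMSEQ_power_zero) simp
  then have "\<forall>\<^sub>F n in sequentially. (1/4::real) ^ n < \<epsilon> / 8"
    using \<epsilon> by (intro order_tendstoD(2)) auto
  then obtain M where M: "\<And>n. n \<ge> M \<Longrightarrow> (1/4::real) ^ n < \<epsilon> / 8"
    by (auto simp: eventually_sequentially)
  \<comment> \<open>The first component makes level \<open>n\<close> use generator \<open>i\<close>;
    as the code is at least its second component, all four lower bounds hold at once.\<close>
  define n where "n = prod_encode (i, m + N + M + q)"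
  have n: "n \<ge> m + N + M + q" unfolding n_def by (rule le_prod_encode_2)
  have i: "fst (prod_decode n) = i" by (simp add: n_def)
  have pn: "p n \<ge> M" "p n \<ge> q" using n p_ge[of n] by linarith+
  have "wperm (base n) q \<sigma> \<in> S.near (4 / 4 ^ p n)"
    using word_perm_near[of n "lift q (p n) \<sigma>"] n lift_permutes[OF pn(2) assms]
    by (simp add: wperm_lift[OF pn(2) assms])
  then have "wperm (gen i) q \<sigma> \<in> S.near (4 / 4 ^ p n + \<epsilon> / 2)"
  proof (rule S.near_shift)
    show "wperm (gen i) q \<sigma> \<in> mp_auts \<Omega>" by (rule wperm_mp[OF gen_sets assms])
    have "P.d (wperm (gen i) q \<sigma>) (wperm (base n) q \<sigma>) \<le> measure \<nu> (gen i - base n)"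
      by (rule d_wperm_subset[OF gen_sets base_sets]) (auto simp: base_def i)
    then show "P.d (wperm (gen i) q \<sigma>) (wperm (base n) q \<sigma>) \<le> \<epsilon> / 2"
      using N[of n] n i by simp
  qed
  moreover have "4 / 4 ^ p n \<le> \<epsilon> / 2"
    using M[OF pn(1)] by (simp add: power_one_over field_simps)
  ultimately show "wperm (gen i) q \<sigma> \<in> S.near \<epsilon>"
    by (elim S.near_mono) simp
qed

end

section \<open>Partial flips over arbitrary Borel sets: a Dynkin class argument\<close>

context fibred
begin

lemma sets_X_generator:
  "sets \<Omega> = sigma_sets (space \<Omega>) {gen i \<times> {x. val q x \<in> K} | i q K. q \<ge> q0}"
proof -
  let ?V = "{{x. val q x \<in> K} | q K. q \<ge> q0}"
  have U: "UNIV \<in> ?V" by (intro CollectI exI[of _ q0] exI[of _ UNIV]) auto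
  have "sets (\<nu> \<Otimes>\<^sub>M cantor_measure) =
      sets (sigma (space \<nu> \<times> space cantor_measure) {a \<times> b |a b. a \<in> range gen \<and> b \<in> ?V})"
  proof (rule sets_pair_eq)
    show "range gen \<subseteq> Pow (space \<nu>)" using sets.sets_into_space[OF gen_sets] by auto
    show "sets \<nu> = sigma_sets (space \<nu>) (range gen)" by (rule gen_sigma)
    show "countable {space \<nu>}" "{space \<nu>} \<subseteq> range gen" "\<Union>{space \<nu>} = space \<nu>"
      using gen_space by auto
    show "?V \<subseteq> Pow (space cantor_measure)" by auto
    show "sets cantor_measure = sigma_sets (space cantor_measure) ?V"
      using sets_cantor_val[of q0] by simp
    show "countable {UNIV :: (nat \<Rightarrow> bool) set}" "{UNIV} \<subseteq> ?V" "\<Union>{UNIV} = space cantor_measure"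
      using U by auto
  qed
  also have "{a \<times> b |a b. a \<in> range gen \<and> b \<in> ?V} = {gen i \<times> {x. val q x \<in> K} | i q K. q \<ge> q0}"
    by blast
  also have "sets (sigma (space \<nu> \<times> space cantor_measure) \<dots>) = sigma_sets (space \<nu> \<times> space cantor_measure) \<dots>"
    using sets.sets_into_space[OF gen_sets] by (intro sets_measure_of) auto
  finally show ?thesis by (simp add: X_space_def space_pair_measure)
qed

lemma generator_Int_stable: "Int_stable {gen i \<times> {x. val q x \<in> K} | i q K. q \<ge> q0}"
proof (rule Int_stableI)
  fix a b
  assume "a \<in> {gen i \<times> {x. val q x \<in> K} | i q K. q \<ge> q0}" "b \<in> {gen i \<times> {x. val q x \<in> K} | i q K. q \<ge> q0}"
  then obtain i q K i' q' K' where a: "a = gen i \<times> {x. val q x \<in> K}" "q \<ge> q0"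
    and b: "b = gen i' \<times> {x. val q' x \<in> K'}" "q' \<ge> q0" by blast
  obtain j where j: "gen i \<inter> gen i' = gen j"
    using gen_Int unfolding Int_stable_def by blast
  let ?r = "max q q'"
  have eq: "a \<inter> b = gen j \<times> {x. val ?r x \<in> {n. take_bit q n \<in> K \<and> take_bit q' n \<in> K'}}"
    unfolding a b by (auto simp: val_take_bit j[symmetric])
  show "a \<inter> b \<in> {gen i \<times> {x. val q x \<in> K} | i q K. q \<ge> q0}"
  proof (rule CollectI, intro exI conjI)
    show "a \<inter> b = gen j \<times> {x. val ?r x \<in> {n. take_bit q n \<in> K \<and> take_bit q' n \<in> K'}}"
      by (rule eq)
    show "q0 \<le> ?r" using a(2) by simp
  qed
qed

text \<open>When the word contains all set bits of \<open>c\<close>, both the flip and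
  \<open>proj\<close> depend on the first \<open>q\<close> letters only: the flip is XOR with
  \<open>c\<close> on codes, applied exactly when the representative of the code lies in
  \<open>K\<close>.\<close>

lemma swap_on_word:
  assumes c: "bit c b" "c < 2 ^ q"
  shows "\<exists>\<sigma>. \<sigma> permutes {..<2 ^ q} \<and> swap_on c b (A \<times> {x. val q x \<in> K}) = wperm A q \<sigma>"
proof -
  let ?f = "\<lambda>n. n XOR c"
  define pr where "pr = (\<lambda>n. if bit n b then ?f n else n)"
  define \<sigma> where "\<sigma> = (\<lambda>n. if n < 2 ^ q \<and> pr n \<in> K then ?f n else n)"
  have ff: "?f (?f n) = n" for n
    by (rule bit_eqI) (auto simp: bit_xor_iff)
  have b_f: "bit (?f n) b \<longleftrightarrow> \<not> bit n b" for n
    using c(1) by (simp add: bit_xor_iff)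
  have lt: "?f n < 2 ^ q \<longleftrightarrow> n < 2 ^ q" for n
  proof -
    have "?f n < 2 ^ q" if "n < 2 ^ q" for n
      using that c(2) by (metis take_bit_nat_eq_self_iff take_bit_xor)
    then show ?thesis using ff by metis
  qed
  have pr_f: "pr (?f n) = pr n" for n by (simp add: pr_def b_f ff)
  have \<sigma>\<sigma>: "\<sigma> (\<sigma> n) = n" for n
    by (cases "n < 2 ^ q \<and> pr n \<in> K") (simp_all only: \<sigma>_def pr_f lt ff if_True if_False simp_thms)
  have "\<sigma> permutes {..<2 ^ q}"
    unfolding permutes_def using \<sigma>\<sigma> by (metis \<sigma>_def lessThan_iff)
  moreover have "swap_on c b (A \<times> {x. val q x \<in> K}) = wperm A q \<sigma>"
  proof
    fix z
    have bq: "b < q" using bit_less_exp[OF c(2,1)] .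
    have pz: "fst (proj c b z) = fst z" "val q (snd (proj c b z)) = pr (val q (snd z))"
      using bq c(2) by (auto simp: proj_def flpX_def pr_def val_flp bit_val)
    have "act q \<sigma> (snd z) = (if pr (val q (snd z)) \<in> K then flp c (snd z) else snd z)"
    proof (rule act_eqI[symmetric])
      show "\<sigma> n < 2 ^ q" if "n < 2 ^ q" for n using that by (simp add: \<sigma>_def lt)
      show "val q (if pr (val q (snd z)) \<in> K then flp c (snd z) else snd z) = \<sigma> (val q (snd z))"
        using c(2) by (simp add: \<sigma>_def val_flp)
      show "(if pr (val q (snd z)) \<in> K then flp c (snd z) else snd z) i = snd z i" if "q \<le> i" for i
        using that bit_less_exp[OF c(2), of i] by (auto simp: flp_def)
    qed
    then show "swap_on c b (A \<times> {x. val q x \<in> K}) z = wperm A q \<sigma> z"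
      by (auto simp: swap_on_def wperm_def pz mem_Times_iff flpX_def)
  qed
  ultimately show ?thesis by blast
qed

lemma swap_on_mult_disjoint:
  assumes c: "bit c b" and DE: "D \<in> sets \<Omega>" "E \<in> sets \<Omega>" "D \<inter> E = {}"
  shows "swap_on c b D \<otimes>\<^bsub>P.G\<^esub> swap_on c b E = swap_on c b (D \<union> E)"
proof (rule mp_auts_eqI)
  fix z assume z: "z \<in> space \<Omega>"
  have s: "swap_on c b E z \<in> space \<Omega>" by (rule mp_auts_space[OF swap_on_mp[OF c DE(2)] z])
  then show "(swap_on c b D \<otimes>\<^bsub>P.G\<^esub> swap_on c b E) z = swap_on c b (D \<union> E) z"
    using z DE(3) by (auto simp: mp_mult_apply swap_on_mp[OF c] DE(1,2) swap_on_apply proj_flpX[OF c])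
qed (use DE in \<open>auto intro!: swap_on_mp[OF c]\<close>)

lemma swap_on_empty: "swap_on c b {} = \<one>\<^bsub>P.G\<^esub>"
proof (rule mp_auts_eqI)
  show "swap_on c b {} \<in> mp_auts \<Omega>"
    unfolding swap_on_def by (rule mp_autsI[where S' = "\<lambda>z. z"]) auto
qed (auto simp: swap_on_apply mp_one_apply)

lemma swap_on_involution:
  assumes c: "bit c b" and D: "D \<in> sets \<Omega>"
  shows "swap_on c b D \<otimes>\<^bsub>P.G\<^esub> swap_on c b D = \<one>\<^bsub>P.G\<^esub>"
proof (rule mp_auts_eqI)
  fix z assume z: "z \<in> space \<Omega>"
  have s: "swap_on c b D z \<in> space \<Omega>" by (rule mp_auts_space[OF swap_on_mp[OF c D] z])
  then show "(swap_on c b D \<otimes>\<^bsub>P.G\<^esub> swap_on c b D) z = \<one>\<^bsub>P.G\<^esub> z"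
    using z by (auto simp: mp_mult_apply mp_one_apply swap_on_mp[OF c] D swap_on_apply proj_flpX[OF c])
qed (use D in \<open>auto intro!: swap_on_mp[OF c]\<close>)

end

context generating
begin

text \<open>Sets \<open>D\<close> whose partial flip is in the closure form a Dynkin class: the flip
  over a complement is a product of two involutions already available, and a countable disjoint
  union is a limit of finite products. On the intersection-stable rectangles
  \<open>gen_perm_H\<close> applies, and q >= c guarantees that the word contains all set bits of
  \<open>c\<close>.\<close>

lemma swap_on_H:
  assumes c: "bit c b" and D: "D \<in> sets \<Omega>"
  shows "swap_on c b D \<in> S.H"
proof -
  let ?G = "{gen i \<times> {x. val q x \<in> K} | i q K. q \<ge> c}"
  have gen_H: "swap_on c b A \<in> S.H" if A: "A \<in> ?G" for A
  proof -
    obtain i q K where iqK: "A = gen i \<times> {x. val q x \<in> K}" "q \<ge> c" using A by blast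
    have "c < 2 ^ q" using iqK(2) less_exp[of q] by linarith
    then obtain \<sigma> where "\<sigma> permutes {..<2 ^ q}" "swap_on c b A = wperm (gen i) q \<sigma>"
      using swap_on_word[OF c, of q "gen i" K] iqK(1) by auto
    then show ?thesis using gen_perm_H by simp
  qed
  have G_sub: "?G \<subseteq> Pow (space \<Omega>)"
    using sets.sets_into_space[OF gen_sets] by (auto simp: space_X)
  have "space \<Omega> \<in> ?G"
  proof -
    obtain i where i: "space \<nu> = gen i" using gen_space by auto
    show ?thesis
      by (intro CollectI exI[of _ i] exI[of _ c] exI[of _ UNIV]) (auto simp: space_X i)
  qed
  then have all_H: "swap_on c b (space \<Omega>) \<in> S.H" by (rule gen_H)
  have "D \<in> sigma_sets (space \<Omega>) ?G" using D sets_X_generator[of c] by simp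
  with generator_Int_stable[of c] G_sub show ?thesis
  proof (induction rule: sigma_sets_induct_disjoint)
    case (basic A)
    then show ?case by (rule gen_H)
  next
    case empty
    show ?case unfolding swap_on_empty by (rule S.one_H)
  next
    case (compl A)
    then have A: "A \<in> sets \<Omega>" using sets_X_generator[of c] by simp
    then have "swap_on c b A \<otimes>\<^bsub>P.G\<^esub> swap_on c b (space \<Omega> - A) = swap_on c b (space \<Omega>)"
      using sets.sets_into_space[OF A] by (subst swap_on_mult_disjoint[OF c]) (auto simp: Un_absorb1)
    then have "swap_on c b A \<otimes>\<^bsub>P.G\<^esub> swap_on c b (space \<Omega>) =
        swap_on c b A \<otimes>\<^bsub>P.G\<^esub> swap_on c b A \<otimes>\<^bsub>P.G\<^esub> swap_on c b (space \<Omega> - A)"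
      using A by (simp add: P.Aut.m_assoc swap_on_mp[OF c])
    then have "swap_on c b (space \<Omega> - A) = swap_on c b A \<otimes>\<^bsub>P.G\<^esub> swap_on c b (space \<Omega>)"
      using A by (simp add: swap_on_involution[OF c] swap_on_mp[OF c])
    then show ?case using S.H_mult[OF compl(2) all_H] by simp
  next
    case (union A)
    then have A: "A n \<in> sets \<Omega>" for n using sets_X_generator[of c] by auto
    define W where "W n = (\<Union>i<n. A i)" for n
    have W: "W n \<in> sets \<Omega>" for n using A by (auto simp: W_def)
    have W_H: "swap_on c b (W n) \<in> S.H" for n
    proof (induction n)
      case 0
      then show ?case by (simp add: W_def swap_on_empty S.one_H)
    next
      case (Suc n)
      have "A n \<inter> A i = {}" if "i < n" for i
        using union(1) that by (simp add: disjoint_family_on_def)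
      then have "A n \<inter> W n = {}" unfolding W_def by blast
      then have "swap_on c b (A n) \<otimes>\<^bsub>P.G\<^esub> swap_on c b (W n) = swap_on c b (A n \<union> W n)"
        by (intro swap_on_mult_disjoint[OF c] A W)
      also have "A n \<union> W n = W (Suc n)" by (auto simp: W_def less_Suc_eq)
      finally show ?case using S.H_mult[OF union(3)[of n] Suc] by simp
    qed
    \<comment> \<open>The two maps agree unless \<open>proj\<close> hits the part of the union not
      yet covered; these sets decrease to the empty set.\<close>
    let ?R = "\<lambda>n. proj c b -` ((\<Union>i. A i) - W n) \<inter> space \<Omega>"
    have AW: "(\<Union>i. A i) - W n \<in> sets \<Omega>" for n using A W by auto
    have R: "?R n \<in> sets \<Omega>" for n by (rule measurable_sets[OF measurable_proj AW])
    have d_le: "P.d (swap_on c b (\<Union>i. A i)) (swap_on c b (W n)) \<le> measure \<Omega> (?R n)" for n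
      by (rule P.d_le[OF _ R]) (auto simp: swap_on_apply W_def split: if_splits)
    have "(\<lambda>n. measure \<Omega> (?R n)) \<longlonglongrightarrow> measure \<Omega> (\<Inter>n. ?R n)"
      by (rule P.finite_Lim_measure_decseq) (use R in \<open>auto simp: decseq_def W_def\<close>)
    moreover have "(\<Inter>n. ?R n) = {}" by (auto simp: W_def)
    ultimately have lim: "(\<lambda>n. measure \<Omega> (?R n)) \<longlonglongrightarrow> 0" by simp
    have "(\<lambda>n. P.d (swap_on c b (\<Union>i. A i)) (swap_on c b (W n))) \<longlonglongrightarrow> 0"
      by (rule tendsto_sandwich[OF _ _ tendsto_const lim]) (use d_le in \<open>auto simp: unif_dist_def\<close>)
    then show ?case
      using A by (intro S.H_limit[OF swap_on_mp[OF c] W_H]) auto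
  qed
qed

end

context generating
begin

text \<open>Given \<open>S\<close> in the full group, multiply it successively by involutions \<open>swap_on c b D\<close>, where \<open>D\<close>
  is the set of points that the current product displaces by \<open>flpX c\<close> together with its image.
  Each step fixes all these points and unfixes none. The sets \<open>D\<close> have summable measures, so by
  Borel-Cantelli almost every orbit is eventually constant, and it can only stabilize at a fixed point
  because every \<open>c\<close> recurs.\<close>

lemma full_group_H:
  assumes S: "S \<in> full_group \<Omega> (R0Y \<nu>)"
  shows "S \<in> S.H"
proof -
  have S_mp: "S \<in> mp_auts \<Omega>" by (rule full_group_mp[OF S])
  define cc where "cc k = fst (prod_decode k)" for k
  define D where "D k R = {z \<in> space \<Omega>. cc k \<noteq> 0 \<and> R z = flpX (cc k) z}" for k R
  define D' where "D' k R = D k R \<union> (flpX (cc k) -` D k R \<inter> space \<Omega>)" for k R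
  \<comment> \<open>The flip \<open>0\<close> has no set bit from which a fundamental domain could
    be chosen, and there is nothing to undo, so that stage is idle.\<close>
  define J where "J k R = (if cc k = 0 then \<one>\<^bsub>P.G\<^esub> else swap_on (cc k) (SOME b. bit (cc k) b) (D' k R))" for k R
  define R where "R = rec_nat S (\<lambda>k R. J k R \<otimes>\<^bsub>P.G\<^esub> R)"
  define h where "h = rec_nat \<one>\<^bsub>P.G\<^esub> (\<lambda>k h. J k (R k) \<otimes>\<^bsub>P.G\<^esub> h)"
  have R_0: "R 0 = S" and R_Suc: "R (Suc k) = J k (R k) \<otimes>\<^bsub>P.G\<^esub> R k" for k
    by (simp_all add: R_def)
  have h_0: "h 0 = \<one>\<^bsub>P.G\<^esub>" and h_Suc: "h (Suc k) = J k (R k) \<otimes>\<^bsub>P.G\<^esub> h k" for k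
    by (simp_all add: h_def)
  have D_sets: "D k Q \<in> sets \<Omega>" if "Q \<in> mp_auts \<Omega>" for k Q
    using P.eq_sets[OF mp_auts_meas[OF that] measurable_flpX[of "cc k"]]
    by (cases "cc k = 0") (simp_all add: D_def)
  have D'_sets: "D' k Q \<in> sets \<Omega>" if "Q \<in> mp_auts \<Omega>" for k Q
    using D_sets[OF that] measurable_sets[OF measurable_flpX D_sets[OF that]] by (simp add: D'_def)
  have bit_cc: "bit (cc k) (SOME b. bit (cc k) b)" if "cc k \<noteq> 0" for k
  proof -
    have "\<exists>b. bit (cc k) b" using that by (auto simp: bit_eq_iff)
    then show ?thesis by (rule someI_ex)
  qed
  have J_H: "J k Q \<in> S.H" if "Q \<in> mp_auts \<Omega>" for k Q
    using swap_on_H[OF bit_cc D'_sets[OF that]] S.one_H by (auto simp: J_def)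
  have J_apply: "J k Q w = (if w \<in> D' k Q then flpX (cc k) w else w)" if w: "w \<in> space \<Omega>" for k Q w
  proof (cases "cc k = 0")
    case True
    then show ?thesis using w by (simp add: J_def D'_def D_def mp_one_apply)
  next
    case False
    \<comment> \<open>\<open>D'\<close> is invariant under the flip, so the involution does not
      depend on which set bit was chosen for the fundamental domain.\<close>
    have "proj (cc k) b w \<in> D' k Q \<longleftrightarrow> w \<in> D' k Q" for b
      using w by (auto simp: proj_def D'_def)
    then show ?thesis using False w by (simp add: J_def swap_on_apply)
  qed
  have R_mp: "R k \<in> mp_auts \<Omega>" for k
    by (induction k) (auto simp: R_0 R_Suc S_mp intro: P.mult_mp S.H_mp[OF J_H])
  have J_mp: "J k (R k) \<in> mp_auts \<Omega>" for k by (rule S.H_mp[OF J_H[OF R_mp]])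
  have h_H: "h k \<in> S.H" for k
    by (induction k) (auto simp: h_0 h_Suc intro: S.one_H S.H_mult J_H R_mp)
  have h_mp: "h k \<in> mp_auts \<Omega>" for k by (rule S.H_mp[OF h_H])
  have R_h: "R k = h k \<otimes>\<^bsub>P.G\<^esub> S" for k
  proof (induction k)
    case (Suc k)
    have "J k (R k) \<otimes>\<^bsub>P.G\<^esub> R k = J k (R k) \<otimes>\<^bsub>P.G\<^esub> (h k \<otimes>\<^bsub>P.G\<^esub> S)"
      using Suc by (rule arg_cong)
    also have "\<dots> = J k (R k) \<otimes>\<^bsub>P.G\<^esub> h k \<otimes>\<^bsub>P.G\<^esub> S"
      by (simp add: P.Aut.m_assoc J_mp h_mp S_mp)
    finally show ?case by (simp only: R_Suc h_Suc)
  qed (simp add: R_0 h_0 S_mp)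
  have R_sp: "R k z \<in> space \<Omega>" if "z \<in> space \<Omega>" for k z
    by (rule mp_auts_space[OF R_mp that])
  have R_Suc_apply: "R (Suc k) z = (if R k z \<in> D' k (R k) then flpX (cc k) (R k z) else R k z)"
    if "z \<in> space \<Omega>" for k z
    using that by (simp add: R_Suc mp_mult_apply J_mp R_mp R_sp J_apply)

  define F where "F k = {z \<in> space \<Omega>. R k z = z}" for k
  have F_sets: "F k \<in> sets \<Omega>" for k
    unfolding F_def by (rule P.eq_sets) (use R_mp mp_auts_meas in auto)
  have D_F: "D k (R k) \<subseteq> F (Suc k)" for k
  proof
    fix z assume z: "z \<in> D k (R k)"
    then have zs: "z \<in> space \<Omega>" "R k z = flpX (cc k) z" by (auto simp: D_def)
    then have "R k z \<in> D' k (R k)" using z by (auto simp: D'_def)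
    then show "z \<in> F (Suc k)" using zs by (simp add: F_def R_Suc_apply)
  qed
  have D_F_disj: "D k (R k) \<inter> F k = {}" for k
  proof -
    have "flpX (cc k) z \<noteq> z" if "cc k \<noteq> 0" for z
      using that flpX_inject[of "cc k" z 0] by (simp add: flpX_def)
    then show ?thesis by (auto simp: D_def F_def)
  qed
  have F_mono: "F k \<subseteq> F (Suc k)" for k
  proof
    fix z assume z: "z \<in> F k"
    then have zs: "z \<in> space \<Omega>" "R k z = z" by (auto simp: F_def)
    \<comment> \<open>Otherwise the flipped point would be sent to \<open>z\<close> by
      \<open>R k\<close>, which already sends \<open>z\<close> to itself, contradicting
      injectivity.\<close>
    have "z \<notin> D' k (R k)"
    proof
      assume "z \<in> D' k (R k)"
      moreover have "z \<notin> D k (R k)" using z D_F_disj by auto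
      ultimately have d: "flpX (cc k) z \<in> D k (R k)" by (auto simp: D'_def)
      then have "R k (flpX (cc k) z) = z" by (auto simp: D_def)
      then have "R k (flpX (cc k) z) = R k z" using zs by simp
      then have "flpX (cc k) z = z" by (subst (asm) mp_auts_inj[OF R_mp]) (use zs in simp_all)
      then show False using d \<open>z \<notin> D k (R k)\<close> by simp
    qed
    then show "z \<in> F (Suc k)" using zs by (simp add: F_def R_Suc_apply)
  qed
  \<comment> \<open>The points of \<open>D\<close> are newly fixed at this stage, so their measure
    is at most the growth of the fixed-point sets; the sum telescopes and is bounded by 1.\<close>
  have mD: "measure \<Omega> (D k (R k)) \<le> measure \<Omega> (F (Suc k)) - measure \<Omega> (F k)" for k
  proof -
    have "measure \<Omega> (D k (R k)) + measure \<Omega> (F k) = measure \<Omega> (D k (R k) \<union> F k)"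
      by (rule P.finite_measure_Union[symmetric, OF D_sets[OF R_mp] F_sets D_F_disj])
    also have "\<dots> \<le> measure \<Omega> (F (Suc k))"
      using D_F F_mono by (intro P.finite_measure_mono F_sets) auto
    finally show ?thesis by simp
  qed
  have "summable (\<lambda>k. measure \<Omega> (D k (R k)))"
  proof (rule summableI_nonneg_bounded[where x = 1])
    fix n
    have "(\<Sum>k<n. measure \<Omega> (D k (R k))) \<le> (\<Sum>k<n. measure \<Omega> (F (Suc k)) - measure \<Omega> (F k))"
      by (intro sum_mono mD)
    also have "\<dots> = measure \<Omega> (F n) - measure \<Omega> (F 0)" by (rule sum_lessThan_telescope)
    also have "\<dots> \<le> 1" using P.prob_le_1[of "F n"] measure_nonneg[of \<Omega> "F 0"] by linarith
    finally show "(\<Sum>k<n. measure \<Omega> (D k (R k))) \<le> 1" .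
  qed simp
  then have sum2: "summable (\<lambda>k. 2 * measure \<Omega> (D k (R k)))" by (rule summable_mult)
  \<comment> \<open>\<open>A k\<close> consists of the points whose current image is in the domain
    moved at stage \<open>k\<close>. A point in only finitely many of these sets has an eventually
    constant sequence \<open>R k z\<close>.\<close>
  define A where "A k = R k -` D' k (R k) \<inter> space \<Omega>" for k
  have A_sets: "A k \<in> sets \<Omega>" for k
    unfolding A_def by (intro measurable_sets[OF mp_auts_meas] R_mp D'_sets)
  have mA: "measure \<Omega> (A k) \<le> 2 * measure \<Omega> (D k (R k))" for k
  proof -
    let ?D = "D k (R k)"
    have "measure \<Omega> (A k) = measure \<Omega> (D' k (R k))"
      unfolding A_def by (intro mp_auts_measure_vimage R_mp D'_sets)
    also have "\<dots> \<le> measure \<Omega> ?D + measure \<Omega> (flpX (cc k) -` ?D \<inter> space \<Omega>)"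
      unfolding D'_def by (intro measure_Un_le D_sets R_mp measurable_sets[OF measurable_flpX])
    also have "\<dots> = 2 * measure \<Omega> ?D"
      using flpX_measure[OF D_sets[OF R_mp], of "cc k" k k] by (simp add: measure_def)
    finally show ?thesis .
  qed
  have "AE z in \<Omega>. \<forall>\<^sub>F k in sequentially. z \<in> space \<Omega> - A k"
  proof (rule borel_cantelli_AE1[OF A_sets])
    show "summable (\<lambda>k. measure \<Omega> (A k))"
      by (rule summable_comparison_test'[OF sum2, of 0]) (use mA in auto)
  qed (simp add: P.emeasure_eq_measure)
  moreover have "AE z in \<Omega>. (S z, z) \<in> R0Y \<nu>" using S by (simp add: full_group_def)
  ultimately have AE_F: "AE z in \<Omega>. z \<in> (\<Union>k. F k)"
    using AE_space
  proof eventually_elim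
    case (elim z)
    then obtain K where K: "\<And>k. k \<ge> K \<Longrightarrow> z \<notin> A k" by (auto simp: eventually_sequentially)
    have const: "R k z = R K z" if "k \<ge> K" for k
      using that
    proof (induction rule: dec_induct)
      case (step k)
      then show ?case using K[of k] elim(3) by (simp add: R_Suc_apply A_def)
    qed simp
    have rel: "\<exists>c. R k z = flpX c z" for k
    proof (induction k)
      case 0
      then show ?case using elim(2) by (simp add: R_0 R0Y_iff)
    next
      case (Suc k)
      then obtain c where c: "R k z = flpX c z" ..
      have fs: "fst z \<in> space \<nu>" using elim(3) by (auto simp: space_X)
      have "(R (Suc k) z, R k z) \<in> R0Y \<nu>"
        using fs c elim(3) by (auto simp: R0Y_iff R_Suc_apply flpX_def intro: exI[of _ 0])
      moreover have "(R k z, z) \<in> R0Y \<nu>" using fs c by (auto simp: R0Y_iff)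
      ultimately have "(R (Suc k) z, z) \<in> R0Y \<nu>" by (rule R0Y_trans[rotated])
      then show ?case by (simp add: R0Y_iff)
    qed
    then obtain c where c: "R K z = flpX c z" by blast
    \<comment> \<open>A stage devoted to the limiting flip \<open>c\<close> and not earlier than the
      stabilization time \<open>K\<close>; if \<open>c\<close> is not 0, it puts \<open>z\<close>
      into \<open>D\<close> and so makes it a fixed point.\<close>
    define k where "k = prod_encode (c, K)"
    have k: "k \<ge> K" "cc k = c" by (auto simp: k_def cc_def le_prod_encode_2)
    have Rk: "R k z = flpX c z" using const[OF k(1)] c by simp
    show ?case
    proof (cases "c = 0")
      case True
      then have "z \<in> F k" using Rk elim(3) by (simp add: F_def flpX_def)
      then show ?thesis by blast
    next
      case False
      then have "z \<in> D k (R k)" using Rk k(2) elim(3) by (simp add: D_def)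
      then show ?thesis using D_F by blast
    qed
  qed
  have "(\<lambda>k. measure \<Omega> (F k)) \<longlonglongrightarrow> measure \<Omega> (\<Union>k. F k)"
    by (rule P.finite_Lim_measure_incseq) (use F_sets F_mono in \<open>auto intro!: incseq_SucI\<close>)
  moreover have "measure \<Omega> (\<Union>k. F k) = 1"
    using AE_F F_sets by (subst P.prob_eq_1) auto
  ultimately have "(\<lambda>k. 1 - measure \<Omega> (F k)) \<longlonglongrightarrow> 1 - 1"
    by (intro tendsto_diff tendsto_const) simp
  then have "(\<lambda>k. 1 - measure \<Omega> (F k)) \<longlonglongrightarrow> 0"
    by simp
  \<comment> \<open>\<open>h k\<close> undoes \<open>S\<close> on \<open>F k\<close>; left
    invariance turns this into closeness of \<open>S\<close> to the inverse of
    \<open>h k\<close>.\<close>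
  moreover have "P.d S (inv\<^bsub>P.G\<^esub> (h k)) = 1 - measure \<Omega> (F k)" for k
  proof -
    have "P.d S (inv\<^bsub>P.G\<^esub> (h k)) = P.d (h k \<otimes>\<^bsub>P.G\<^esub> S) (h k \<otimes>\<^bsub>P.G\<^esub> inv\<^bsub>P.G\<^esub> (h k))"
      by (rule P.d_left[symmetric]) (use S_mp h_mp in auto)
    also have "\<dots> = P.d (R k) \<one>\<^bsub>P.G\<^esub>" using h_mp by (simp add: R_h)
    also have "\<dots> = measure \<Omega> (space \<Omega> - F k)"
      unfolding unif_dist_def by (rule arg_cong[where f = "measure \<Omega>"]) (auto simp: F_def mp_one_apply)
    also have "\<dots> = 1 - measure \<Omega> (F k)" by (rule P.prob_compl[OF F_sets])
    finally show ?thesis .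
  qed
  ultimately show ?thesis
    by (intro S.H_limit[OF S_mp, of "\<lambda>k. inv\<^bsub>P.G\<^esub> (h k)"]) (auto intro: S.H_inv h_H)
qed

end

section \<open>Odd cycles\<close>

context mp_space
begin

lemma int_pow_fixed:
  assumes S: "S \<in> mp_auts M" "x \<in> space M" "S x = x"
  shows "(S [^]\<^bsub>G\<^esub> (k::int)) x = x"
proof -
  have *: "(R [^]\<^bsub>G\<^esub> (n::nat)) x = x" if R: "R \<in> mp_auts M" "R x = x" for R n
    by (induction n) (use R S(2) in \<open>auto simp: mp_one_apply mp_mult_apply\<close>)
  have "(inv\<^bsub>G\<^esub> S) x = x" using inv_apply[OF S(1,2)] S(3) by simp
  then show ?thesis
    using *[OF S(1,3)] *[of "inv\<^bsub>G\<^esub> S"] S(1)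
    by (cases k rule: int_cases2) (auto simp: int_pow_int Aut.int_pow_neg Aut.nat_pow_inv)
qed

lemma pow_fixed:
  assumes S: "S \<in> mp_auts M" "x \<in> space M" "(S [^]\<^bsub>G\<^esub> (n::nat)) x = x"
  shows "(S [^]\<^bsub>G\<^esub> (n * t)) x = x"
  using int_pow_fixed[of "S [^]\<^bsub>G\<^esub> n" x "int t"] S by (simp add: int_pow_int Aut.nat_pow_pow)

text \<open>Finiteness forces two exponents to collide, which gives a period. The least positive
  period \<open>n\<close> is the size of the orbit, because the exponents 0, ..., n - 1 list the
  orbit without repetition.\<close>

lemma odd_orbit_period:
  assumes C: "C \<in> mp_auts M" and x: "x \<in> space M"
    and fin: "finite (orbit_of M C x)" and odd: "odd (card (orbit_of M C x))"
  shows "\<exists>n. odd n \<and> (C [^]\<^bsub>G\<^esub> (n::nat)) x = x"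
proof -
  define f where "f i = (C [^]\<^bsub>G\<^esub> (i::int)) x" for i
  have orb: "orbit_of M C x = range f" by (simp add: orbit_of_def f_def)
  have pow: "C [^]\<^bsub>G\<^esub> (i::int) \<in> mp_auts M" for i
    using Aut.int_pow_closed[of C i] C by simp
  have f_add: "f (i + j) = (C [^]\<^bsub>G\<^esub> i) (f j)" for i j
    using C x pow by (simp add: f_def Aut.int_pow_mult mp_mult_apply)
  have f_sp: "f i \<in> space M" for i unfolding f_def by (rule mp_auts_space[OF pow x])
  have f0: "f 0 = x" using x by (simp add: f_def mp_one_apply)
  have f_diff: "f (j - i) = x" if "f i = f j" for i j
  proof -
    have "(C [^]\<^bsub>G\<^esub> i) (f (j - i)) = (C [^]\<^bsub>G\<^esub> i) (f 0)"
      using that by (simp flip: f_add)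
    then have "f (j - i) = f 0"
      by (subst (asm) mp_auts_inj[OF pow]) (simp_all add: f_sp)
    then show ?thesis by (simp add: f0)
  qed
  have "\<not> inj f" using fin orb finite_imageD[of f UNIV] infinite_UNIV_int by auto
  then obtain i j where ij: "f i = f j" "i \<noteq> j" by (auto simp: inj_def)
  define k where "k = nat \<bar>j - i\<bar>"
  have k: "k > 0" "f (int k) = x"
    using ij f_diff[of i j] f_diff[of j i] by (auto simp: k_def abs_if)
  define n where "n = (LEAST n. n > 0 \<and> f (int n) = x)"
  have n: "n > 0" "f (int n) = x"
    using LeastI[of "\<lambda>n. n > 0 \<and> f (int n) = x" k] k by (auto simp: n_def)
  have least: "f (int l) \<noteq> x" if "0 < l" "l < n" for l
    using not_less_Least[of l "\<lambda>n. n > 0 \<and> f (int n) = x"] that by (auto simp: n_def)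
  have f_mult: "f (int n * q) = x" for q
    using int_pow_fixed[OF pow x, of "int n" q] n(2) C by (simp add: f_def Aut.int_pow_pow)
  have "range f = f ` {0..<int n}"
  proof (intro equalityI subsetI)
    fix y assume "y \<in> range f"
    then obtain i where i: "y = f i" by auto
    have "f i = f (i mod int n + int n * (i div int n))" by simp
    also have "\<dots> = f (i mod int n)"
      unfolding f_add f_mult by (simp add: f_def)
    finally show "y \<in> f ` {0..<int n}" using i n(1) by auto
  qed auto
  moreover have "inj_on f {0..<int n}"
  proof -
    have "\<not> i < j" if "i \<in> {0..<int n}" "j \<in> {0..<int n}" "f i = f j" for i j
    proof
      assume "i < j"
      then have "0 < nat (j - i)" "nat (j - i) < n" "int (nat (j - i)) = j - i"
        using that(1,2) by auto
      then show False using least[of "nat (j - i)"] f_diff[OF that(3)] by simp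
    qed
    then show ?thesis by (metis inj_onI linorder_neqE)
  qed
  ultimately have "card (range f) = n" by (simp add: card_image)
  then have "odd n" using odd orb by simp
  moreover have "(C [^]\<^bsub>G\<^esub> n) x = x" using n(2) by (simp add: f_def int_pow_int)
  ultimately show ?thesis by blast
qed

text \<open>\<open>L N\<close> is the product of the first \<open>N\<close> odd numbers: it is odd,
  and every odd period eventually divides it, so the points it does not fix decrease to a null set.
  The free factor \<open>t\<close> lets the exponent be adjusted later modulo a power of 2.\<close>

lemma odd_cycle_power_near_one:
  assumes C: "odd_cycle M C" and \<epsilon>: "\<epsilon> > 0"
  shows "\<exists>l::nat. odd l \<and> (\<forall>t::nat. d (C [^]\<^bsub>G\<^esub> (l * t)) \<one>\<^bsub>G\<^esub> < \<epsilon>)"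
proof -
  have C_mp: "C \<in> mp_auts M" using C by (simp add: odd_cycle_def is_cycle_def)
  define L where "L N = (\<Prod>j<N. 2 * j + 1 :: nat)" for N
  have L_Suc: "L (Suc N) = L N * (2 * N + 1)" for N
    by (simp only: L_def prod.lessThan_Suc)
  define A where "A N = {x \<in> space M. (C [^]\<^bsub>G\<^esub> L N) x \<noteq> x}" for N
  have A_sets: "A N \<in> sets M" for N
    unfolding A_def by (rule neq_sets) (use C_mp in \<open>auto intro: mp_auts_meas\<close>)
  have A_dec: "A (Suc N) \<subseteq> A N" for N
    unfolding A_def L_Suc using pow_fixed[OF C_mp] by blast
  have "(\<lambda>N. measure M (A N)) \<longlonglongrightarrow> measure M (\<Inter>N. A N)"
    by (rule finite_Lim_measure_decseq) (use A_sets A_dec in \<open>auto intro!: decseq_SucI\<close>)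
  moreover have "measure M (\<Inter>N. A N) = 0"
  proof -
    have "AE x in M. finite (orbit_of M C x)" "AE x in M. odd (card (orbit_of M C x))"
      using C by (auto simp: odd_cycle_def is_cycle_def)
    then have "AE x in M. x \<notin> (\<Inter>N. A N)"
      using AE_space
    proof eventually_elim
      case (elim x)
      then obtain n where n: "odd n" "(C [^]\<^bsub>G\<^esub> (n::nat)) x = x"
        using odd_orbit_period[OF C_mp] by blast
      then obtain j where j: "n = 2 * j + 1" by (auto elim: oddE)
      have "n dvd L (Suc j)" by (simp only: L_Suc j dvd_triv_right)
      then obtain t where "L (Suc j) = n * t" by blast
      then have "x \<notin> A (Suc j)"
        using pow_fixed[OF C_mp elim(3) n(2), of t] elim(3) by (simp add: A_def mp_one_apply)
      then show ?case by blast
    qed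
    moreover have "(\<Inter>N. A N) \<in> sets M" by (intro sets.countable_INT') (use A_sets in auto)
    ultimately have "(\<Inter>N. A N) \<in> null_sets M" by (subst AE_iff_null_sets)
    then show ?thesis by (rule measure_eq_0_null_sets)
  qed
  ultimately have "\<forall>\<^sub>F N in sequentially. measure M (A N) < \<epsilon>"
    using \<epsilon> by (intro order_tendstoD(2)) auto
  then obtain N where N: "measure M (A N) < \<epsilon>" by (auto simp: eventually_sequentially)
  have "odd (L N)" unfolding L_def by (induction N) auto
  moreover have "d (C [^]\<^bsub>G\<^esub> (L N * t)) \<one>\<^bsub>G\<^esub> < \<epsilon>" for t
  proof -
    have "d (C [^]\<^bsub>G\<^esub> (L N * t)) \<one>\<^bsub>G\<^esub> \<le> measure M (A N)"
      using pow_fixed[OF C_mp] A_sets by (intro d_le) (auto simp: A_def mp_one_apply)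
    then show ?thesis using N by simp
  qed
  ultimately show ?thesis by blast
qed

lemma d_0_trans:
  assumes "d a b = 0" "d b c = 0" "a \<in> mp_auts M" "b \<in> mp_auts M" "c \<in> mp_auts M"
  shows "d a c = 0"
  using d_triangle[of a b c] assms by (simp add: unif_dist_def measure_le_0_iff)

text \<open>By injectivity the image of a moved point is moved by the same map, so almost surely the
  other map fixes it as well as the point. The supports may meet in a null set, hence distance 0 in
  place of equality.\<close>

lemma ae_disjoint_commute:
  assumes C: "C \<in> mp_auts M" and V: "V \<in> mp_auts M"
    and disj: "ae_disjoint M (supp M C) (supp M V)"
  shows "d (V \<otimes>\<^bsub>G\<^esub> C) (C \<otimes>\<^bsub>G\<^esub> V) = 0"
proof (rule d_eq_0I)
  let ?Q = "\<lambda>x. \<not> (x \<in> supp M C \<and> x \<in> supp M V)"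
  have Q: "AE x in M. ?Q x" using disj by (simp add: ae_disjoint_def)
  show "AE x in M. (V \<otimes>\<^bsub>G\<^esub> C) x = (C \<otimes>\<^bsub>G\<^esub> V) x"
    using Q mp_auts_AE[OF C Q] mp_auts_AE[OF V Q] AE_space
  proof eventually_elim
    case (elim x)
    have sp: "C x \<in> space M" "V x \<in> space M" using elim(4) C V by (auto intro: mp_auts_space)
    have "C (C x) \<noteq> C x" if "C x \<noteq> x" using that mp_auts_inj[OF C sp(1) elim(4)] by simp
    moreover have "V (V x) \<noteq> V x" if "V x \<noteq> x" using that mp_auts_inj[OF V sp(2) elim(4)] by simp
    ultimately have "V (C x) = C (V x)"
      using elim sp unfolding supp_def by (metis (mono_tags, lifting) mem_Collect_eq)
    then show ?case using elim(4) C V by (simp add: mp_mult_apply)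
  qed
qed

text \<open>The law for powers of commuting elements, with distance 0 in the role of equality;
  invariance of \<open>d\<close> allows substitution inside products.\<close>

lemma pow_mult_commuting:
  assumes C: "C \<in> mp_auts M" and V: "V \<in> mp_auts M" and comm: "d (V \<otimes>\<^bsub>G\<^esub> C) (C \<otimes>\<^bsub>G\<^esub> V) = 0"
  shows "d ((C \<otimes>\<^bsub>G\<^esub> V) [^]\<^bsub>G\<^esub> (k::nat)) (C [^]\<^bsub>G\<^esub> k \<otimes>\<^bsub>G\<^esub> V [^]\<^bsub>G\<^esub> k) = 0"
proof -
  have VC: "d (V [^]\<^bsub>G\<^esub> k \<otimes>\<^bsub>G\<^esub> C) (C \<otimes>\<^bsub>G\<^esub> V [^]\<^bsub>G\<^esub> k) = 0" for k :: nat
  proof (induction k)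
    case 0
    then show ?case using C by simp
  next
    case (Suc k)
    have "d (V [^]\<^bsub>G\<^esub> Suc k \<otimes>\<^bsub>G\<^esub> C) (V [^]\<^bsub>G\<^esub> k \<otimes>\<^bsub>G\<^esub> C \<otimes>\<^bsub>G\<^esub> V) = 0"
      using comm C V d_left[of "V [^]\<^bsub>G\<^esub> k" "V \<otimes>\<^bsub>G\<^esub> C" "C \<otimes>\<^bsub>G\<^esub> V"] by (simp add: Aut.m_assoc)
    moreover have "d (V [^]\<^bsub>G\<^esub> k \<otimes>\<^bsub>G\<^esub> C \<otimes>\<^bsub>G\<^esub> V) (C \<otimes>\<^bsub>G\<^esub> V [^]\<^bsub>G\<^esub> Suc k) = 0"
      using Suc C V d_right[of V "V [^]\<^bsub>G\<^esub> k \<otimes>\<^bsub>G\<^esub> C" "C \<otimes>\<^bsub>G\<^esub> V [^]\<^bsub>G\<^esub> k"] by (simp add: Aut.m_assoc)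
    ultimately show ?case by (rule d_0_trans) (use C V in \<open>auto intro!: mult_mp pow_mp\<close>)
  qed
  show ?thesis
  proof (induction k)
    case 0
    then show ?case by simp
  next
    case (Suc k)
    have "d ((C \<otimes>\<^bsub>G\<^esub> V) [^]\<^bsub>G\<^esub> Suc k) (C [^]\<^bsub>G\<^esub> k \<otimes>\<^bsub>G\<^esub> V [^]\<^bsub>G\<^esub> k \<otimes>\<^bsub>G\<^esub> (C \<otimes>\<^bsub>G\<^esub> V)) = 0"
      using Suc C V d_right[of "C \<otimes>\<^bsub>G\<^esub> V" "(C \<otimes>\<^bsub>G\<^esub> V) [^]\<^bsub>G\<^esub> k" "C [^]\<^bsub>G\<^esub> k \<otimes>\<^bsub>G\<^esub> V [^]\<^bsub>G\<^esub> k"] by simp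
    moreover have "d (C [^]\<^bsub>G\<^esub> k \<otimes>\<^bsub>G\<^esub> V [^]\<^bsub>G\<^esub> k \<otimes>\<^bsub>G\<^esub> (C \<otimes>\<^bsub>G\<^esub> V)) (C [^]\<^bsub>G\<^esub> Suc k \<otimes>\<^bsub>G\<^esub> V [^]\<^bsub>G\<^esub> Suc k) = 0"
    proof -
      have "d (C [^]\<^bsub>G\<^esub> k \<otimes>\<^bsub>G\<^esub> (V [^]\<^bsub>G\<^esub> k \<otimes>\<^bsub>G\<^esub> C \<otimes>\<^bsub>G\<^esub> V)) (C [^]\<^bsub>G\<^esub> k \<otimes>\<^bsub>G\<^esub> (C \<otimes>\<^bsub>G\<^esub> V [^]\<^bsub>G\<^esub> k \<otimes>\<^bsub>G\<^esub> V))
          = d (V [^]\<^bsub>G\<^esub> k \<otimes>\<^bsub>G\<^esub> C \<otimes>\<^bsub>G\<^esub> V) (C \<otimes>\<^bsub>G\<^esub> V [^]\<^bsub>G\<^esub> k \<otimes>\<^bsub>G\<^esub> V)"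
        using C V by (intro d_left) auto
      also have "\<dots> = d (V [^]\<^bsub>G\<^esub> k \<otimes>\<^bsub>G\<^esub> C) (C \<otimes>\<^bsub>G\<^esub> V [^]\<^bsub>G\<^esub> k)"
        using C V by (intro d_right) auto
      finally show ?thesis using VC[of k] C V by (simp add: Aut.m_assoc)
    qed
    ultimately show ?case by (rule d_0_trans) (use C V in \<open>auto intro!: mult_mp pow_mp\<close>)
  qed
qed

end

section \<open>Recovering a power of U from its product with an odd cycle\<close>

context partitioned
begin

lemma odd_cycle_mult_closure:
  fixes m :: nat
  defines "V \<equiv> U [^]\<^bsub>P.G\<^esub> ((2::nat) ^ m)"
  assumes C: "odd_cycle \<Omega> C" and disj: "ae_disjoint \<Omega> (supp \<Omega> C) (supp \<Omega> V)"
  shows "V \<in> closed_group_generated \<Omega> {C \<otimes>\<^bsub>P.G\<^esub> V}"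
proof -
  have C_mp: "C \<in> mp_auts \<Omega>" using C by (simp add: odd_cycle_def is_cycle_def)
  have V_mp: "V \<in> mp_auts \<Omega>" unfolding V_def using U_mp by simp
  note [simp] = C_mp V_mp
  have "\<exists>W\<in>generate P.G {C \<otimes>\<^bsub>P.G\<^esub> V}. P.d V W < \<epsilon>" if \<epsilon>: "\<epsilon> > 0" for \<epsilon> :: real
  proof -
    obtain l :: nat where l: "odd l" "\<And>t. P.d (C [^]\<^bsub>P.G\<^esub> (l * t)) \<one>\<^bsub>P.G\<^esub> < \<epsilon> / 2"
      using P.odd_cycle_power_near_one[OF C, of "\<epsilon> / 2"] half_gt_zero[OF \<epsilon>] by blast
    have "(\<lambda>n. (1/2::real) ^ n) \<longlonglongrightarrow> 0" by (rule LIMSEQ_power_zero) simp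
    then have "\<forall>\<^sub>F n in sequentially. (1/2::real) ^ n < \<epsilon> / 8"
      using \<epsilon> by (intro order_tendstoD(2)) auto
    then obtain N where N: "\<And>n. n \<ge> N \<Longrightarrow> (1/2::real) ^ n < \<epsilon> / 8"
      by (auto simp: eventually_sequentially)
    have pN: "4 / 2 ^ p (m + N) < \<epsilon> / 2"
      using N[of "p (m + N)"] p_ge[of "m + N"] by (simp add: power_one_over field_simps)
    \<comment> \<open>As \<open>l\<close> is odd, Euler's theorem makes this power congruent to 1
      modulo 2 ^ N, while it stays a multiple of \<open>l\<close>. Thus it nearly kills
      \<open>C\<close> and nearly preserves \<open>V\<close>.\<close>
    define k where "k = l ^ totient (2 ^ N)"
    have "coprime l (2 ^ N)" using l(1) by simp
    then have "[k = 1] (mod 2 ^ N)" unfolding k_def by (rule euler_theorem)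
    moreover have "k \<noteq> 0" using l(1) by (auto simp: k_def odd_pos)
    ultimately obtain s where s: "k = 1 + s * 2 ^ N" using cong_to_1'_nat[of k "2 ^ N"] by blast
    have "l dvd k" unfolding k_def by (intro dvd_power) simp
    then obtain t where t: "k = l * t" by blast
    \<comment> \<open>Writing \<open>k\<close> as 1 + s * 2 ^ N leaves \<open>V\<close> times a
      power of \<open>U\<close> with exponent divisible by 2 ^ (m + N), which is close to the
      identity.\<close>
    have V_pow: "V [^]\<^bsub>P.G\<^esub> k = V \<otimes>\<^bsub>P.G\<^esub> U [^]\<^bsub>P.G\<^esub> (2 ^ (m + N) * s)"
    proof -
      have "V [^]\<^bsub>P.G\<^esub> k = V \<otimes>\<^bsub>P.G\<^esub> V [^]\<^bsub>P.G\<^esub> (2 ^ N * s)"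
        using P.Aut.nat_pow_mult[of V 1 "2 ^ N * s"] by (simp add: s mult.commute)
      also have "V [^]\<^bsub>P.G\<^esub> (2 ^ N * s) = U [^]\<^bsub>P.G\<^esub> (2 ^ (m + N) * s)"
        unfolding V_def using U_mp by (simp add: P.Aut.nat_pow_pow power_add mult.assoc)
      finally show ?thesis .
    qed
    let ?W = "(C \<otimes>\<^bsub>P.G\<^esub> V) [^]\<^bsub>P.G\<^esub> k"
    have U_mp': "U [^]\<^bsub>P.G\<^esub> ((2::nat) ^ (m + N) * s) \<in> mp_auts \<Omega>" using U_mp by simp
    have "P.d V (V [^]\<^bsub>P.G\<^esub> k) = P.d (V \<otimes>\<^bsub>P.G\<^esub> \<one>\<^bsub>P.G\<^esub>) (V \<otimes>\<^bsub>P.G\<^esub> U [^]\<^bsub>P.G\<^esub> ((2::nat) ^ (m + N) * s))"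
      by (simp add: V_pow)
    also have "\<dots> = P.d \<one>\<^bsub>P.G\<^esub> (U [^]\<^bsub>P.G\<^esub> ((2::nat) ^ (m + N) * s))"
      by (rule P.d_left) (use U_mp' in auto)
    also have "\<dots> = P.d (U [^]\<^bsub>P.G\<^esub> ((2::nat) ^ (m + N) * s)) \<one>\<^bsub>P.G\<^esub>"
      by (rule P.d_sym)
    also have "\<dots> \<le> 4 / 2 ^ p (m + N)" by (rule U_pow_near_id)
    also note pN
    finally have dV: "P.d V (V [^]\<^bsub>P.G\<^esub> k) < \<epsilon> / 2" .
    have "P.d (\<one>\<^bsub>P.G\<^esub> \<otimes>\<^bsub>P.G\<^esub> V) (C [^]\<^bsub>P.G\<^esub> k \<otimes>\<^bsub>P.G\<^esub> V [^]\<^bsub>P.G\<^esub> k) \<le>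
        P.d \<one>\<^bsub>P.G\<^esub> (C [^]\<^bsub>P.G\<^esub> k) + P.d V (V [^]\<^bsub>P.G\<^esub> k)"
      by (intro P.d_mult) auto
    also have "P.d \<one>\<^bsub>P.G\<^esub> (C [^]\<^bsub>P.G\<^esub> k) < \<epsilon> / 2" using l(2)[of t] by (subst P.d_sym) (simp add: t)
    finally have "P.d V (C [^]\<^bsub>P.G\<^esub> k \<otimes>\<^bsub>P.G\<^esub> V [^]\<^bsub>P.G\<^esub> k) < \<epsilon>" using dV by simp
    moreover have "P.d (C [^]\<^bsub>P.G\<^esub> k \<otimes>\<^bsub>P.G\<^esub> V [^]\<^bsub>P.G\<^esub> k) ?W = 0"
      using P.pow_mult_commuting[OF C_mp V_mp P.ae_disjoint_commute[OF C_mp V_mp disj], of k]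
      by (simp add: P.d_sym)
    moreover have "P.d V ?W \<le> P.d V (C [^]\<^bsub>P.G\<^esub> k \<otimes>\<^bsub>P.G\<^esub> V [^]\<^bsub>P.G\<^esub> k) + P.d (C [^]\<^bsub>P.G\<^esub> k \<otimes>\<^bsub>P.G\<^esub> V [^]\<^bsub>P.G\<^esub> k) ?W"
      by (rule P.d_triangle) auto
    ultimately have "P.d V ?W < \<epsilon>" by simp
    moreover have "?W \<in> generate P.G {C \<otimes>\<^bsub>P.G\<^esub> V}"
      by (induction k) (auto intro: generate.one generate.eng generate.incl)
    ultimately show ?thesis by blast
  qed
  then show ?thesis
    using V_mp by (simp add: closed_group_generated_def unif_closure_def)
qed

end

theorem theorem4p1:
  fixes \<nu> :: "'a measure" and P :: "nat \<Rightarrow> 'a set"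
  assumes "standard_prob_space \<nu>"
    and "ae_partition \<nu> P"
  shows "\<exists>U \<in> full_group (X_space \<nu>) (R0Y \<nu>).
           ae_subset (X_space \<nu>) (supp (X_space \<nu>) U) (Z_set P) \<and>
           (\<forall>m::nat.
              topologically_generates (X_space \<nu>)
                {odometerY \<nu>, U [^]\<^bsub>mp_aut_group (X_space \<nu>)\<^esub> ((2::nat) ^ m)}
                (full_group (X_space \<nu>) (R0Y \<nu>)) \<and>
              (\<forall>C. odd_cycle (X_space \<nu>) C \<and>
                   ae_disjoint (X_space \<nu>) (supp (X_space \<nu>) C)
                     (supp (X_space \<nu>) (U [^]\<^bsub>mp_aut_group (X_space \<nu>)\<^esub> ((2::nat) ^ m))) \<longrightarrow>
                   U [^]\<^bsub>mp_aut_group (X_space \<nu>)\<^esub> ((2::nat) ^ m)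
                     \<in> closed_group_generated (X_space \<nu>)
                         {C \<otimes>\<^bsub>mp_aut_group (X_space \<nu>)\<^esub>
                            (U [^]\<^bsub>mp_aut_group (X_space \<nu>)\<^esub> ((2::nat) ^ m))}))"
proof -
  obtain \<G> where \<G>: "countable \<G>" "\<G> \<subseteq> sets \<nu>" "space \<nu> \<in> \<G>" "Int_stable \<G>"
    "sets \<nu> = sigma_sets (space \<nu>) \<G>"
    "\<And>x y. \<lbrakk>x \<in> space \<nu>; y \<in> space \<nu>; x \<noteq> y\<rbrakk> \<Longrightarrow> \<exists>A\<in>\<G>. x \<in> A \<and> y \<notin> A"
    using assms(1) standard_borel_space_generator unfolding standard_prob_space_def by metis
  define gen where "gen = from_nat_into \<G>"
  have range: "range gen = \<G>"
    unfolding gen_def using \<G>(1,3) by (intro range_from_nat_into) auto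
  have "prob_space \<nu>" using assms(1) by (simp add: standard_prob_space_def)
  then interpret prob_space \<nu> .
  interpret partitioned \<nu> gen P
  proof
    show "gen i \<in> sets \<nu>" for i using range \<G>(2) by blast
    show "space \<nu> \<in> range gen" "Int_stable (range gen)" "sets \<nu> = sigma_sets (space \<nu>) (range gen)"
      using \<G> range by simp_all
    show "\<exists>i. x \<in> gen i \<and> y \<notin> gen i" if "x \<in> space \<nu>" "y \<in> space \<nu>" "x \<noteq> y" for x y
      using \<G>(6)[OF that] range by blast
    show "P k \<in> sets \<nu>" for k using assms(2) by (simp add: ae_partition_def)
    have "AE y in \<nu>. \<exists>!k. y \<in> P k" using assms(2) by (simp add: ae_partition_def)
    then show "AE y in \<nu>. \<exists>k. y \<in> P k" by eventually_elim blast
  qed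
  show ?thesis
  proof (rule bexI[OF _ U_full], intro conjI allI impI)
    show "ae_subset \<Omega> (supp \<Omega> U) (Z_set P)"
      using supp_U by (auto simp: ae_subset_def)
  next
    fix m
    interpret D: generating \<nu> gen P m ..
    show "topologically_generates \<Omega> {T, U [^]\<^bsub>P.G\<^esub> ((2::nat) ^ m)} (full_group \<Omega> (R0Y \<nu>))"
      unfolding topologically_generates_def
    proof
      have "U [^]\<^bsub>P.G\<^esub> ((2::nat) ^ m) \<in> full_group \<Omega> (R0Y \<nu>)"
        unfolding U_pow by (rule glue_full[OF admissible_funpow[OF admissible_cyc]])
      then show "generate P.G {T, U [^]\<^bsub>P.G\<^esub> ((2::nat) ^ m)} \<subseteq> full_group \<Omega> (R0Y \<nu>)"
        using T_full by (intro P.Aut.generate_subgroup_incl full_group_subgroup) simp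
      show "full_group \<Omega> (R0Y \<nu>) \<subseteq> closed_group_generated \<Omega> {T, U [^]\<^bsub>P.G\<^esub> ((2::nat) ^ m)}"
        using D.full_group_H by (auto simp: closed_group_generated_def D.V_def)
    qed
  next
    fix m C
    assume "odd_cycle \<Omega> C \<and> ae_disjoint \<Omega> (supp \<Omega> C) (supp \<Omega> (U [^]\<^bsub>P.G\<^esub> ((2::nat) ^ m)))"
    then show "U [^]\<^bsub>P.G\<^esub> ((2::nat) ^ m) \<in> closed_group_generated \<Omega> {C \<otimes>\<^bsub>P.G\<^esub> U [^]\<^bsub>P.G\<^esub> ((2::nat) ^ m)}"
      by (intro odd_cycle_mult_closure) auto
  qed
qed

end
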